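(* Let $\mathfrak{H}$ be a Schunck formation of soluble Leibniz algebras over a field $F$, let $L$ be a finite-dimensional soluble Leibniz algebra over $F$, and let $H$ be an $\mathfrak{H}$-projector of $L$. Then $H$ is intravariant in $L$.
   Context: Leibniz algebras are left Leibniz algebras: algebras $L$ over a field $F$ with $a(bc)=(ab)c+b(ac)$ for all $a,b,c\in L$. Ideals are two-sided. $L$ is soluble if its derived series ($L^{(0)}=L$, $L^{(i+1)}=L^{(i)}L^{(i)}$) reaches $0$. Classes: All classes consist of finite-dimensional soluble Leibniz algebras over $F$, are non-empty and closed under isomorphism. A soluble Leibniz algebra $P$ is primitive if it has a minimal ideal $C$ with $\mathcal{C}_P(C)=C$, where $\mathcal{C}_P(C)=\{x\in P: xC=Cx=0\}$. A class $\mathfrak{X}$ is a Schunck class if it is exactly the class of all finite-dimensional soluble Leibniz algebras all of whose primitive quotients lie in $\mathfrak{X}$. A class $\mathfrak{X}$ is a formation if it is closed under quotients and under subdirect sums (if $L$ has ideals $K_i$ with $\bigcap_i K_i=0$ and all $L/K_i\in\mathfrak{X}$, then $L\in\mathfrak{X}$). A Schunck formation is a Schunck class which is a formation. Projectors: a subalgebra $U$ of $L$ is $\mathfrak{H}$-maximal in $L$ if it is maximal (under inclusion) among the subalgebras of $L$ which are in $\mathfrak{H}$. $U$ is an $\mathfrak{H}$-projector of $L$ if, for every ideal $K$ of $L$, $(U+K)/K$ is $\mathfrak{H}$-maximal in $L/K$. Intravariance: $\mathrm{Leib}(L)$ is the linear span of $\{x^2: x\in L\}$. An antiderivation of $L$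 is a linear map $D:L\to L$ with $D(xy)=x\,D(y)-y\,D(x)$. A biderivation is a pair $(d,D)$ with $d$ a derivation and $D$ an antiderivation of $L$ such that $(dx)y=(Dx)y$ for all $x,y\in L$. Biderivations are added componentwise. The inner biderivation given by $a\in L$ is $(\mathrm{ad}_a,\mathrm{Ad}_a)$ with $\mathrm{ad}_a(x)=ax$, $\mathrm{Ad}_a(x)=-xa$. A pair $(d,D)$ of a derivation and an antiderivation is close if $(d-D)L\subseteq\mathrm{Leib}(L)$ (it is then a biderivation). A biderivation $(d,D)$ stabilises a subalgebra $U$ if $dU\subseteq U$ and $DU\subseteq U$. A subalgebra $U$ of $L$ is intravariant in $L$ if every close biderivation of $L$ is the sum of an inner biderivation and a biderivation which stabilises $U$. *)

theory Defs
  imports "Jordan_Normal_Form.Missing_VectorSpace" "HOL-Algebra.QuotRing"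
begin

text \<open>
  An algebra over \<open>F\<close> is carried by the \<^typ>\<open>('f, 'a) module\<close> record of HOL-Algebra; the field
  \<open>mult\<close> is the (in general non-associative) product and the field \<open>one\<close> is never referred to.
\<close>

locale leibniz_algebra = vectorspace F L
  for F :: "('f, 'm) ring_scheme" and L :: "('f, 'a, 'n) module_scheme" (structure) +
  assumes mult_closed: "\<lbrakk>x \<in> carrier L; y \<in> carrier L\<rbrakk> \<Longrightarrow> x \<otimes> y \<in> carrier L"
    and mult_add_left: "\<lbrakk>x \<in> carrier L; y \<in> carrier L; z \<in> carrier L\<rbrakk>
      \<Longrightarrow> (x \<oplus> y) \<otimes> z = x \<otimes> z \<oplus> y \<otimes> z"
    and mult_add_right: "\<lbrakk>x \<in> carrier L; y \<in> carrier L; z \<in> carrier L\<rbrakk>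
      \<Longrightarrow> x \<otimes> (y \<oplus> z) = x \<otimes> y \<oplus> x \<otimes> z"
    and mult_smult_left: "\<lbrakk>c \<in> carrier F; x \<in> carrier L; y \<in> carrier L\<rbrakk>
      \<Longrightarrow> (c \<odot> x) \<otimes> y = c \<odot> (x \<otimes> y)"
    and mult_smult_right: "\<lbrakk>c \<in> carrier F; x \<in> carrier L; y \<in> carrier L\<rbrakk>
      \<Longrightarrow> x \<otimes> (c \<odot> y) = c \<odot> (x \<otimes> y)"
    and leibniz: "\<lbrakk>x \<in> carrier L; y \<in> carrier L; z \<in> carrier L\<rbrakk>
      \<Longrightarrow> x \<otimes> (y \<otimes> z) = (x \<otimes> y) \<otimes> z \<oplus> y \<otimes> (x \<otimes> z)"

abbreviation lin_span :: "('f, 'm) ring_scheme \<Rightarrow> ('f, 'a, 'n) module_scheme \<Rightarrow> 'a set \<Rightarrow> 'a set"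
  where "lin_span F L S \<equiv> LinearCombinations.module.span F L S"

definition subalgebra ::
    "('f, 'm) ring_scheme \<Rightarrow> ('f, 'a, 'n) module_scheme \<Rightarrow> 'a set \<Rightarrow> bool" where
  "subalgebra F L U \<longleftrightarrow> subspace F U L \<and> (\<forall>x\<in>U. \<forall>y\<in>U. x \<otimes>\<^bsub>L\<^esub> y \<in> U)"

definition alg_ideal ::
    "('f, 'm) ring_scheme \<Rightarrow> ('f, 'a, 'n) module_scheme \<Rightarrow> 'a set \<Rightarrow> bool" where
  "alg_ideal F L I \<longleftrightarrow> subspace F I L \<and>
     (\<forall>x\<in>carrier L. \<forall>a\<in>I. x \<otimes>\<^bsub>L\<^esub> a \<in> I \<and> a \<otimes>\<^bsub>L\<^esub> x \<in> I)"

definition quotient_alg :: "('f, 'a, 'n) module_scheme \<Rightarrow> 'a set \<Rightarrow> ('f, 'a set) module" where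
  "quotient_alg L K =
    \<lparr>carrier = a_rcosets\<^bsub>L\<^esub> K, mult = rcoset_mult L K, one = K +>\<^bsub>L\<^esub> \<one>\<^bsub>L\<^esub>,
     zero = K, add = set_add L, smult = (\<lambda>c A. \<Union>x\<in>A. K +>\<^bsub>L\<^esub> (c \<odot>\<^bsub>L\<^esub> x))\<rparr>"

text \<open>\<open>(U + K)/K\<close> as a subset of \<open>L/K\<close>\<close>

definition quotient_image :: "('f, 'a, 'n) module_scheme \<Rightarrow> 'a set \<Rightarrow> 'a set \<Rightarrow> 'a set set" where
  "quotient_image L K U = (\<lambda>x. K +>\<^bsub>L\<^esub> x) ` (U <+>\<^bsub>L\<^esub> K)"

primrec derived_series ::
    "('f, 'm) ring_scheme \<Rightarrow> ('f, 'a, 'n) module_scheme \<Rightarrow> nat \<Rightarrow> 'a set" where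
  "derived_series F L 0 = carrier L"
| "derived_series F L (Suc i) =
     lin_span F L {x \<otimes>\<^bsub>L\<^esub> y | x y. x \<in> derived_series F L i \<and> y \<in> derived_series F L i}"

text \<open>Soluble Leibniz algebras over \<open>F\<close>, always taken finite-dimensional\<close>

definition soluble_leibniz ::
    "('f, 'm) ring_scheme \<Rightarrow> ('f, 'a, 'n) module_scheme \<Rightarrow> bool" where
  "soluble_leibniz F L \<longleftrightarrow> leibniz_algebra F L \<and> vectorspace.fin_dim F L \<and>
     (\<exists>n. derived_series F L n = {\<zero>\<^bsub>L\<^esub>})"

definition alg_iso :: "('f, 'm) ring_scheme \<Rightarrow> ('f, 'a, 'n) module_scheme \<Rightarrow>
    ('f, 'b, 'k) module_scheme \<Rightarrow> bool" where
  "alg_iso F A B \<longleftrightarrow> (\<exists>\<phi> \<in> module_hom F A B. bij_betw \<phi> (carrier A) (carrier B) \<and>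
     (\<forall>x\<in>carrier A. \<forall>y\<in>carrier A. \<phi> (x \<otimes>\<^bsub>A\<^esub> y) = \<phi> x \<otimes>\<^bsub>B\<^esub> \<phi> y))"

text \<open>
  A class of algebras must contain algebras with carriers in arbitrary types. Up to isomorphism
  every finite-dimensional algebra over \<open>F\<close> has a carrier in the type \<^typ>\<open>nat \<Rightarrow> 'f\<close> (namely
  coordinate tuples \<open>{..<n} \<rightarrow>\<^sub>E carrier F\<close>). So an isomorphism-closed class is given by its members
  with carriers in that type, and an arbitrary algebra lies in the class iff it is isomorphic to
  such a member.
\<close>

type_synonym 'f alg_class = "('f, nat \<Rightarrow> 'f) module set"

definition in_class :: "('f, 'm) ring_scheme \<Rightarrow> 'f alg_class \<Rightarrow>
    ('f, 'a, 'n) module_scheme \<Rightarrow> bool" where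
  "in_class F \<X> L \<longleftrightarrow> (\<exists>A\<in>\<X>. alg_iso F A L)"

definition leibniz_class :: "('f, 'm) ring_scheme \<Rightarrow> 'f alg_class \<Rightarrow> bool" where
  "leibniz_class F \<X> \<longleftrightarrow> \<X> \<noteq> {} \<and> (\<forall>A\<in>\<X>. soluble_leibniz F A) \<and>
     (\<forall>A\<in>\<X>. \<forall>B. soluble_leibniz F B \<and> alg_iso F A B \<longrightarrow> B \<in> \<X>)"

definition minimal_ideal ::
    "('f, 'm) ring_scheme \<Rightarrow> ('f, 'a, 'n) module_scheme \<Rightarrow> 'a set \<Rightarrow> bool" where
  "minimal_ideal F L C \<longleftrightarrow> alg_ideal F L C \<and> C \<noteq> {\<zero>\<^bsub>L\<^esub>} \<and>
     (\<forall>J. alg_ideal F L J \<and> J \<subseteq> C \<longrightarrow> J = {\<zero>\<^bsub>L\<^esub>} \<or> J = C)"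

definition alg_centraliser :: "('f, 'a, 'n) module_scheme \<Rightarrow> 'a set \<Rightarrow> 'a set" where
  "alg_centraliser P C =
     {x \<in> carrier P. \<forall>c\<in>C. x \<otimes>\<^bsub>P\<^esub> c = \<zero>\<^bsub>P\<^esub> \<and> c \<otimes>\<^bsub>P\<^esub> x = \<zero>\<^bsub>P\<^esub>}"

definition primitive_alg :: "('f, 'm) ring_scheme \<Rightarrow> ('f, 'a, 'n) module_scheme \<Rightarrow> bool" where
  "primitive_alg F P \<longleftrightarrow> soluble_leibniz F P \<and>
     (\<exists>C. minimal_ideal F P C \<and> alg_centraliser P C = C)"

definition schunck_class :: "('f, 'm) ring_scheme \<Rightarrow> 'f alg_class \<Rightarrow> bool" where
  "schunck_class F \<X> \<longleftrightarrow> leibniz_class F \<X> \<and>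
     (\<forall>L. L \<in> \<X> \<longleftrightarrow> soluble_leibniz F L \<and>
        (\<forall>K. alg_ideal F L K \<and> primitive_alg F (quotient_alg L K)
           \<longrightarrow> in_class F \<X> (quotient_alg L K)))"

text \<open>
  In the subdirect sum condition \<open>\<K>\<close> may be infinite. It is taken non-empty because
  \<open>\<Inter>{}\<close> is the universal set in HOL.
\<close>

definition alg_formation :: "('f, 'm) ring_scheme \<Rightarrow> 'f alg_class \<Rightarrow> bool" where
  "alg_formation F \<X> \<longleftrightarrow> leibniz_class F \<X> \<and>
     (\<forall>L\<in>\<X>. \<forall>K. alg_ideal F L K \<longrightarrow> in_class F \<X> (quotient_alg L K)) \<and>
     (\<forall>L \<K>. soluble_leibniz F L \<and> \<K> \<noteq> {} \<and> \<Inter>\<K> = {\<zero>\<^bsub>L\<^esub>} \<and>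
        (\<forall>K\<in>\<K>. alg_ideal F L K \<and> in_class F \<X> (quotient_alg L K)) \<longrightarrow> L \<in> \<X>)"

definition schunck_formation :: "('f, 'm) ring_scheme \<Rightarrow> 'f alg_class \<Rightarrow> bool" where
  "schunck_formation F \<X> \<longleftrightarrow> schunck_class F \<X> \<and> alg_formation F \<X>"

definition class_maximal :: "('f, 'm) ring_scheme \<Rightarrow> 'f alg_class \<Rightarrow>
    ('f, 'a, 'n) module_scheme \<Rightarrow> 'a set \<Rightarrow> bool" where
  "class_maximal F \<X> L U \<longleftrightarrow> subalgebra F L U \<and> in_class F \<X> (L\<lparr>carrier := U\<rparr>) \<and>
     (\<forall>V. subalgebra F L V \<and> in_class F \<X> (L\<lparr>carrier := V\<rparr>) \<and> U \<subseteq> V \<longrightarrow> V = U)"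

definition projector :: "('f, 'm) ring_scheme \<Rightarrow> 'f alg_class \<Rightarrow>
    ('f, 'a, 'n) module_scheme \<Rightarrow> 'a set \<Rightarrow> bool" where
  "projector F \<X> L U \<longleftrightarrow> subalgebra F L U \<and>
     (\<forall>K. alg_ideal F L K \<longrightarrow> class_maximal F \<X> (quotient_alg L K) (quotient_image L K U))"

definition Leib :: "('f, 'm) ring_scheme \<Rightarrow> ('f, 'a, 'n) module_scheme \<Rightarrow> 'a set" where
  "Leib F L = lin_span F L {x \<otimes>\<^bsub>L\<^esub> x | x. x \<in> carrier L}"

definition derivation :: "('f, 'm) ring_scheme \<Rightarrow> ('f, 'a, 'n) module_scheme \<Rightarrow>
    ('a \<Rightarrow> 'a) \<Rightarrow> bool" where
  "derivation F L d \<longleftrightarrow> d \<in> module_hom F L L \<and>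
     (\<forall>x\<in>carrier L. \<forall>y\<in>carrier L. d (x \<otimes>\<^bsub>L\<^esub> y) = d x \<otimes>\<^bsub>L\<^esub> y \<oplus>\<^bsub>L\<^esub> x \<otimes>\<^bsub>L\<^esub> d y)"

definition antiderivation :: "('f, 'm) ring_scheme \<Rightarrow> ('f, 'a, 'n) module_scheme \<Rightarrow>
    ('a \<Rightarrow> 'a) \<Rightarrow> bool" where
  "antiderivation F L D \<longleftrightarrow> D \<in> module_hom F L L \<and>
     (\<forall>x\<in>carrier L. \<forall>y\<in>carrier L. D (x \<otimes>\<^bsub>L\<^esub> y) = x \<otimes>\<^bsub>L\<^esub> D y \<ominus>\<^bsub>L\<^esub> y \<otimes>\<^bsub>L\<^esub> D x)"

definition biderivation :: "('f, 'm) ring_scheme \<Rightarrow> ('f, 'a, 'n) module_scheme \<Rightarrow>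
    ('a \<Rightarrow> 'a) \<times> ('a \<Rightarrow> 'a) \<Rightarrow> bool" where
  "biderivation F L = (\<lambda>(d, D). derivation F L d \<and> antiderivation F L D \<and>
     (\<forall>x\<in>carrier L. \<forall>y\<in>carrier L. d x \<otimes>\<^bsub>L\<^esub> y = D x \<otimes>\<^bsub>L\<^esub> y))"

definition close :: "('f, 'm) ring_scheme \<Rightarrow> ('f, 'a, 'n) module_scheme \<Rightarrow>
    ('a \<Rightarrow> 'a) \<times> ('a \<Rightarrow> 'a) \<Rightarrow> bool" where
  "close F L = (\<lambda>(d, D). \<forall>x\<in>carrier L. d x \<ominus>\<^bsub>L\<^esub> D x \<in> Leib F L)"

definition inner_biderivation :: "('f, 'a, 'n) module_scheme \<Rightarrow> 'a \<Rightarrow>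
    ('a \<Rightarrow> 'a) \<times> ('a \<Rightarrow> 'a)" where
  "inner_biderivation L a = (\<lambda>x. a \<otimes>\<^bsub>L\<^esub> x, \<lambda>x. \<ominus>\<^bsub>L\<^esub> (x \<otimes>\<^bsub>L\<^esub> a))"

definition stabilises :: "('a \<Rightarrow> 'a) \<times> ('a \<Rightarrow> 'a) \<Rightarrow> 'a set \<Rightarrow> bool" where
  "stabilises b U \<longleftrightarrow> fst b ` U \<subseteq> U \<and> snd b ` U \<subseteq> U"

definition is_sum_of :: "('f, 'a, 'n) module_scheme \<Rightarrow> ('a \<Rightarrow> 'a) \<times> ('a \<Rightarrow> 'a) \<Rightarrow>
    ('a \<Rightarrow> 'a) \<times> ('a \<Rightarrow> 'a) \<Rightarrow> ('a \<Rightarrow> 'a) \<times> ('a \<Rightarrow> 'a) \<Rightarrow> bool" where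
  "is_sum_of L b b1 b2 \<longleftrightarrow> (\<forall>x\<in>carrier L.
     fst b x = fst b1 x \<oplus>\<^bsub>L\<^esub> fst b2 x \<and> snd b x = snd b1 x \<oplus>\<^bsub>L\<^esub> snd b2 x)"

definition intravariant :: "('f, 'm) ring_scheme \<Rightarrow> ('f, 'a, 'n) module_scheme \<Rightarrow>
    'a set \<Rightarrow> bool" where
  "intravariant F L U \<longleftrightarrow> subalgebra F L U \<and>
     (\<forall>b. biderivation F L b \<and> close F L b \<longrightarrow>
        (\<exists>a\<in>carrier L. \<exists>b'. biderivation F L b' \<and> stabilises b' U \<and>
           is_sum_of L b (inner_biderivation L a) b'))"

end

theory Submission
  imports Defs
begin

text \<open>
  Write \<open>L_i\<close> for the \<open>i\<close>-th term of the derived series, suppose that \<open>d\<close> and \<open>D\<close> map \<open>H\<close> into \<open>H + L_i\<close>,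
  and put \<open>V = L_i\<close> and \<open>W = V \<inter> (H + L_(i+1))\<close>. Then \<open>d\<close> induces a cocycle of \<open>H\<close> in the bimodule \<open>V/W\<close>.
  If it is inner, subtracting the inner biderivation of some \<open>v \<in> V\<close> moves \<open>d H\<close> into \<open>H + L_(i+1)\<close>. After
  that, \<open>D\<close> induces a cocycle in the part of \<open>V/W\<close> with zero right action, provided that this part is given
  the symmetric right action \<open>v x = - x v\<close> instead.

  Maximality of \<open>H\<close> modulo \<open>L_(i+1)\<close> means that no submodule \<open>U/W \<noteq> 0\<close> is central, that is, has its split
  extension by \<open>H\<close> in the class, and this forces every cocycle to be inner. On a simple non-central module
  a cocycle vanishes on the annihilator, because otherwise the module would be a chief factor of \<open>H\<close>; and
  some \<open>a\<close> in an ideal of \<open>H\<close> that acts commutatively acts bijectively, so that the value at \<open>a\<close> picks out an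
  inner cocycle, which then agrees everywhere. One passes from simple modules to all by showing that an
  extension of a central module by a simple non-central one splits: it is not in the class, so it has a
  primitive quotient outside the class, all of whose non-zero abelian ideals coincide, and this yields
  the complement. Finally, a module that is central with its symmetric right action is central with zero
  right action, so the change of right action above creates no central submodules.
\<close>

subsection \<open>Linear algebra modulo a subspace\<close>

text \<open>On the module side no quotient is formed: cocycles, simplicity and annihilators of V/W
  are written on V as congruences modulo W. Cosets would change the carrier type at every step of an
  induction on submodules, while the class lives in one fixed type. On the algebra side
  \<open>inq X K\<close> says that X/K lies in the class, and homomorphisms into a quotient are
  given by representatives.

  That d is corrected before D is forced by d(x)y = D(x)y: only once d(H) lies in H + L_(i+1) do the
  L_i-components of D have zero right action modulo W. The element then found for D has zero right
  action as well, so its inner biderivation does not move d(H) out again.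

  The obstacle in using the maximality of H is that H + U need not be a split extension of U by H,
  so a central U/W does not directly put (H + U)/L_(i+1) into the class. The primitive quotients of
  H + U have to be tested one by one, and here again it matters that two abelian ideals outside the
  kernel have the same image.\<close>

lemmas (in abelian_group) abelian_group_simprules
  [algebra abelian_group "zero G" "add G" "a_inv G" "a_minus G"] =
  a_closed zero_closed a_inv_closed minus_closed a_assoc l_zero l_neg a_comm minus_eq
  r_zero r_neg r_neg2 r_neg1 minus_add minus_minus minus_zero a_lcomm

text \<open>Stands in for equality of cosets of K, so that elements of a quotient vector space can
  be handled through representatives.\<close>

definition eqmod :: "('a, 'n) ring_scheme \<Rightarrow> 'a set \<Rightarrow> 'a \<Rightarrow> 'a \<Rightarrow> bool" where
  "eqmod L K x y \<longleftrightarrow> x \<ominus>\<^bsub>L\<^esub> y \<in> K"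

context vectorspace
begin

lemma subspaceI:
  assumes "S \<subseteq> carrier V" "\<zero>\<^bsub>V\<^esub> \<in> S" "\<And>x y. x \<in> S \<Longrightarrow> y \<in> S \<Longrightarrow> x \<oplus>\<^bsub>V\<^esub> y \<in> S"
    "\<And>c x. c \<in> carrier K \<Longrightarrow> x \<in> S \<Longrightarrow> c \<odot>\<^bsub>V\<^esub> x \<in> S"
  shows "subspace K S V"
  using assms module_axioms vectorspace_axioms
  by (auto simp: subspace_def LinearCombinations.submodule_def)

lemma subspaceD:
  assumes "subspace K S V"
  shows "S \<subseteq> carrier V" "\<zero>\<^bsub>V\<^esub> \<in> S" "\<And>x. x \<in> S \<Longrightarrow> x \<in> carrier V"
    "\<And>x y. x \<in> S \<Longrightarrow> y \<in> S \<Longrightarrow> x \<oplus>\<^bsub>V\<^esub> y \<in> S"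
    "\<And>c x. c \<in> carrier K \<Longrightarrow> x \<in> S \<Longrightarrow> c \<odot>\<^bsub>V\<^esub> x \<in> S"
    "\<And>x. x \<in> S \<Longrightarrow> \<ominus>\<^bsub>V\<^esub> x \<in> S" "\<And>x y. x \<in> S \<Longrightarrow> y \<in> S \<Longrightarrow> x \<ominus>\<^bsub>V\<^esub> y \<in> S"
proof -
  show 1: "S \<subseteq> carrier V" "\<zero>\<^bsub>V\<^esub> \<in> S" "\<And>x. x \<in> S \<Longrightarrow> x \<in> carrier V"
    and 2: "\<And>x y. x \<in> S \<Longrightarrow> y \<in> S \<Longrightarrow> x \<oplus>\<^bsub>V\<^esub> y \<in> S"
    and 3: "\<And>c x. c \<in> carrier K \<Longrightarrow> x \<in> S \<Longrightarrow> c \<odot>\<^bsub>V\<^esub> x \<in> S"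
    using assms by (auto simp: subspace_def LinearCombinations.submodule_def)
  show 4: "\<ominus>\<^bsub>V\<^esub> x \<in> S" if "x \<in> S" for x
    using 3[of "\<ominus>\<^bsub>K\<^esub> \<one>\<^bsub>K\<^esub>", OF _ that] smult_minus_1[OF 1(3)[OF that]] by simp
  show "\<And>x y. x \<in> S \<Longrightarrow> y \<in> S \<Longrightarrow> x \<ominus>\<^bsub>V\<^esub> y \<in> S"
    using 2 4 by (simp add: M.minus_eq)
qed

lemma subspace_carrier: "subspace K (carrier V) V"
  by (rule subspaceI) auto

lemma subspace_zero: "subspace K {\<zero>\<^bsub>V\<^esub>} V"
  by (rule subspaceI) auto

lemma subspace_Int: "subspace K S V \<Longrightarrow> subspace K T V \<Longrightarrow> subspace K (S \<inter> T) V"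
  by (rule subspaceI) (auto dest: subspaceD)

lemma set_add_iff: "x \<in> S <+>\<^bsub>V\<^esub> T \<longleftrightarrow> (\<exists>s\<in>S. \<exists>t\<in>T. x = s \<oplus>\<^bsub>V\<^esub> t)"
  by (auto simp: set_add_def')

lemma set_addI: "s \<in> S \<Longrightarrow> t \<in> T \<Longrightarrow> s \<oplus>\<^bsub>V\<^esub> t \<in> S <+>\<^bsub>V\<^esub> T"
  by (auto simp: set_add_iff)

lemma subspace_set_add:
  assumes S: "subspace K S V" and T: "subspace K T V"
  shows "subspace K (S <+>\<^bsub>V\<^esub> T) V"
proof (rule subspaceI)
  note [simp] = subspaceD[OF S] subspaceD[OF T]
  show "S <+>\<^bsub>V\<^esub> T \<subseteq> carrier V" by (auto simp: set_add_iff)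
  show "\<zero>\<^bsub>V\<^esub> \<in> S <+>\<^bsub>V\<^esub> T"
    using set_addI[of "\<zero>\<^bsub>V\<^esub>" S "\<zero>\<^bsub>V\<^esub>" T] by simp
  fix x y assume "x \<in> S <+>\<^bsub>V\<^esub> T" "y \<in> S <+>\<^bsub>V\<^esub> T"
  then obtain s t s' t' where *: "s \<in> S" "t \<in> T" "s' \<in> S" "t' \<in> T"
    "x = s \<oplus>\<^bsub>V\<^esub> t" "y = s' \<oplus>\<^bsub>V\<^esub> t'" by (auto simp: set_add_iff)
  then have "x \<oplus>\<^bsub>V\<^esub> y = (s \<oplus>\<^bsub>V\<^esub> s') \<oplus>\<^bsub>V\<^esub> (t \<oplus>\<^bsub>V\<^esub> t')"
    by (simp add: M.a_ac)
  then show "x \<oplus>\<^bsub>V\<^esub> y \<in> S <+>\<^bsub>V\<^esub> T"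
    using * by (simp add: set_addI)
next
  note [simp] = subspaceD[OF S] subspaceD[OF T]
  fix c x assume c: "c \<in> carrier K" and "x \<in> S <+>\<^bsub>V\<^esub> T"
  then obtain s t where *: "s \<in> S" "t \<in> T" "x = s \<oplus>\<^bsub>V\<^esub> t" by (auto simp: set_add_iff)
  then have "c \<odot>\<^bsub>V\<^esub> x = (c \<odot>\<^bsub>V\<^esub> s) \<oplus>\<^bsub>V\<^esub> (c \<odot>\<^bsub>V\<^esub> t)"
    using c by (simp add: smult_r_distr)
  then show "c \<odot>\<^bsub>V\<^esub> x \<in> S <+>\<^bsub>V\<^esub> T"
    using * c by (simp add: set_addI)
qed

lemma set_add_left: "subspace K T V \<Longrightarrow> S \<subseteq> carrier V \<Longrightarrow> S \<subseteq> S <+>\<^bsub>V\<^esub> T"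
proof
  fix x assume *: "subspace K T V" "S \<subseteq> carrier V" "x \<in> S"
  then have "x = x \<oplus>\<^bsub>V\<^esub> \<zero>\<^bsub>V\<^esub>" "\<zero>\<^bsub>V\<^esub> \<in> T" using subspaceD(2) by auto
  then show "x \<in> S <+>\<^bsub>V\<^esub> T" unfolding set_add_iff using * by blast
qed

lemma set_add_right: "subspace K S V \<Longrightarrow> T \<subseteq> carrier V \<Longrightarrow> T \<subseteq> S <+>\<^bsub>V\<^esub> T"
proof
  fix x assume *: "subspace K S V" "T \<subseteq> carrier V" "x \<in> T"
  then have "x = \<zero>\<^bsub>V\<^esub> \<oplus>\<^bsub>V\<^esub> x" "\<zero>\<^bsub>V\<^esub> \<in> S" using subspaceD(2) by auto
  then show "x \<in> S <+>\<^bsub>V\<^esub> T" unfolding set_add_iff using * by blast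
qed

text \<open>The rank of a subspace is the largest size of an independent subset of it.\<close>

lemma subspace_rank_exists:
  assumes fd: fin_dim
  shows "\<exists>r :: 'c set \<Rightarrow> nat. \<forall>S T. subspace K S V \<longrightarrow> subspace K T V \<longrightarrow> S \<subset> T \<longrightarrow> r S < r T \<and> r T \<le> dim"
proof -
  define N where "N S = {card A | A. A \<subseteq> S \<and> lin_indpt A}" for S :: "'c set"
  have fin: "finite (N S)" "\<And>n. n \<in> N S \<Longrightarrow> n \<le> dim" if "subspace K S V" for S
  proof -
    show le: "n \<le> dim" if "n \<in> N S" for n
    proof -
      from that obtain A where A: "A \<subseteq> S" "lin_indpt A" "n = card A" by (auto simp: N_def)
      show ?thesis using li_le_dim(2)[OF fd _ A(2)] A subspaceD(1)[OF \<open>subspace K S V\<close>] by auto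
    qed
    show "finite (N S)" using le finite_nat_set_iff_bounded_le[of "N S"] by blast
  qed
  have ne: "N S \<noteq> {}" for S
  proof -
    have "lin_indpt {}" unfolding lin_dep_def by auto
    then show ?thesis unfolding N_def by blast
  qed
  have "Max (N S) < Max (N T) \<and> Max (N T) \<le> dim"
    if S: "subspace K S V" and T: "subspace K T V" and ST: "S \<subset> T" for S T
  proof
    have "Max (N S) \<in> N S" using fin(1)[OF S] ne by (rule Max_in)
    then obtain A where A: "A \<subseteq> S" "lin_indpt A" "card A = Max (N S)" by (auto simp: N_def)
    from ST obtain t where t: "t \<in> T" "t \<notin> S" by auto
    have AV: "A \<subseteq> carrier V" using A(1) subspaceD(1)[OF S] by auto
    have "span A \<subseteq> S" using span_is_subset A(1) S by (auto simp: subspace_def)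
    then have "t \<notin> span A" using t by auto
    then have "lin_indpt (A \<union> {t})"
      using lin_dep_iff_in_span[OF AV A(2)] t A(1) subspaceD(3)[OF T] by blast
    then have "card (A \<union> {t}) \<in> N T" using A(1) ST t by (auto simp: N_def)
    moreover have "card (A \<union> {t}) = Suc (card A)"
      using t A(1) li_le_dim(1)[OF fd AV A(2)] by (auto simp: card_insert_if)
    ultimately have "Suc (card A) \<le> Max (N T)" using fin(1)[OF T] by simp
    then show "Max (N S) < Max (N T)" using A by simp
    show "Max (N T) \<le> dim" using fin[OF T] ne by simp
  qed
  then show ?thesis by (intro exI[of _ "\<lambda>S. Max (N S)"]) simp
qed

text \<open>Plays the part of induction on dimension: a member of least rank is minimal, because a
  proper subspace has smaller rank. It yields the minimal submodules used below and also shows that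
  descending chains of subspaces become stationary.\<close>

lemma minimal_subspace_exists:
  assumes fin_dim "P S" "\<And>T. P T \<Longrightarrow> subspace K T V"
  shows "\<exists>S. P S \<and> (\<forall>T. P T \<and> T \<subseteq> S \<longrightarrow> T = S)"
proof -
  obtain r :: "'c set \<Rightarrow> nat" where
    r: "\<And>S T. subspace K S V \<Longrightarrow> subspace K T V \<Longrightarrow> S \<subset> T \<Longrightarrow> r S < r T"
    using subspace_rank_exists[OF assms(1)] by blast
  obtain S' where S': "P S'" "\<And>T. P T \<Longrightarrow> r S' \<le> r T"
    using ex_has_least_nat[of P S r] assms(2) by blast
  have "T = S'" if "P T" "T \<subseteq> S'" for T
    using r[of T S'] S'(1) S'(2)[of T] that assms(3) by fastforce
  with S'(1) show ?thesis by blast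
qed

text \<open>If every member had a proper larger one, the ranks would grow beyond \<open>dim\<close>.
  The lemma picks a maximal counterexample in \<open>cocycle_inner\<close> and a hyperplane in
  \<open>functional_exists\<close>.\<close>

lemma maximal_subspace_exists:
  assumes fin_dim "P S" "\<And>T. P T \<Longrightarrow> subspace K T V"
  shows "\<exists>S. P S \<and> (\<forall>T. P T \<and> S \<subseteq> T \<longrightarrow> T = S)"
proof (rule ccontr)
  assume neg: "\<not> ?thesis"
  obtain r :: "'c set \<Rightarrow> nat" where
    r: "\<And>S T. subspace K S V \<Longrightarrow> subspace K T V \<Longrightarrow> S \<subset> T \<Longrightarrow> r S < r T \<and> r T \<le> dim"
    using subspace_rank_exists[OF assms(1)] by blast
  have "\<exists>T. P T \<and> n \<le> r T" for n
  proof (induction n)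
    case 0
    then show ?case using assms(2) by blast
  next
    case (Suc n)
    then obtain T where T: "P T" "n \<le> r T" by blast
    then obtain T' where T': "P T'" "T \<subset> T'" using neg by blast
    then have "r T < r T'" using r assms(3) T(1) by blast
    with T T' show ?case by (intro exI[of _ T']) simp
  qed
  then obtain T where T: "P T" "Suc dim \<le> r T" by blast
  then obtain T' where "P T'" "T \<subset> T'" using neg by blast
  then have "r T < r T' \<and> r T' \<le> dim" using r T(1) assms(3) by blast
  then show False using T by simp
qed

lemma subspace_fin_dim:
  assumes fd: fin_dim and S: "subspace K S V"
  shows "vectorspace.fin_dim K (V\<lparr>carrier := S\<rparr>)"
proof -
  define P where "P A \<longleftrightarrow> A \<subseteq> S \<and> lin_indpt A" for A
  have SV: "S \<subseteq> carrier V" using subspaceD[OF S] by auto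
  have "P {}" by (auto simp: P_def lin_dep_def)
  moreover have "\<And>A. P A \<Longrightarrow> finite A \<and> card A \<le> dim"
    using li_le_dim[OF fd] SV by (auto simp: P_def)
  ultimately obtain A where A: "finite A" "maximal A P" using maximal_exists by metis
  then have AS: "A \<subseteq> S" and li: "lin_indpt A" by (auto simp: maximal_def P_def)
  have AV: "A \<subseteq> carrier V" using AS SV by auto
  have "S \<subseteq> span A"
  proof
    fix s assume s: "s \<in> S"
    show "s \<in> span A"
    proof (cases "s \<in> A")
      case True
      then show ?thesis using in_own_span[OF AV] by auto
    next
      case False
      then have "\<not> P (A \<union> {s})" using A(2) by (auto simp: maximal_def)
      then have "lin_dep (A \<union> {s})" using s AS by (auto simp: P_def)
      then show ?thesis using lin_dep_iff_in_span[OF AV li _ False] s SV by auto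
    qed
  qed
  moreover have sub: "LinearCombinations.submodule K S V" using S by (simp add: subspace_def)
  ultimately have "LinearCombinations.module.span K (V\<lparr>carrier := S\<rparr>) A = S"
    using span_li_not_depend(1)[OF AS sub] span_is_subset[OF AS sub] by auto
  then show ?thesis
    using vectorspace.fin_dim_def[OF subspace_is_vs[OF S]] A(1) AS by auto
qed

text \<open>Injectivity is all that is asked for, because \<open>transport_exists\<close> carries an
  algebra structure along any injection. The target type is that of the members of a class, so this
  is how an algebra with an arbitrary carrier type comes to be compared with the class.\<close>

lemma coordinates_exist:
  assumes fin_dim
  shows "\<exists>\<phi> :: 'c \<Rightarrow> nat \<Rightarrow> 'a. inj_on \<phi> (carrier V)"
proof -
  obtain A where A: "finite A" "A \<subseteq> carrier V" "span A = carrier V"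
    using assms by (auto simp: fin_dim_def)
  obtain e :: "'c \<Rightarrow> nat" where e: "inj_on e A"
    using A(1) finite_imp_inj_to_nat_seg by metis
  have "\<forall>x\<in>carrier V. \<exists>a. a \<in> A \<rightarrow> carrier K \<and> lincomb a A = x"
    using finite_in_span[OF A(1,2)] A(3) by blast
  then obtain a where a: "\<And>x. x \<in> carrier V \<Longrightarrow> lincomb (a x) A = x"
    and ac: "\<And>x. x \<in> carrier V \<Longrightarrow> a x \<in> A \<rightarrow> carrier K" by metis
  define \<phi> where "\<phi> x = (\<lambda>i. a x (inv_into A e i))" for x
  have "inj_on \<phi> (carrier V)"
  proof (rule inj_onI)
    fix x y assume xy: "x \<in> carrier V" "y \<in> carrier V" "\<phi> x = \<phi> y"
    have *: "a x v = a y v" if "v \<in> A" for v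
      using fun_cong[OF xy(3), of "e v"] that e by (simp add: \<phi>_def)
    have "lincomb (a x) A = lincomb (a y) A"
      unfolding lincomb_def using A(2) ac[OF xy(1)] ac[OF xy(2)] *
      by (intro M.finsum_cong') (auto simp: Pi_def subset_iff)
    then show "x = y" using a[OF xy(1)] a[OF xy(2)] by simp
  qed
  then show ?thesis by blast
qed

section \<open>Congruence modulo a fixed subspace\<close>

context
  fixes S assumes S: "subspace K S V"
begin

lemma eqmod_refl [simp]: "x \<in> carrier V \<Longrightarrow> eqmod V S x x"
  using subspaceD(2)[OF S] by (simp add: eqmod_def M.minus_eq M.r_neg)

lemma eqmod_sym: "eqmod V S x y \<Longrightarrow> x \<in> carrier V \<Longrightarrow> y \<in> carrier V \<Longrightarrow> eqmod V S y x"
proof -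
  assume *: "eqmod V S x y" "x \<in> carrier V" "y \<in> carrier V"
  have "y \<ominus>\<^bsub>V\<^esub> x = \<ominus>\<^bsub>V\<^esub> (x \<ominus>\<^bsub>V\<^esub> y)" using *(2,3) by algebra
  then show ?thesis using subspaceD(6)[OF S] *(1) by (simp add: eqmod_def)
qed

lemma eqmod_trans:
  assumes "eqmod V S x y" "eqmod V S y z" "x \<in> carrier V" "y \<in> carrier V" "z \<in> carrier V"
  shows "eqmod V S x z"
proof -
  have "x \<ominus>\<^bsub>V\<^esub> z = (x \<ominus>\<^bsub>V\<^esub> y) \<oplus>\<^bsub>V\<^esub> (y \<ominus>\<^bsub>V\<^esub> z)" using assms(3-) by algebra
  then show ?thesis using subspaceD(4)[OF S] assms by (simp add: eqmod_def)
qed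

lemma eqmod_add:
  assumes "eqmod V S x y" "eqmod V S x' y'"
    "x \<in> carrier V" "y \<in> carrier V" "x' \<in> carrier V" "y' \<in> carrier V"
  shows "eqmod V S (x \<oplus>\<^bsub>V\<^esub> x') (y \<oplus>\<^bsub>V\<^esub> y')"
proof -
  have "(x \<oplus>\<^bsub>V\<^esub> x') \<ominus>\<^bsub>V\<^esub> (y \<oplus>\<^bsub>V\<^esub> y') = (x \<ominus>\<^bsub>V\<^esub> y) \<oplus>\<^bsub>V\<^esub> (x' \<ominus>\<^bsub>V\<^esub> y')"
    using assms(3-) by algebra
  then show ?thesis using subspaceD(4)[OF S] assms by (simp add: eqmod_def)
qed

lemma eqmod_uminus:
  assumes "eqmod V S x y" "x \<in> carrier V" "y \<in> carrier V"
  shows "eqmod V S (\<ominus>\<^bsub>V\<^esub> x) (\<ominus>\<^bsub>V\<^esub> y)"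
proof -
  have "(\<ominus>\<^bsub>V\<^esub> x) \<ominus>\<^bsub>V\<^esub> (\<ominus>\<^bsub>V\<^esub> y) = \<ominus>\<^bsub>V\<^esub> (x \<ominus>\<^bsub>V\<^esub> y)" using assms(2-) by algebra
  then show ?thesis using subspaceD(6)[OF S] assms by (simp add: eqmod_def)
qed

lemma eqmod_minus:
  assumes "eqmod V S x y" "eqmod V S x' y'"
    "x \<in> carrier V" "y \<in> carrier V" "x' \<in> carrier V" "y' \<in> carrier V"
  shows "eqmod V S (x \<ominus>\<^bsub>V\<^esub> x') (y \<ominus>\<^bsub>V\<^esub> y')"
  using assms eqmod_add eqmod_uminus by (simp add: M.minus_eq)

lemma eqmod_smult:
  assumes "eqmod V S x y" "c \<in> carrier K" "x \<in> carrier V" "y \<in> carrier V"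
  shows "eqmod V S (c \<odot>\<^bsub>V\<^esub> x) (c \<odot>\<^bsub>V\<^esub> y)"
proof -
  have "(c \<odot>\<^bsub>V\<^esub> x) \<ominus>\<^bsub>V\<^esub> (c \<odot>\<^bsub>V\<^esub> y) = c \<odot>\<^bsub>V\<^esub> (x \<ominus>\<^bsub>V\<^esub> y)"
    using assms(2-) by (simp add: M.minus_eq smult_r_distr smult_r_minus)
  then show ?thesis using subspaceD(5)[OF S] assms by (simp add: eqmod_def)
qed

lemma eqmod_zero: "x \<in> carrier V \<Longrightarrow> eqmod V S x \<zero>\<^bsub>V\<^esub> \<longleftrightarrow> x \<in> S"
proof -
  assume "x \<in> carrier V"
  then have "x \<ominus>\<^bsub>V\<^esub> \<zero>\<^bsub>V\<^esub> = x" by (simp add: M.minus_eq M.add.inv_one)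
  then show ?thesis by (simp add: eqmod_def)
qed

lemma eqmod_mem:
  assumes "eqmod V S x y" "subspace K T V" "S \<subseteq> T" "x \<in> carrier V" "y \<in> carrier V"
  shows "x \<in> T \<longleftrightarrow> y \<in> T"
proof -
  have "x = (x \<ominus>\<^bsub>V\<^esub> y) \<oplus>\<^bsub>V\<^esub> y" "y = \<ominus>\<^bsub>V\<^esub> (x \<ominus>\<^bsub>V\<^esub> y) \<oplus>\<^bsub>V\<^esub> x"
    using assms(4,5) by algebra+
  then show ?thesis using assms subspaceD(4,6)[OF assms(2)] by (metis eqmod_def subsetD)
qed

lemma coset_mem_iff: "x \<in> carrier V \<Longrightarrow> y \<in> carrier V \<Longrightarrow> y \<in> S +>\<^bsub>V\<^esub> x \<longleftrightarrow> eqmod V S y x"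
proof -
  assume *: "x \<in> carrier V" "y \<in> carrier V"
  have "y \<in> S +>\<^bsub>V\<^esub> x \<longleftrightarrow> (\<exists>h\<in>S. y = h \<oplus>\<^bsub>V\<^esub> x)" by (auto simp: a_r_coset_def')
  also have "\<dots> \<longleftrightarrow> y \<ominus>\<^bsub>V\<^esub> x \<in> S"
  proof
    assume "\<exists>h\<in>S. y = h \<oplus>\<^bsub>V\<^esub> x"
    then obtain h where h: "h \<in> S" "y = h \<oplus>\<^bsub>V\<^esub> x" by auto
    then have hc: "h \<in> carrier V" using subspaceD(3)[OF S] by auto
    have "(h \<oplus>\<^bsub>V\<^esub> x) \<ominus>\<^bsub>V\<^esub> x = h" using hc *(1) by algebra
    then show "y \<ominus>\<^bsub>V\<^esub> x \<in> S" using h by simp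
  next
    assume **: "y \<ominus>\<^bsub>V\<^esub> x \<in> S"
    have "y = (y \<ominus>\<^bsub>V\<^esub> x) \<oplus>\<^bsub>V\<^esub> x" using * by algebra
    then show "\<exists>h\<in>S. y = h \<oplus>\<^bsub>V\<^esub> x" using ** by blast
  qed
  finally show ?thesis by (simp add: eqmod_def)
qed

lemma coset_subset: "x \<in> carrier V \<Longrightarrow> S +>\<^bsub>V\<^esub> x \<subseteq> carrier V"
  using subspaceD(1)[OF S] by (auto simp: a_r_coset_def')

lemma coset_eq_iff:
  assumes "x \<in> carrier V" "y \<in> carrier V"
  shows "S +>\<^bsub>V\<^esub> x = S +>\<^bsub>V\<^esub> y \<longleftrightarrow> eqmod V S x y"
proof
  assume "S +>\<^bsub>V\<^esub> x = S +>\<^bsub>V\<^esub> y"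
  then show "eqmod V S x y" using coset_mem_iff[OF assms(1,1)] coset_mem_iff[OF assms(2,1)] assms by simp
next
  assume e: "eqmod V S x y"
  have "z \<in> S +>\<^bsub>V\<^esub> x \<longleftrightarrow> z \<in> S +>\<^bsub>V\<^esub> y" if "z \<in> carrier V" for z
    using coset_mem_iff assms that e eqmod_trans eqmod_sym by metis
  then show "S +>\<^bsub>V\<^esub> x = S +>\<^bsub>V\<^esub> y" using coset_subset assms by blast
qed

lemma set_add_eqmod: "T \<subseteq> carrier V \<Longrightarrow> x \<in> T <+>\<^bsub>V\<^esub> S \<longleftrightarrow> x \<in> carrier V \<and> (\<exists>t\<in>T. eqmod V S x t)"
proof -
  assume T: "T \<subseteq> carrier V"
  show ?thesis
  proof
    assume "x \<in> T <+>\<^bsub>V\<^esub> S"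
    then obtain t s where ts: "t \<in> T" "s \<in> S" "x = t \<oplus>\<^bsub>V\<^esub> s" by (auto simp: set_add_iff)
    then have c: "t \<in> carrier V" "s \<in> carrier V" using T subspaceD(3)[OF S] by auto
    have "(t \<oplus>\<^bsub>V\<^esub> s) \<ominus>\<^bsub>V\<^esub> t = s" using c by algebra
    then show "x \<in> carrier V \<and> (\<exists>t\<in>T. eqmod V S x t)" using ts c by (metis M.a_closed eqmod_def)
  next
    assume "x \<in> carrier V \<and> (\<exists>t\<in>T. eqmod V S x t)"
    then obtain t where t: "x \<in> carrier V" "t \<in> T" "x \<ominus>\<^bsub>V\<^esub> t \<in> S" by (auto simp: eqmod_def)
    then have c: "t \<in> carrier V" using T by auto
    have "x = t \<oplus>\<^bsub>V\<^esub> (x \<ominus>\<^bsub>V\<^esub> t)" using t(1) c by algebra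
    then show "x \<in> T <+>\<^bsub>V\<^esub> S" using t(2,3) set_addI by metis
  qed
qed

end

lemma eqmod_mono: "eqmod V S x y \<Longrightarrow> S \<subseteq> T \<Longrightarrow> eqmod V T x y"
  by (auto simp: eqmod_def)

section \<open>Restricting the carrier to a subspace\<close>

lemma subspace_restrict_iff:
  assumes U: "subspace K U V"
  shows "subspace K S (V\<lparr>carrier := U\<rparr>) \<longleftrightarrow> subspace K S V \<and> S \<subseteq> U"
proof -
  interpret U: vectorspace K "V\<lparr>carrier := U\<rparr>" by (rule subspace_is_vs[OF U])
  show ?thesis
  proof
    assume S: "subspace K S (V\<lparr>carrier := U\<rparr>)"
    show "subspace K S V \<and> S \<subseteq> U"
      using U.subspaceD[OF S] subspaceD[OF U] by (auto intro!: subspaceI)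
  next
    assume "subspace K S V \<and> S \<subseteq> U"
    then show "subspace K S (V\<lparr>carrier := U\<rparr>)"
      using subspaceD[of S] by (intro U.subspaceI) auto
  qed
qed

text \<open>Addition and scaling are fields of the record and survive a change of the carrier
  unchanged. Negation is defined by a search in the carrier, so here uniqueness of additive inverses
  has to be invoked.\<close>

lemma restrict_uminus:
  assumes U: "subspace K U V" and y: "y \<in> U"
  shows "\<ominus>\<^bsub>V\<lparr>carrier := U\<rparr>\<^esub> y = \<ominus>\<^bsub>V\<^esub> y"
proof -
  interpret U: vectorspace K "V\<lparr>carrier := U\<rparr>" by (rule subspace_is_vs[OF U])
  define m where "m = \<ominus>\<^bsub>V\<lparr>carrier := U\<rparr>\<^esub> y"
  have "m \<in> U" "y \<oplus>\<^bsub>V\<^esub> m = \<zero>\<^bsub>V\<^esub>"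
    using U.M.a_inv_closed[of y] U.M.r_neg[of y] y by (auto simp: m_def)
  moreover from this have "m \<in> carrier V" using subspaceD(3)[OF U] by auto
  ultimately have "m = \<ominus>\<^bsub>V\<^esub> y" using subspaceD(3)[OF U y] M.minus_equality M.a_comm by metis
  then show ?thesis by (simp add: m_def)
qed

lemma restrict_minus:
  "subspace K U V \<Longrightarrow> y \<in> U \<Longrightarrow> x \<ominus>\<^bsub>V\<lparr>carrier := U\<rparr>\<^esub> y = x \<ominus>\<^bsub>V\<^esub> y"
  by (simp add: a_minus_def restrict_uminus)

lemma restrict_eqmod:
  "subspace K U V \<Longrightarrow> x \<in> U \<Longrightarrow> y \<in> U \<Longrightarrow> eqmod (V\<lparr>carrier := U\<rparr>) S x y \<longleftrightarrow> eqmod V S x y"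
  by (simp add: eqmod_def restrict_minus)

lemma span_subsetI: "subspace K T V \<Longrightarrow> S \<subseteq> T \<Longrightarrow> span S \<subseteq> T"
  using span_is_subset by (auto simp: subspace_def)

end

subsection \<open>Ideals and the derived series\<close>

context leibniz_algebra
begin

lemma ideal_subspace: "alg_ideal F L I \<Longrightarrow> subspace F I L"
  by (simp add: alg_ideal_def)

lemma ideal_mult:
  "alg_ideal F L I \<Longrightarrow> x \<in> carrier L \<Longrightarrow> a \<in> I \<Longrightarrow> x \<otimes> a \<in> I"
  "alg_ideal F L I \<Longrightarrow> x \<in> carrier L \<Longrightarrow> a \<in> I \<Longrightarrow> a \<otimes> x \<in> I"
  by (auto simp: alg_ideal_def)

lemmas ideal_carrier = subspaceD(1)[OF ideal_subspace]

lemma mult_zero [simp]: "x \<in> carrier L \<Longrightarrow> x \<otimes> \<zero> = \<zero>" "x \<in> carrier L \<Longrightarrow> \<zero> \<otimes> x = \<zero>"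
proof -
  assume x: "x \<in> carrier L"
  show "x \<otimes> \<zero> = \<zero>"
    using mult_smult_right[of "\<zero>\<^bsub>F\<^esub>" x \<zero>] x mult_closed[of x \<zero>] by simp
  show "\<zero> \<otimes> x = \<zero>"
    using mult_smult_left[of "\<zero>\<^bsub>F\<^esub>" \<zero> x] x mult_closed[of \<zero> x] by simp
qed

lemma mult_uminus:
  assumes "x \<in> carrier L" "y \<in> carrier L"
  shows "x \<otimes> (\<ominus> y) = \<ominus> (x \<otimes> y)" "(\<ominus> x) \<otimes> y = \<ominus> (x \<otimes> y)"
  using mult_smult_right[of "\<ominus>\<^bsub>F\<^esub> \<one>\<^bsub>F\<^esub>" x y] mult_smult_left[of "\<ominus>\<^bsub>F\<^esub> \<one>\<^bsub>F\<^esub>" x y]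
    assms mult_closed by (simp_all add: smult_minus_1[symmetric])

lemma mult_minus:
  assumes "x \<in> carrier L" "y \<in> carrier L" "z \<in> carrier L"
  shows "x \<otimes> (y \<ominus> z) = x \<otimes> y \<ominus> x \<otimes> z" "(x \<ominus> y) \<otimes> z = x \<otimes> z \<ominus> y \<otimes> z"
  using assms by (simp_all add: M.minus_eq mult_add_left mult_add_right mult_uminus)

lemma leibniz_right:
  assumes "x \<in> carrier L" "y \<in> carrier L" "z \<in> carrier L"
  shows "(x \<otimes> y) \<otimes> z = x \<otimes> (y \<otimes> z) \<ominus> y \<otimes> (x \<otimes> z)"
proof -
  have c: "(x \<otimes> y) \<otimes> z \<in> carrier L" "y \<otimes> (x \<otimes> z) \<in> carrier L"
    using assms mult_closed by auto
  have "((x \<otimes> y) \<otimes> z \<oplus> y \<otimes> (x \<otimes> z)) \<ominus> y \<otimes> (x \<otimes> z) = (x \<otimes> y) \<otimes> z"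
    using c by algebra
  then show ?thesis using leibniz[OF assms] by simp
qed

lemma eqmod_mult:
  assumes I: "alg_ideal F L I" and "eqmod L I x y" "eqmod L I x' y'"
    "x \<in> carrier L" "y \<in> carrier L" "x' \<in> carrier L" "y' \<in> carrier L"
  shows "eqmod L I (x \<otimes> x') (y \<otimes> y')"
proof -
  have c: "x \<otimes> x' \<in> carrier L" "y \<otimes> x' \<in> carrier L" "y \<otimes> y' \<in> carrier L"
    using assms mult_closed by auto
  have "(x \<otimes> x') \<ominus> (y \<otimes> y') = ((x \<otimes> x') \<ominus> (y \<otimes> x')) \<oplus> ((y \<otimes> x') \<ominus> (y \<otimes> y'))"
    using c by algebra
  also have "\<dots> = (x \<ominus> y) \<otimes> x' \<oplus> y \<otimes> (x' \<ominus> y')"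
    using assms(4-) by (simp add: mult_minus)
  finally show ?thesis
    using assms ideal_mult[OF I] subspaceD(4)[OF ideal_subspace[OF I]] by (simp add: eqmod_def)
qed

lemma carrier_ideal: "alg_ideal F L (carrier L)"
  by (simp add: alg_ideal_def subspace_carrier mult_closed)

lemma zero_ideal: "alg_ideal F L {\<zero>}"
  by (simp add: alg_ideal_def subspace_zero)

lemma ideal_Int: "alg_ideal F L I \<Longrightarrow> alg_ideal F L J \<Longrightarrow> alg_ideal F L (I \<inter> J)"
  by (auto simp: alg_ideal_def subspace_Int)

lemma ideal_set_add:
  assumes I: "alg_ideal F L I" and J: "alg_ideal F L J"
  shows "alg_ideal F L (I <+>\<^bsub>L\<^esub> J)"
proof -
  have "x \<otimes> a \<in> I <+>\<^bsub>L\<^esub> J \<and> a \<otimes> x \<in> I <+>\<^bsub>L\<^esub> J" if "x \<in> carrier L" "a \<in> I <+>\<^bsub>L\<^esub> J" for x a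
  proof -
    obtain i j where *: "i \<in> I" "j \<in> J" "a = i \<oplus> j" using \<open>a \<in> I <+>\<^bsub>L\<^esub> J\<close> by (auto simp: set_add_iff)
    then have "i \<in> carrier L" "j \<in> carrier L" using ideal_carrier I J by auto
    then have "x \<otimes> a = x \<otimes> i \<oplus> x \<otimes> j" "a \<otimes> x = i \<otimes> x \<oplus> j \<otimes> x"
      using * that(1) by (simp_all add: mult_add_left mult_add_right)
    then show ?thesis using * that(1) ideal_mult I J set_addI by metis
  qed
  then show ?thesis
    using assms by (auto simp: alg_ideal_def subspace_set_add)
qed

lemma subalgebra_set_add:
  assumes U: "subalgebra F L U" and I: "alg_ideal F L I"
  shows "subalgebra F L (U <+>\<^bsub>L\<^esub> I)"
proof -
  have sU: "subspace F U L" using U by (simp add: subalgebra_def)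
  have "x \<otimes> y \<in> U <+>\<^bsub>L\<^esub> I" if "x \<in> U <+>\<^bsub>L\<^esub> I" "y \<in> U <+>\<^bsub>L\<^esub> I" for x y
  proof -
    from that sU obtain u v where uv: "u \<in> U" "v \<in> U" "eqmod L I x u" "eqmod L I y v"
        "x \<in> carrier L" "y \<in> carrier L"
      using set_add_eqmod[OF ideal_subspace[OF I]] subspaceD(1) by metis
    then have "eqmod L I (x \<otimes> y) (u \<otimes> v)"
      by (intro eqmod_mult[OF I]) (auto intro: subspaceD(3)[OF sU])
    moreover have "u \<otimes> v \<in> U" using U uv by (simp add: subalgebra_def)
    ultimately show ?thesis
      using set_add_eqmod[OF ideal_subspace[OF I] subspaceD(1)[OF sU]] uv mult_closed by blast
  qed
  then show ?thesis using subspace_set_add[OF sU ideal_subspace[OF I]] by (auto simp: subalgebra_def)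
qed

lemma restrict_leibniz:
  assumes "subalgebra F L U"
  shows "leibniz_algebra F (L\<lparr>carrier := U\<rparr>)"
proof -
  have s: "subspace F U L" using assms by (simp add: subalgebra_def)
  interpret U: vectorspace F "L\<lparr>carrier := U\<rparr>" by (rule subspace_is_vs[OF s])
  note c = subspaceD(3)[OF s]
  have "leibniz_algebra_axioms F (L\<lparr>carrier := U\<rparr>)"
  proof (rule leibniz_algebra_axioms.intro, goal_cases)
    case 1 then show ?case using assms by (simp add: subalgebra_def)
  next
    case 2 then show ?case using c mult_add_left by simp
  next
    case 3 then show ?case using c mult_add_right by simp
  next
    case 4 then show ?case using c mult_smult_left by simp
  next
    case 5 then show ?case using c mult_smult_right by simp
  next
    case (6 x y z)
    have "x \<otimes> (y \<otimes> z) = (x \<otimes> y) \<otimes> z \<oplus> y \<otimes> (x \<otimes> z)"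
      by (rule leibniz) (use 6 c in auto)
    then show ?case by simp
  qed
  then show ?thesis using U.vectorspace_axioms by (simp add: leibniz_algebra_def)
qed

lemma ideal_restrict_iff:
  assumes U: "subspace F U L"
  shows "alg_ideal F (L\<lparr>carrier := U\<rparr>) S \<longleftrightarrow>
    subspace F S L \<and> S \<subseteq> U \<and> (\<forall>x\<in>U. \<forall>a\<in>S. x \<otimes> a \<in> S \<and> a \<otimes> x \<in> S)"
  by (auto simp: alg_ideal_def subspace_restrict_iff[OF U])

section \<open>The derived series\<close>

abbreviation D where "D \<equiv> derived_series F L"

lemma derived_mult_closed: "x \<in> D i \<Longrightarrow> y \<in> D i \<Longrightarrow> D i \<subseteq> carrier L \<Longrightarrow> x \<otimes> y \<in> D (Suc i)"
proof -
  assume *: "x \<in> D i" "y \<in> D i" "D i \<subseteq> carrier L"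
  then have "{x \<otimes> y |x y. x \<in> D i \<and> y \<in> D i} \<subseteq> carrier L" using mult_closed by auto
  then show ?thesis using in_own_span[of "{x \<otimes> y |x y. x \<in> D i \<and> y \<in> D i}"] * by auto
qed

text \<open>Induction on i: for y, z in \<open>D i\<close> the Leibniz identity gives x(yz) = (xy)z
  + y(xz) and (yz)x = y(zx) - z(yx), and every product on the right has both factors in the ideal
  \<open>D i\<close>. The elements that x multiplies into \<open>D (Suc i)\<close> from both sides
  form a subspace, so looking at the generators yz is enough.\<close>

lemma derived_ideal: "alg_ideal F L (D i)"
proof (induction i)
  case 0
  show ?case by (simp add: carrier_ideal)
next
  case (Suc i)
  note c = ideal_carrier[OF Suc]
  let ?G = "{x \<otimes> y |x y. x \<in> D i \<and> y \<in> D i}"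
  have G: "?G \<subseteq> carrier L" using mult_closed c by auto
  have sub: "subspace F (D (Suc i)) L" using span_is_subspace[OF G] by simp
  have "x \<otimes> a \<in> D (Suc i) \<and> a \<otimes> x \<in> D (Suc i)" if x: "x \<in> carrier L" and a: "a \<in> D (Suc i)" for x a
  proof -
    define T where "T = {w \<in> carrier L. x \<otimes> w \<in> D (Suc i) \<and> w \<otimes> x \<in> D (Suc i)}"
    have "subspace F T L"
      using x subspaceD[OF sub] mult_add_left mult_add_right mult_smult_left mult_smult_right
      by (intro subspaceI) (auto simp: T_def)
    moreover have "?G \<subseteq> T"
    proof
      fix w assume "w \<in> ?G"
      then obtain y z where w: "w = y \<otimes> z" "y \<in> D i" "z \<in> D i" by auto
      then have yz: "y \<in> carrier L" "z \<in> carrier L" using c by auto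
      have m: "\<And>u v. u \<in> D i \<Longrightarrow> v \<in> D i \<Longrightarrow> u \<otimes> v \<in> D (Suc i)" using derived_mult_closed c by auto
      have "x \<otimes> w \<in> D (Suc i)"
        using leibniz[OF x yz] w m ideal_mult[OF Suc x] subspaceD(4)[OF sub] by metis
      moreover have "w \<otimes> x \<in> D (Suc i)"
        using leibniz_right[OF yz x] w m ideal_mult[OF Suc x] subspaceD(7)[OF sub] by metis
      ultimately show "w \<in> T" using w yz by (simp add: T_def mult_closed)
    qed
    ultimately have "D (Suc i) \<subseteq> T" using span_subsetI by simp
    then show ?thesis using a by (auto simp: T_def)
  qed
  then show ?case using sub by (auto simp: alg_ideal_def)
qed

lemma derived_mult: "x \<in> D i \<Longrightarrow> y \<in> D i \<Longrightarrow> x \<otimes> y \<in> D (Suc i)"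
  using derived_mult_closed ideal_carrier[OF derived_ideal] by blast

lemma derived_subset_series:
  assumes "S 0 = carrier L" "\<And>i. subspace F (S i) L"
    "\<And>i x y. x \<in> S i \<Longrightarrow> y \<in> S i \<Longrightarrow> x \<otimes> y \<in> S (Suc i)"
  shows "D i \<subseteq> S i"
proof (induction i)
  case 0
  show ?case using assms(1) by simp
next
  case (Suc i)
  then have "{x \<otimes> y |x y. x \<in> D i \<and> y \<in> D i} \<subseteq> S (Suc i)" using assms(3)[of _ i] by blast
  then show ?case using span_subsetI[OF assms(2)] by simp
qed

lemma derived_antimono_Suc: "D (Suc i) \<subseteq> D i"
proof -
  have "{x \<otimes> y |x y. x \<in> D i \<and> y \<in> D i} \<subseteq> D i"
    using ideal_mult[OF derived_ideal] ideal_carrier[OF derived_ideal] by blast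
  then show ?thesis using span_subsetI[OF ideal_subspace[OF derived_ideal]] by simp
qed

lemma derived_antimono: "i \<le> j \<Longrightarrow> D j \<subseteq> D i"
  by (rule lift_Suc_antimono_le[of D]) (rule derived_antimono_Suc)

text \<open>Any sequence of subspaces that starts at L, satisfies S_i S_i \<subseteq> S_(i+1) and
  reaches 0 dominates the derived series. Solubility of subalgebras, images, extensions and products
  is always shown by naming such a sequence, never by computing the derived series.\<close>

lemma solubleI:
  assumes fin_dim "S 0 = carrier L" "\<And>i. subspace F (S i) L"
    "\<And>i x y. x \<in> S i \<Longrightarrow> y \<in> S i \<Longrightarrow> x \<otimes> y \<in> S (Suc i)" "S n = {\<zero>}"
  shows "soluble_leibniz F L"
proof -
  have "D n \<subseteq> {\<zero>}" using derived_subset_series[of S n] assms by auto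
  then have "D n = {\<zero>}" using subspaceD(2)[OF ideal_subspace[OF derived_ideal]] by blast
  then show ?thesis using assms(1) leibniz_algebra_axioms by (auto simp: soluble_leibniz_def)
qed

end

lemma solubleD:
  assumes "soluble_leibniz F L"
  shows "leibniz_algebra F L" "vectorspace.fin_dim F L" "\<exists>n. derived_series F L n = {\<zero>\<^bsub>L\<^esub>}"
  using assms by (auto simp: soluble_leibniz_def)

lemma restrict_soluble:
  assumes X: "soluble_leibniz F L" and U: "subalgebra F L U"
  shows "soluble_leibniz F (L\<lparr>carrier := U\<rparr>)"
proof -
  interpret leibniz_algebra F L using X by (rule solubleD)
  have sU: "subspace F U L" using U by (simp add: subalgebra_def)
  interpret U: leibniz_algebra F "L\<lparr>carrier := U\<rparr>" by (rule restrict_leibniz[OF U])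
  obtain n where n: "D n = {\<zero>\<^bsub>L\<^esub>}" using solubleD(3)[OF X] by blast
  show ?thesis
  proof (rule U.solubleI[where S = "\<lambda>i. D i \<inter> U" and n = n])
    show U.fin_dim by (rule subspace_fin_dim[OF solubleD(2)[OF X] sU])
    show "D 0 \<inter> U = carrier (L\<lparr>carrier := U\<rparr>)" using subspaceD(1)[OF sU] by auto
    show "subspace F (D i \<inter> U) (L\<lparr>carrier := U\<rparr>)" for i
      by (simp add: subspace_restrict_iff[OF sU] subspace_Int[OF ideal_subspace[OF derived_ideal] sU])
    show "x \<otimes>\<^bsub>L\<lparr>carrier := U\<rparr>\<^esub> y \<in> D (Suc i) \<inter> U" if "x \<in> D i \<inter> U" "y \<in> D i \<inter> U" for i x y
      using that derived_mult[of x i y] U by (auto simp: subalgebra_def)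
    show "D n \<inter> U = {\<zero>\<^bsub>L\<lparr>carrier := U\<rparr>\<^esub>}" using n subspaceD(2)[OF sU] by auto
  qed
qed

subsection \<open>Homomorphisms and quotients\<close>

lemma (in abelian_group) minus_eq_zero_iff:
  assumes "x \<in> carrier G" "y \<in> carrier G"
  shows "x \<ominus> y = \<zero> \<longleftrightarrow> x = y"
proof
  assume *: "x \<ominus> y = \<zero>"
  have "x = (x \<ominus> y) \<oplus> y" using assms by algebra
  then show "x = y" using * assms by simp
qed (use assms in \<open>simp add: minus_eq r_neg\<close>)

definition alg_hom :: "('f, 'm) ring_scheme \<Rightarrow> ('f, 'a, 'n) module_scheme \<Rightarrow>
    ('f, 'b, 'k) module_scheme \<Rightarrow> ('a \<Rightarrow> 'b) set" where
  "alg_hom F A B = {\<phi> \<in> module_hom F A B.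
     \<forall>x\<in>carrier A. \<forall>y\<in>carrier A. \<phi> (x \<otimes>\<^bsub>A\<^esub> y) = \<phi> x \<otimes>\<^bsub>B\<^esub> \<phi> y}"

lemma alg_iso_iff: "alg_iso F A B \<longleftrightarrow> (\<exists>\<phi>\<in>alg_hom F A B. bij_betw \<phi> (carrier A) (carrier B))"
  unfolding alg_iso_def alg_hom_def by auto

lemma alg_homI:
  assumes "\<And>x. x \<in> carrier A \<Longrightarrow> \<phi> x \<in> carrier B"
    "\<And>x y. x \<in> carrier A \<Longrightarrow> y \<in> carrier A \<Longrightarrow> \<phi> (x \<oplus>\<^bsub>A\<^esub> y) = \<phi> x \<oplus>\<^bsub>B\<^esub> \<phi> y"
    "\<And>x y. x \<in> carrier A \<Longrightarrow> y \<in> carrier A \<Longrightarrow> \<phi> (x \<otimes>\<^bsub>A\<^esub> y) = \<phi> x \<otimes>\<^bsub>B\<^esub> \<phi> y"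
    "\<And>c x. c \<in> carrier F \<Longrightarrow> x \<in> carrier A \<Longrightarrow> \<phi> (c \<odot>\<^bsub>A\<^esub> x) = c \<odot>\<^bsub>B\<^esub> \<phi> x"
  shows "\<phi> \<in> alg_hom F A B"
  using assms by (auto simp: alg_hom_def module_hom_def)

lemma alg_homD:
  assumes "\<phi> \<in> alg_hom F A B"
  shows "\<And>x. x \<in> carrier A \<Longrightarrow> \<phi> x \<in> carrier B"
    "\<And>x y. x \<in> carrier A \<Longrightarrow> y \<in> carrier A \<Longrightarrow> \<phi> (x \<oplus>\<^bsub>A\<^esub> y) = \<phi> x \<oplus>\<^bsub>B\<^esub> \<phi> y"
    "\<And>x y. x \<in> carrier A \<Longrightarrow> y \<in> carrier A \<Longrightarrow> \<phi> (x \<otimes>\<^bsub>A\<^esub> y) = \<phi> x \<otimes>\<^bsub>B\<^esub> \<phi> y"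
    "\<And>c x. c \<in> carrier F \<Longrightarrow> x \<in> carrier A \<Longrightarrow> \<phi> (c \<odot>\<^bsub>A\<^esub> x) = c \<odot>\<^bsub>B\<^esub> \<phi> x"
  using assms by (auto simp: alg_hom_def module_hom_def)

lemma alg_hom_comp:
  assumes "\<phi> \<in> alg_hom F A B" "\<psi> \<in> alg_hom F B C"
  shows "\<psi> \<circ> \<phi> \<in> alg_hom F A C"
  by (rule alg_homI) (simp_all add: alg_homD[OF assms(1)] alg_homD[OF assms(2)])

lemma alg_hom_linear_map:
  assumes "leibniz_algebra F A" "leibniz_algebra F B" "\<phi> \<in> alg_hom F A B"
  shows "linear_map F A B \<phi>"
proof -
  interpret A: leibniz_algebra F A by fact
  interpret B: leibniz_algebra F B by fact
  show ?thesis
    using assms(3) by unfold_locales (auto simp: alg_hom_def)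
qed

lemma alg_hom_zero:
  assumes "leibniz_algebra F A" "leibniz_algebra F B" "\<phi> \<in> alg_hom F A B"
  shows "\<phi> \<zero>\<^bsub>A\<^esub> = \<zero>\<^bsub>B\<^esub>"
  using linear_map.T0_is_0[OF alg_hom_linear_map[OF assms]] .

lemma alg_hom_minus:
  assumes "leibniz_algebra F A" "leibniz_algebra F B" "\<phi> \<in> alg_hom F A B"
    "x \<in> carrier A" "y \<in> carrier A"
  shows "\<phi> (x \<ominus>\<^bsub>A\<^esub> y) = \<phi> x \<ominus>\<^bsub>B\<^esub> \<phi> y"
  using linear_map.T_minus[OF alg_hom_linear_map[OF assms(1-3)]] assms(4,5) by blast

lemma alg_hom_kernel_ideal:
  assumes A: "leibniz_algebra F A" and B: "leibniz_algebra F B" and \<phi>: "\<phi> \<in> alg_hom F A B"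
    and J: "alg_ideal F B J"
  shows "alg_ideal F A {x \<in> carrier A. \<phi> x \<in> J}"
proof -
  interpret A: leibniz_algebra F A by fact
  interpret B: leibniz_algebra F B by fact
  note [simp] = alg_homD[OF \<phi>] B.subspaceD(4,5)[OF B.ideal_subspace[OF J]] B.ideal_mult[OF J]
  have "\<phi> \<zero>\<^bsub>A\<^esub> \<in> J"
    using alg_hom_zero[OF A B \<phi>] B.subspaceD(2)[OF B.ideal_subspace[OF J]] by simp
  then have "subspace F {x \<in> carrier A. \<phi> x \<in> J} A"
    by (intro A.subspaceI) auto
  then show ?thesis
    using A.mult_closed by (auto simp: alg_ideal_def)
qed

lemma alg_hom_image_subspace:
  assumes A: "leibniz_algebra F A" and B: "leibniz_algebra F B" and \<phi>: "\<phi> \<in> alg_hom F A B"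
    and S: "subspace F S A"
  shows "subspace F (\<phi> ` S) B"
proof -
  interpret A: leibniz_algebra F A by fact
  interpret B: leibniz_algebra F B by fact
  note S' = A.subspaceD[OF S]
  show ?thesis
  proof (rule B.subspaceI)
    show "\<phi> ` S \<subseteq> carrier B" using S' alg_homD[OF \<phi>] by auto
    show "\<zero>\<^bsub>B\<^esub> \<in> \<phi> ` S" using S' alg_hom_zero[OF A B \<phi>] by (metis imageI)
    show "x \<oplus>\<^bsub>B\<^esub> y \<in> \<phi> ` S" if "x \<in> \<phi> ` S" "y \<in> \<phi> ` S" for x y
      using that S'(3,4) alg_homD(2)[OF \<phi>] by (auto simp: image_iff) metis
    show "c \<odot>\<^bsub>B\<^esub> x \<in> \<phi> ` S" if "c \<in> carrier F" "x \<in> \<phi> ` S" for c x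
      using that S'(3,5) alg_homD(4)[OF \<phi>] by (auto simp: image_iff) metis
  qed
qed

lemma alg_hom_image_ideal:
  assumes A: "leibniz_algebra F A" and B: "leibniz_algebra F B" and \<phi>: "\<phi> \<in> alg_hom F A B"
    and surj: "\<phi> ` carrier A = carrier B" and J: "alg_ideal F A J"
  shows "alg_ideal F B (\<phi> ` J)"
proof -
  interpret A: leibniz_algebra F A by fact
  have "x \<otimes>\<^bsub>B\<^esub> b \<in> \<phi> ` J \<and> b \<otimes>\<^bsub>B\<^esub> x \<in> \<phi> ` J" if x: "x \<in> carrier B" and b: "b \<in> \<phi> ` J" for x b
  proof -
    obtain a j where "x = \<phi> a" "a \<in> carrier A" "b = \<phi> j" "j \<in> J"
      using x b surj by (metis imageE)
    moreover from this have "j \<in> carrier A" using A.ideal_carrier[OF J] by auto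
    ultimately show ?thesis
      using A.ideal_mult[OF J] alg_homD(3)[OF \<phi>] by (metis imageI)
  qed
  then show ?thesis
    using alg_hom_image_subspace[OF A B \<phi> A.ideal_subspace[OF J]] by (auto simp: alg_ideal_def)
qed

text \<open>\<open>B\<close> is only a record of operations at this point; each law is lifted to
  preimages in \<open>A\<close> and pushed forward. That zero goes to zero has to be assumed, since
  it would follow from additivity only in a group, and \<open>B\<close> is not yet known to be one.
  The lemma provides quotients and transported copies at once.\<close>

lemma hom_image_leibniz:
  assumes A: "leibniz_algebra F A" and \<phi>: "\<phi> \<in> alg_hom F A B" and surj: "\<phi> ` carrier A = carrier B"
    and zero: "\<phi> \<zero>\<^bsub>A\<^esub> = \<zero>\<^bsub>B\<^esub>"
  shows "leibniz_algebra F B"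
proof -
  interpret A: leibniz_algebra F A by fact
  note h = alg_homD[OF \<phi>]
  note hs = h(2-4)[symmetric] zero[symmetric]
  have ex: "\<exists>a\<in>carrier A. b = \<phi> a" if "b \<in> carrier B" for b using that surj by auto
  interpret B: vectorspace F B
  proof (rule vs_criteria, goal_cases)
    case 1 show ?case by (rule A.field.field_axioms)
  next
    case 2 show ?case using h(1)[of "\<zero>\<^bsub>A\<^esub>"] zero by simp
  next
    case 3 show ?case using ex by (metis h(1,2) A.M.a_closed)
  next
    case 4 show ?case
    proof
      fix v assume "v \<in> carrier B"
      then obtain a where "a \<in> carrier A" "v = \<phi> a" using ex by auto
      then show "\<exists>neg_v\<in>carrier B. v \<oplus>\<^bsub>B\<^esub> neg_v = \<zero>\<^bsub>B\<^esub>"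
        using h(1)[of "\<ominus>\<^bsub>A\<^esub> a"] h(2)[of a "\<ominus>\<^bsub>A\<^esub> a"] zero A.M.r_neg by (intro bexI[of _ "\<phi> (\<ominus>\<^bsub>A\<^esub> a)"]) auto
    qed
  next
    case 5 show ?case using ex by (metis h(1,4) A.smult_closed)
  next
    case 6 show ?case using ex by (metis h(2) A.M.a_comm)
  next
    case 7 show ?case
    proof (intro allI impI, elim conjE)
      fix v w x assume "v \<in> carrier B" "w \<in> carrier B" "x \<in> carrier B"
      then obtain a b c where "a \<in> carrier A" "v = \<phi> a" "b \<in> carrier A" "w = \<phi> b" "c \<in> carrier A" "x = \<phi> c"
        using ex by metis
      then show "v \<oplus>\<^bsub>B\<^esub> w \<oplus>\<^bsub>B\<^esub> x = v \<oplus>\<^bsub>B\<^esub> (w \<oplus>\<^bsub>B\<^esub> x)" by (simp add: hs A.M.a_assoc)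
    qed
  next
    case 8 show ?case using ex zero by (metis h(2) A.M.r_zero A.M.zero_closed)
  next
    case 9 show ?case
    proof (intro allI impI, elim conjE)
      fix a b v assume "a \<in> carrier F" "b \<in> carrier F" "v \<in> carrier B"
      moreover from this obtain u where "u \<in> carrier A" "v = \<phi> u" using ex by metis
      ultimately show "(a \<otimes>\<^bsub>F\<^esub> b) \<odot>\<^bsub>B\<^esub> v = a \<odot>\<^bsub>B\<^esub> (b \<odot>\<^bsub>B\<^esub> v)" by (simp add: hs A.smult_assoc1)
    qed
  next
    case 10 show ?case
    proof
      fix v assume "v \<in> carrier B"
      then obtain u where "u \<in> carrier A" "v = \<phi> u" using ex by metis
      then show "\<one>\<^bsub>F\<^esub> \<odot>\<^bsub>B\<^esub> v = v" by (simp add: hs)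
    qed
  next
    case 11 show ?case
    proof (intro allI impI, elim conjE)
      fix a b v assume "a \<in> carrier F" "b \<in> carrier F" "v \<in> carrier B"
      moreover from this obtain u where "u \<in> carrier A" "v = \<phi> u" using ex by metis
      ultimately show "(a \<oplus>\<^bsub>F\<^esub> b) \<odot>\<^bsub>B\<^esub> v = a \<odot>\<^bsub>B\<^esub> v \<oplus>\<^bsub>B\<^esub> b \<odot>\<^bsub>B\<^esub> v" by (simp add: hs A.smult_l_distr)
    qed
  next
    case 12 show ?case
    proof (intro allI impI, elim conjE)
      fix a v w assume "a \<in> carrier F" "v \<in> carrier B" "w \<in> carrier B"
      moreover from this obtain b c where "b \<in> carrier A" "v = \<phi> b" "c \<in> carrier A" "w = \<phi> c"
        using ex by metis
      ultimately show "a \<odot>\<^bsub>B\<^esub> (v \<oplus>\<^bsub>B\<^esub> w) = a \<odot>\<^bsub>B\<^esub> v \<oplus>\<^bsub>B\<^esub> a \<odot>\<^bsub>B\<^esub> w" by (simp add: hs A.smult_r_distr)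
    qed
  qed
  show ?thesis
  proof (unfold_locales, goal_cases)
    case (1 x y)
    then show ?case using ex by (metis h(1,3) A.mult_closed)
  next
    case (2 x y z)
    then obtain a b c where "a \<in> carrier A" "x = \<phi> a" "b \<in> carrier A" "y = \<phi> b" "c \<in> carrier A" "z = \<phi> c"
      using ex by metis
    then show ?case by (simp add: hs A.mult_closed A.mult_add_left)
  next
    case (3 x y z)
    then obtain a b c where "a \<in> carrier A" "x = \<phi> a" "b \<in> carrier A" "y = \<phi> b" "c \<in> carrier A" "z = \<phi> c"
      using ex by metis
    then show ?case by (simp add: hs A.mult_closed A.mult_add_right)
  next
    case (4 c x y)
    then obtain a b where "a \<in> carrier A" "x = \<phi> a" "b \<in> carrier A" "y = \<phi> b" using ex by metis
    then show ?case using 4(1) by (simp add: hs A.mult_closed A.mult_smult_left)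
  next
    case (5 c x y)
    then obtain a b where "a \<in> carrier A" "x = \<phi> a" "b \<in> carrier A" "y = \<phi> b" using ex by metis
    then show ?case using 5(1) by (simp add: hs A.mult_closed A.mult_smult_right)
  next
    case (6 x y z)
    then obtain a b c where "a \<in> carrier A" "x = \<phi> a" "b \<in> carrier A" "y = \<phi> b" "c \<in> carrier A" "z = \<phi> c"
      using ex by metis
    then show ?case using A.leibniz[of a b c] by (simp add: hs A.mult_closed)
  qed
qed

lemma hom_image_soluble:
  assumes A: "soluble_leibniz F A" and \<phi>: "\<phi> \<in> alg_hom F A B" and surj: "\<phi> ` carrier A = carrier B"
    and zero: "\<phi> \<zero>\<^bsub>A\<^esub> = \<zero>\<^bsub>B\<^esub>"
  shows "soluble_leibniz F B"
proof -
  interpret A: leibniz_algebra F A using A by (rule solubleD)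
  interpret B: leibniz_algebra F B
    by (rule hom_image_leibniz[OF A.leibniz_algebra_axioms \<phi> surj zero])
  interpret linear_map F A B \<phi>
    by (rule alg_hom_linear_map[OF A.leibniz_algebra_axioms B.leibniz_algebra_axioms \<phi>])
  obtain n where n: "A.D n = {\<zero>\<^bsub>A\<^esub>}" using solubleD(3)[OF A] by blast
  show ?thesis
  proof (rule B.solubleI[where S = "\<lambda>i. \<phi> ` A.D i" and n = n])
    show B.fin_dim by (rule surj_fin_dim[OF solubleD(2)[OF A] surj])
    show "\<phi> ` A.D 0 = carrier B" using surj by simp
    show "subspace F (\<phi> ` A.D i) B" for i
      by (rule alg_hom_image_subspace[OF A.leibniz_algebra_axioms B.leibniz_algebra_axioms \<phi>
            A.ideal_subspace[OF A.derived_ideal]])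
    show "x \<otimes>\<^bsub>B\<^esub> y \<in> \<phi> ` A.D (Suc i)" if xy: "x \<in> \<phi> ` A.D i" "y \<in> \<phi> ` A.D i" for i x y
    proof -
      obtain a b where ab: "a \<in> A.D i" "b \<in> A.D i" "x = \<phi> a" "y = \<phi> b" using xy by auto
      then have "a \<in> carrier A" "b \<in> carrier A" using A.ideal_carrier[OF A.derived_ideal] by auto
      then have "x \<otimes>\<^bsub>B\<^esub> y = \<phi> (a \<otimes>\<^bsub>A\<^esub> b)" using ab alg_homD(3)[OF \<phi>] by simp
      then show ?thesis using A.derived_mult[OF ab(1,2)] by blast
    qed
    show "\<phi> ` A.D n = {\<zero>\<^bsub>B\<^esub>}" using n zero by simp
  qed
qed

lemma abelian_extension_soluble:
  assumes A: "leibniz_algebra F A" and fd: "vectorspace.fin_dim F A" and B: "soluble_leibniz F B"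
    and \<phi>: "\<phi> \<in> alg_hom F A B"
    and ab: "\<And>x y. x \<in> carrier A \<Longrightarrow> y \<in> carrier A \<Longrightarrow> \<phi> x = \<zero>\<^bsub>B\<^esub> \<Longrightarrow> \<phi> y = \<zero>\<^bsub>B\<^esub> \<Longrightarrow> x \<otimes>\<^bsub>A\<^esub> y = \<zero>\<^bsub>A\<^esub>"
  shows "soluble_leibniz F A"
proof -
  interpret A: leibniz_algebra F A by fact
  interpret B: leibniz_algebra F B using B by (rule solubleD)
  obtain n where n: "B.D n = {\<zero>\<^bsub>B\<^esub>}" using solubleD(3)[OF B] by blast
  \<comment> \<open>Preimages of the derived series of \<open>B\<close> arrive at the kernel after n
    steps; products inside the kernel vanish, so one further step reaches 0.\<close>
  define S where "S i = (if i \<le> n then {x \<in> carrier A. \<phi> x \<in> B.D i} else {\<zero>\<^bsub>A\<^esub>})" for i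
  show ?thesis
  proof (rule A.solubleI[where S = S and n = "Suc n"])
    show A.fin_dim by (rule fd)
    show "S 0 = carrier A" using alg_homD(1)[OF \<phi>] by (auto simp: S_def)
    show "subspace F (S i) A" for i
      using A.ideal_subspace[OF alg_hom_kernel_ideal[OF A B.leibniz_algebra_axioms \<phi> B.derived_ideal]]
      by (simp add: S_def A.subspace_zero)
    show "x \<otimes>\<^bsub>A\<^esub> y \<in> S (Suc i)" if "x \<in> S i" "y \<in> S i" for i x y
    proof (cases "i < n")
      case True
      then show ?thesis using that alg_homD(3)[OF \<phi>] B.derived_mult[of "\<phi> x" i "\<phi> y"] A.mult_closed
        by (simp add: S_def)
    next
      case False
      then show ?thesis using that ab n by (cases "i = n") (auto simp: S_def)
    qed
    show "S (Suc n) = {\<zero>\<^bsub>A\<^esub>}" by (simp add: S_def)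
  qed
qed

lemma alg_iso_sym:
  assumes "leibniz_algebra F A" "alg_iso F A B"
  shows "alg_iso F B A"
proof -
  interpret A: leibniz_algebra F A by fact
  obtain \<phi> where \<phi>: "\<phi> \<in> alg_hom F A B" and bij: "bij_betw \<phi> (carrier A) (carrier B)"
    using assms(2) by (auto simp: alg_iso_iff)
  define \<psi> where "\<psi> = inv_into (carrier A) \<phi>"
  have inv: "\<psi> b \<in> carrier A" "\<phi> (\<psi> b) = b" if "b \<in> carrier B" for b
    using that bij_betw_inv_into_right[OF bij] bij by (auto simp: \<psi>_def bij_betw_def inv_into_into)
  have invl: "\<psi> (\<phi> a) = a" if "a \<in> carrier A" for a
    using that bij_betw_inv_into_left[OF bij] by (simp add: \<psi>_def)
  have "\<psi> \<in> alg_hom F B A"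
  proof (rule alg_homI)
    fix x y c assume xy: "x \<in> carrier B" "y \<in> carrier B"
    show "\<psi> (x \<oplus>\<^bsub>B\<^esub> y) = \<psi> x \<oplus>\<^bsub>A\<^esub> \<psi> y"
      using xy inv invl alg_homD(2)[OF \<phi>] A.M.a_closed by metis
    show "\<psi> (x \<otimes>\<^bsub>B\<^esub> y) = \<psi> x \<otimes>\<^bsub>A\<^esub> \<psi> y"
      using xy inv invl alg_homD(3)[OF \<phi>] A.mult_closed by metis
  next
    fix c x assume "c \<in> carrier F" "x \<in> carrier B"
    then show "\<psi> (c \<odot>\<^bsub>B\<^esub> x) = c \<odot>\<^bsub>A\<^esub> \<psi> x"
      using inv invl alg_homD(4)[OF \<phi>] A.smult_closed by metis
  qed (use inv in auto)
  moreover have "bij_betw \<psi> (carrier B) (carrier A)"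
    unfolding \<psi>_def by (rule bij_betw_inv_into[OF bij])
  ultimately show ?thesis by (auto simp: alg_iso_iff)
qed

lemma alg_iso_trans: "alg_iso F A B \<Longrightarrow> alg_iso F B C \<Longrightarrow> alg_iso F A C"
  unfolding alg_iso_iff by (meson alg_hom_comp bij_betw_trans)

text \<open>The operations of \<open>quotient_alg\<close> are unions over all representatives. This
  and the next lemma reduce such a union to a single coset once the value is independent of the
  representative.\<close>

lemma UN_const: "A \<noteq> {} \<Longrightarrow> (\<And>a. a \<in> A \<Longrightarrow> f a = C) \<Longrightarrow> (\<Union>a\<in>A. f a) = C"
  by blast

lemma UN_UN_const:
  "A \<noteq> {} \<Longrightarrow> B \<noteq> {} \<Longrightarrow> (\<And>a b. a \<in> A \<Longrightarrow> b \<in> B \<Longrightarrow> f a b = C) \<Longrightarrow> (\<Union>a\<in>A. \<Union>b\<in>B. f a b) = C"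
  by blast

section \<open>The quotient by an ideal and its universal property\<close>

locale alg_with_ideal = leibniz_algebra F L
  for F :: "('f, 'm) ring_scheme" and L :: "('f, 'a, 'n) module_scheme" (structure) +
  fixes K assumes K: "alg_ideal F L K"
begin

abbreviation Q where "Q \<equiv> quotient_alg L K"
abbreviation q where "q x \<equiv> K +> x"

lemmas subK = ideal_subspace[OF K]

lemma q_eq: "x \<in> carrier L \<Longrightarrow> y \<in> carrier L \<Longrightarrow> q x = q y \<longleftrightarrow> eqmod L K x y"
  by (rule coset_eq_iff[OF subK])

lemma quotient_carrier: "carrier Q = q ` carrier L"
  by (auto simp: quotient_alg_def A_RCOSETS_def')

lemma quotient_zero: "\<zero>\<^bsub>Q\<^esub> = q \<zero>"
  using ideal_carrier[OF K] by (simp add: quotient_alg_def)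

lemma q_rep: "x \<in> carrier L \<Longrightarrow> y \<in> q x \<Longrightarrow> y \<in> carrier L \<and> eqmod L K y x \<and> q y = q x"
  using coset_subset[OF subK] coset_mem_iff[OF subK] q_eq by blast

lemma q_self: "x \<in> carrier L \<Longrightarrow> x \<in> q x"
  by (simp add: coset_mem_iff[OF subK] eqmod_refl[OF subK])

lemma q_hom: "q \<in> alg_hom F L Q"
proof (rule alg_homI)
  fix x y assume xy: "x \<in> carrier L" "y \<in> carrier L"
  show "q (x \<oplus> y) = q x \<oplus>\<^bsub>Q\<^esub> q y"
  proof -
    have "subgroup K (add_monoid L)"
    proof (rule M.add.subgroupI)
      show "K \<noteq> {}" using subspaceD(2)[OF subK] by auto
    qed (auto intro: subspaceD[OF subK])
    then have "abelian_subgroup K L"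
      using abelian_subgroupI3 additive_subgroupI M.abelian_group_axioms by blast
    then have "q x <+>\<^bsub>L\<^esub> q y = q (x \<oplus> y)"
      using xy by (rule abelian_subgroup.a_rcos_sum)
    moreover have "q x \<oplus>\<^bsub>Q\<^esub> q y = q x <+>\<^bsub>L\<^esub> q y" unfolding quotient_alg_def by simp
    ultimately show ?thesis by simp
  qed
  have "q x \<otimes>\<^bsub>Q\<^esub> q y = (\<Union>a\<in>q x. \<Union>b\<in>q y. q (a \<otimes> b))"
  proof -
    have m: "mult Q = rcoset_mult L K" by (simp add: quotient_alg_def)
    show ?thesis unfolding m by (rule rcoset_mult_def)
  qed
  also have "\<dots> = q (x \<otimes> y)"
  proof (rule UN_UN_const)
    show "q x \<noteq> {}" "q y \<noteq> {}" using q_self xy by blast+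
    fix a b assume "a \<in> q x" "b \<in> q y"
    then have ab: "a \<in> carrier L" "b \<in> carrier L" "eqmod L K a x" "eqmod L K b y" using q_rep xy by blast+
    then have "eqmod L K (a \<otimes> b) (x \<otimes> y)" using eqmod_mult[OF K] xy by blast
    then show "q (a \<otimes> b) = q (x \<otimes> y)"
      using q_eq ab(1,2) xy mult_closed by blast
  qed
  finally show "q (x \<otimes> y) = q x \<otimes>\<^bsub>Q\<^esub> q y" ..
next
  fix c x assume cx: "c \<in> carrier F" "x \<in> carrier L"
  have "c \<odot>\<^bsub>Q\<^esub> q x = (\<Union>a\<in>q x. q (c \<odot> a))"
  proof -
    have m: "smult Q = (\<lambda>c A. \<Union>x\<in>A. K +> (c \<odot> x))" by (simp add: quotient_alg_def)
    show ?thesis unfolding m by (rule refl)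
  qed
  also have "\<dots> = q (c \<odot> x)"
  proof (rule UN_const)
    show "q x \<noteq> {}" using q_self cx by blast
    fix a assume "a \<in> q x"
    then have a: "a \<in> carrier L" "eqmod L K a x" using q_rep cx by blast+
    then have "eqmod L K (c \<odot> a) (c \<odot> x)" using eqmod_smult[OF subK] cx by blast
    then show "q (c \<odot> a) = q (c \<odot> x)"
      using q_eq a(1) cx smult_closed by blast
  qed
  finally show "q (c \<odot> x) = c \<odot>\<^bsub>Q\<^esub> q x" ..
qed (simp add: quotient_carrier)

lemma quotient_leibniz: "leibniz_algebra F Q"
  by (rule hom_image_leibniz[OF leibniz_algebra_axioms q_hom])
    (simp_all add: quotient_carrier quotient_zero)

lemma quotient_soluble: "soluble_leibniz F L \<Longrightarrow> soluble_leibniz F Q"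
  by (rule hom_image_soluble[OF _ q_hom]) (simp_all add: quotient_carrier quotient_zero)

lemma q_zero_iff: "x \<in> carrier L \<Longrightarrow> q x = \<zero>\<^bsub>Q\<^esub> \<longleftrightarrow> x \<in> K"
  by (simp add: quotient_zero q_eq eqmod_zero[OF subK])

lemma quotient_lift:
  assumes B: "leibniz_algebra F B" and g: "g \<in> alg_hom F L B"
    and ker: "\<And>x. x \<in> K \<Longrightarrow> g x = \<zero>\<^bsub>B\<^esub>"
  shows "\<exists>\<theta>\<in>alg_hom F Q B. \<forall>x\<in>carrier L. \<theta> (q x) = g x"
proof -
  interpret B: leibniz_algebra F B by fact
  define \<theta> where "\<theta> C = g (SOME x. x \<in> carrier L \<and> C = q x)" for C
  have eq: "\<theta> (q x) = g x" if x: "x \<in> carrier L" for x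
  proof -
    define y where "y = (SOME y. y \<in> carrier L \<and> q x = q y)"
    have y: "y \<in> carrier L" "q x = q y"
      using someI_ex[of "\<lambda>y. y \<in> carrier L \<and> q x = q y"] x by (auto simp: y_def)
    then have "x \<ominus> y \<in> K" using q_eq x by (simp add: eqmod_def)
    then have "g x \<ominus>\<^bsub>B\<^esub> g y = \<zero>\<^bsub>B\<^esub>"
      using ker alg_hom_minus[OF leibniz_algebra_axioms B g x y(1)] by metis
    then have "g x = g y"
      using B.minus_eq_zero_iff alg_homD(1)[OF g] x y by simp
    then show ?thesis by (simp add: \<theta>_def y_def)
  qed
  have "\<theta> \<in> alg_hom F Q B"
    by (rule alg_homI)
      (auto simp: quotient_carrier eq alg_homD[OF g] alg_homD(2-4)[OF q_hom, symmetric] mult_closed)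
  then show ?thesis using eq by blast
qed

lemma first_isomorphism:
  assumes B: "leibniz_algebra F B" and g: "g \<in> alg_hom F L B" and surj: "g ` carrier L = carrier B"
    and ker: "\<And>x. x \<in> carrier L \<Longrightarrow> g x = \<zero>\<^bsub>B\<^esub> \<longleftrightarrow> x \<in> K"
  shows "alg_iso F Q B"
proof -
  interpret B: leibniz_algebra F B by fact
  obtain \<theta> where \<theta>: "\<theta> \<in> alg_hom F Q B" "\<And>x. x \<in> carrier L \<Longrightarrow> \<theta> (q x) = g x"
    using quotient_lift[OF B g] ker ideal_carrier[OF K] by blast
  have "inj_on \<theta> (carrier Q)"
  proof (rule inj_onI)
    fix X Y assume "X \<in> carrier Q" "Y \<in> carrier Q" "\<theta> X = \<theta> Y"
    then obtain x y where xy: "x \<in> carrier L" "y \<in> carrier L" "X = q x" "Y = q y" "g x = g y"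
      using \<theta>(2) by (auto simp: quotient_carrier)
    then have "g (x \<ominus> y) = \<zero>\<^bsub>B\<^esub>"
      using alg_hom_minus[OF leibniz_algebra_axioms B g xy(1,2)] B.minus_eq_zero_iff alg_homD(1)[OF g]
      by simp
    then show "X = Y" using ker xy q_eq by (simp add: eqmod_def)
  qed
  moreover have "\<theta> ` carrier Q = carrier B"
    using surj \<theta>(2) by (force simp: quotient_carrier image_image)
  ultimately show ?thesis using \<theta>(1) by (auto simp: alg_iso_iff bij_betw_def)
qed

end

lemma alg_with_idealI: "leibniz_algebra F L \<Longrightarrow> alg_ideal F L K \<Longrightarrow> alg_with_ideal F L K"
  by (simp add: alg_with_ideal_def alg_with_ideal_axioms_def)

subsection \<open>Primitive quotients and closure properties of a Schunck formation\<close>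

text \<open>A homomorphism from X to Y/K, given by representatives in Y. The maps built from
  cocycles and from sums H + U respect the operations only up to K, so they are of this kind without
  being homomorphisms into Y.\<close>

definition hom_mod :: "('f, 'm) ring_scheme \<Rightarrow> ('f, 'a, 'n) module_scheme \<Rightarrow>
    ('f, 'b, 'k) module_scheme \<Rightarrow> 'b set \<Rightarrow> ('a \<Rightarrow> 'b) \<Rightarrow> bool" where
  "hom_mod F X Y K \<phi> \<longleftrightarrow> (\<forall>x\<in>carrier X. \<phi> x \<in> carrier Y) \<and>
     (\<forall>x\<in>carrier X. \<forall>y\<in>carrier X. eqmod Y K (\<phi> (x \<oplus>\<^bsub>X\<^esub> y)) (\<phi> x \<oplus>\<^bsub>Y\<^esub> \<phi> y)) \<and>
     (\<forall>x\<in>carrier X. \<forall>y\<in>carrier X. eqmod Y K (\<phi> (x \<otimes>\<^bsub>X\<^esub> y)) (\<phi> x \<otimes>\<^bsub>Y\<^esub> \<phi> y)) \<and>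
     (\<forall>c\<in>carrier F. \<forall>x\<in>carrier X. eqmod Y K (\<phi> (c \<odot>\<^bsub>X\<^esub> x)) (c \<odot>\<^bsub>Y\<^esub> \<phi> x))"

lemma hom_mod_coset:
  assumes X: "leibniz_algebra F X" and Y: "leibniz_algebra F Y" and K: "alg_ideal F Y K"
    and h: "hom_mod F X Y K \<phi>"
  shows "(\<lambda>x. K +>\<^bsub>Y\<^esub> \<phi> x) \<in> alg_hom F X (quotient_alg Y K)"
proof -
  interpret X: leibniz_algebra F X by fact
  interpret Y: alg_with_ideal F Y K using Y K by (rule alg_with_idealI)
  note h = h[unfolded hom_mod_def]
  show ?thesis
  proof (rule alg_homI)
    show "Y.q (\<phi> x) \<in> carrier Y.Q" if "x \<in> carrier X" for x
      using that h by (auto simp: Y.quotient_carrier)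
    show "Y.q (\<phi> (x \<oplus>\<^bsub>X\<^esub> y)) = Y.q (\<phi> x) \<oplus>\<^bsub>Y.Q\<^esub> Y.q (\<phi> y)"
      if xy: "x \<in> carrier X" "y \<in> carrier X" for x y
    proof -
      have c: "\<phi> x \<in> carrier Y" "\<phi> y \<in> carrier Y" "\<phi> (x \<oplus>\<^bsub>X\<^esub> y) \<in> carrier Y" using h xy by auto
      show ?thesis
        unfolding alg_homD(2)[OF Y.q_hom c(1,2), symmetric] using Y.q_eq c h xy by simp
    qed
    show "Y.q (\<phi> (x \<otimes>\<^bsub>X\<^esub> y)) = Y.q (\<phi> x) \<otimes>\<^bsub>Y.Q\<^esub> Y.q (\<phi> y)"
      if xy: "x \<in> carrier X" "y \<in> carrier X" for x y
    proof -
      have c: "\<phi> x \<in> carrier Y" "\<phi> y \<in> carrier Y" "\<phi> (x \<otimes>\<^bsub>X\<^esub> y) \<in> carrier Y"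
        using h xy X.mult_closed by auto
      show ?thesis
        unfolding alg_homD(3)[OF Y.q_hom c(1,2), symmetric] using Y.q_eq c h xy Y.mult_closed by simp
    qed
    show "Y.q (\<phi> (c \<odot>\<^bsub>X\<^esub> x)) = c \<odot>\<^bsub>Y.Q\<^esub> Y.q (\<phi> x)"
      if cx: "c \<in> carrier F" "x \<in> carrier X" for c x
    proof -
      have c: "\<phi> x \<in> carrier Y" "\<phi> (c \<odot>\<^bsub>X\<^esub> x) \<in> carrier Y" using h cx by auto
      show ?thesis
        unfolding alg_homD(4)[OF Y.q_hom cx(1) c(1), symmetric] using Y.q_eq c h cx by simp
    qed
  qed
qed

lemma transport_exists:
  assumes X: "soluble_leibniz F X" and inj: "inj_on \<phi> (carrier X)"
  shows "\<exists>X'. soluble_leibniz F (X' :: ('f, 'b) module) \<and> \<phi> \<in> alg_hom F X X' \<and>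
    bij_betw \<phi> (carrier X) (carrier X')"
proof -
  interpret X: leibniz_algebra F X using X by (rule solubleD)
  define \<iota> where "\<iota> = inv_into (carrier X) \<phi>"
  have \<iota>: "\<iota> (\<phi> x) = x" if "x \<in> carrier X" for x using that inj by (simp add: \<iota>_def)
  define X' :: "('f, 'b) module" where "X' = \<lparr>carrier = \<phi> ` carrier X,
    mult = (\<lambda>a b. \<phi> (\<iota> a \<otimes>\<^bsub>X\<^esub> \<iota> b)), one = \<phi> \<one>\<^bsub>X\<^esub>, zero = \<phi> \<zero>\<^bsub>X\<^esub>,
    add = (\<lambda>a b. \<phi> (\<iota> a \<oplus>\<^bsub>X\<^esub> \<iota> b)), smult = (\<lambda>c a. \<phi> (c \<odot>\<^bsub>X\<^esub> \<iota> a))\<rparr>"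
  have hom: "\<phi> \<in> alg_hom F X X'"
    by (rule alg_homI) (auto simp: X'_def \<iota>)
  moreover have "soluble_leibniz F X'"
    by (rule hom_image_soluble[OF X hom]) (auto simp: X'_def)
  moreover have "bij_betw \<phi> (carrier X) (carrier X')" using inj by (simp add: bij_betw_def X'_def)
  ultimately show ?thesis by blast
qed

text \<open>\<open>prim_quot F X J\<close> says that \<open>X/J\<close> is primitive, as a statement about ideals of \<open>X\<close>.\<close>

definition prim_quot :: "('f, 'm) ring_scheme \<Rightarrow> ('f, 'a, 'n) module_scheme \<Rightarrow> 'a set \<Rightarrow> bool" where
  "prim_quot F X J \<longleftrightarrow> (\<exists>C. alg_ideal F X C \<and> J \<subset> C \<and>
     (\<forall>I. alg_ideal F X I \<and> J \<subseteq> I \<and> I \<subseteq> C \<longrightarrow> I = J \<or> I = C) \<and>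
     {x \<in> carrier X. \<forall>c\<in>C. x \<otimes>\<^bsub>X\<^esub> c \<in> J \<and> c \<otimes>\<^bsub>X\<^esub> x \<in> J} \<subseteq> C)"

text \<open>The required C is the preimage of the self-centralising minimal ideal C' of P.
  Surjectivity makes images of ideals ideals, so an ideal between the kernel and C has image 0 or
  C', and because it contains the kernel it is then the kernel or C itself. Centralising C modulo
  the kernel means that the image centralises C'.\<close>

lemma prim_quot_kernel:
  assumes X: "leibniz_algebra F X" and P: "primitive_alg F P" and s: "\<sigma> \<in> alg_hom F X P"
    and surj: "\<sigma> ` carrier X = carrier P"
  shows "prim_quot F X {x \<in> carrier X. \<sigma> x = \<zero>\<^bsub>P\<^esub>}" (is "prim_quot F X ?J")
proof -
  interpret X: leibniz_algebra F X by fact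
  have Pl: "leibniz_algebra F P" using P by (simp add: primitive_alg_def soluble_leibniz_def)
  interpret P: leibniz_algebra F P by (rule Pl)
  obtain C' where C': "minimal_ideal F P C'" "alg_centraliser P C' = C'"
    using P by (auto simp: primitive_alg_def)
  then have iC': "alg_ideal F P C'" and C'0: "C' \<noteq> {\<zero>\<^bsub>P\<^esub>}"
    and minC': "\<And>J. alg_ideal F P J \<Longrightarrow> J \<subseteq> C' \<Longrightarrow> J = {\<zero>\<^bsub>P\<^esub>} \<or> J = C'"
    by (auto simp: minimal_ideal_def)
  define C where "C = {x \<in> carrier X. \<sigma> x \<in> C'}"
  have "alg_ideal F X C" unfolding C_def by (rule alg_hom_kernel_ideal[OF X Pl s iC'])
  moreover have "?J \<subset> C"
  proof
    show "?J \<subseteq> C" using P.subspaceD(2)[OF P.ideal_subspace[OF iC']] by (auto simp: C_def)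
    obtain c where "c \<in> C'" "c \<noteq> \<zero>\<^bsub>P\<^esub>"
      using C'0 P.subspaceD(2)[OF P.ideal_subspace[OF iC']] by blast
    moreover from this have "c \<in> carrier P" using P.ideal_carrier[OF iC'] by blast
    then obtain x where "x \<in> carrier X" "\<sigma> x = c" using surj by (metis imageE)
    ultimately show "?J \<noteq> C" by (auto simp: C_def)
  qed
  moreover have "I = ?J \<or> I = C" if I: "alg_ideal F X I" "?J \<subseteq> I" "I \<subseteq> C" for I
  proof -
    have "alg_ideal F P (\<sigma> ` I)" by (rule alg_hom_image_ideal[OF X Pl s surj I(1)])
    moreover have "\<sigma> ` I \<subseteq> C'" using I(3) by (auto simp: C_def)
    ultimately consider "\<sigma> ` I = {\<zero>\<^bsub>P\<^esub>}" | "\<sigma> ` I = C'" using minC' by blast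
    then show ?thesis
    proof cases
      case 1
      then have "I \<subseteq> ?J" using X.ideal_carrier[OF I(1)] by blast
      then show ?thesis using I(2) by blast
    next
      case 2
      have "x \<in> I" if "x \<in> C" for x
      proof -
        have x: "x \<in> carrier X" "\<sigma> x \<in> C'" using that by (auto simp: C_def)
        then obtain i where i: "i \<in> I" "\<sigma> x = \<sigma> i" using 2 by (metis imageE)
        then have ic: "i \<in> carrier X" using X.ideal_carrier[OF I(1)] by blast
        have "\<sigma> (x \<ominus>\<^bsub>X\<^esub> i) = \<zero>\<^bsub>P\<^esub>"
          using alg_hom_minus[OF X Pl s x(1) ic] i(2) P.minus_eq_zero_iff alg_homD(1)[OF s] ic by simp
        then have "x \<ominus>\<^bsub>X\<^esub> i \<in> I" using I(2) x(1) ic by blast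
        moreover have "x = (x \<ominus>\<^bsub>X\<^esub> i) \<oplus>\<^bsub>X\<^esub> i" using x(1) ic by algebra
        ultimately show ?thesis using X.subspaceD(4)[OF X.ideal_subspace[OF I(1)]] i(1) by metis
      qed
      then show ?thesis using I(3) by blast
    qed
  qed
  moreover have "x \<in> C" if x: "x \<in> carrier X" "\<And>c. c \<in> C \<Longrightarrow> x \<otimes>\<^bsub>X\<^esub> c \<in> ?J \<and> c \<otimes>\<^bsub>X\<^esub> x \<in> ?J" for x
  proof -
    have "\<sigma> x \<otimes>\<^bsub>P\<^esub> d = \<zero>\<^bsub>P\<^esub> \<and> d \<otimes>\<^bsub>P\<^esub> \<sigma> x = \<zero>\<^bsub>P\<^esub>" if "d \<in> C'" for d
    proof -
      have "d \<in> carrier P" using P.ideal_carrier[OF iC'] that by blast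
      then obtain c where c: "c \<in> carrier X" "\<sigma> c = d" using surj by (metis imageE)
      then have "c \<in> C" using that by (simp add: C_def)
      then have "\<sigma> (x \<otimes>\<^bsub>X\<^esub> c) = \<zero>\<^bsub>P\<^esub>" "\<sigma> (c \<otimes>\<^bsub>X\<^esub> x) = \<zero>\<^bsub>P\<^esub>" using x(2)[of c] by auto
      then show ?thesis using alg_homD(3)[OF s] x(1) c by simp
    qed
    then have "\<sigma> x \<in> alg_centraliser P C'"
      using alg_homD(1)[OF s] x(1) by (simp add: alg_centraliser_def)
    then show ?thesis using C'(2) x(1) by (simp add: C_def)
  qed
  then have "{x \<in> carrier X. \<forall>c\<in>C. x \<otimes>\<^bsub>X\<^esub> c \<in> ?J \<and> c \<otimes>\<^bsub>X\<^esub> x \<in> ?J} \<subseteq> C" by blast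
  ultimately show ?thesis unfolding prim_quot_def by blast
qed

context leibniz_algebra
begin

text \<open>Modulo J every abelian ideal B that is not 0 equals C. If B met C trivially, then BC and
  CB would vanish, so B would lie in the centraliser, hence in C, and be 0. By minimality C
  therefore lies in B, and since B is abelian it centralises C, which puts B inside C. Applied to
  both ideals this exchanges elements of one for elements of the other.\<close>

lemma prim_quot_socle:
  assumes J: "alg_ideal F L J" and pr: "prim_quot F L J"
    and I1: "alg_ideal F L I1" "\<not> I1 \<subseteq> J" "\<And>x y. x \<in> I1 \<Longrightarrow> y \<in> I1 \<Longrightarrow> x \<otimes> y \<in> J"
    and I2: "alg_ideal F L I2" "\<not> I2 \<subseteq> J" "\<And>x y. x \<in> I2 \<Longrightarrow> y \<in> I2 \<Longrightarrow> x \<otimes> y \<in> J"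
    and x: "x \<in> I2"
  shows "\<exists>y\<in>I1. eqmod L J x y"
proof -
  obtain C where C1: "alg_ideal F L C" and C2: "J \<subset> C"
    and C3: "\<forall>I. alg_ideal F L I \<and> J \<subseteq> I \<and> I \<subseteq> C \<longrightarrow> I = J \<or> I = C"
    and C4: "{x \<in> carrier L. \<forall>c\<in>C. x \<otimes> c \<in> J \<and> c \<otimes> x \<in> J} \<subseteq> C"
    using pr unfolding prim_quot_def by (elim exE conjE) (rule that)
  have C': "x \<in> C" if "x \<in> carrier L" "\<And>c. c \<in> C \<Longrightarrow> x \<otimes> c \<in> J \<and> c \<otimes> x \<in> J" for x
    using C4 that by auto
  have key: "I <+>\<^bsub>L\<^esub> J = C"
    if I: "alg_ideal F L I" "\<not> I \<subseteq> J" "\<And>x y. x \<in> I \<Longrightarrow> y \<in> I \<Longrightarrow> x \<otimes> y \<in> J" for I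
  proof -
    define B where "B = I <+>\<^bsub>L\<^esub> J"
    have B: "alg_ideal F L B" unfolding B_def by (rule ideal_set_add[OF I(1) J])
    have IB: "I \<subseteq> B" "J \<subseteq> B"
      unfolding B_def using set_add_left set_add_right ideal_subspace ideal_carrier I(1) J by metis+
    have BB: "x \<otimes> y \<in> J" if xy: "x \<in> B" "y \<in> B" for x y
    proof -
      obtain u v where uv: "u \<in> I" "v \<in> I" "eqmod L J x u" "eqmod L J y v"
        using xy set_add_eqmod[OF ideal_subspace[OF J] ideal_carrier[OF I(1)]] unfolding B_def by blast
      have c: "u \<in> carrier L" "v \<in> carrier L" "x \<in> carrier L" "y \<in> carrier L"
        using uv xy ideal_carrier[OF I(1)] ideal_carrier[OF B] by auto
      have "eqmod L J (x \<otimes> y) (u \<otimes> v)" by (rule eqmod_mult[OF J uv(3,4)]) (use c in auto)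
      then show ?thesis
        using eqmod_mem[OF ideal_subspace[OF J] _ ideal_subspace[OF J]] I(3)[OF uv(1,2)] c mult_closed by blast
    qed
    have "C \<inter> B = J \<or> C \<inter> B = C" using C2 IB C3 ideal_Int[OF C1 B] by blast
    then have CB: "C \<subseteq> B"
    proof
      assume CB: "C \<inter> B = J"
      have "b \<in> C" if b: "b \<in> B" for b
      proof (rule C')
        show bc: "b \<in> carrier L" using b ideal_carrier[OF B] by blast
        fix c assume c: "c \<in> C"
        then have cc: "c \<in> carrier L" using ideal_carrier[OF C1] by blast
        show "b \<otimes> c \<in> J \<and> c \<otimes> b \<in> J"
          using ideal_mult[OF B cc b] ideal_mult[OF C1 bc c] CB by blast
      qed
      then show ?thesis using CB IB I(2) by blast
    qed auto
    have "b \<in> C" if b: "b \<in> B" for b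
    proof (rule C')
      show "b \<in> carrier L" using b ideal_carrier[OF B] by blast
      show "b \<otimes> c \<in> J \<and> c \<otimes> b \<in> J" if "c \<in> C" for c using BB b CB that by blast
    qed
    then show ?thesis using CB unfolding B_def by blast
  qed
  have "x \<in> I2 <+>\<^bsub>L\<^esub> J" using set_add_left[OF ideal_subspace[OF J] ideal_carrier[OF I2(1)]] x by blast
  then have "x \<in> I1 <+>\<^bsub>L\<^esub> J" using key[OF I1] key[OF I2] by blast
  then show ?thesis using set_add_eqmod[OF ideal_subspace[OF J] ideal_carrier[OF I1(1)]] by blast
qed

end

section \<open>Closure properties of the class, for arbitrary carrier types\<close>

locale schunck_formation_class =
  fixes F :: "('f, 'm) ring_scheme" and \<HH> :: "'f alg_class"
  assumes SF: "schunck_formation F \<HH>"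
begin

text \<open>The working form of membership: algebras are kept together with an ideal, and X itself
  is treated as X/0, so that the transfer lemmas below cover every construction.\<close>

abbreviation inq where "inq X K \<equiv> in_class F \<HH> (quotient_alg X K)"

lemma class_soluble: "A \<in> \<HH> \<Longrightarrow> soluble_leibniz F A"
  using SF by (auto simp: schunck_formation_def schunck_class_def leibniz_class_def)

lemma in_class_iso: "in_class F \<HH> A \<Longrightarrow> alg_iso F A B \<Longrightarrow> in_class F \<HH> B"
  unfolding in_class_def using alg_iso_trans by blast

lemma in_class_member_iff:
  assumes "soluble_leibniz F X"
  shows "X \<in> \<HH> \<longleftrightarrow> in_class F \<HH> X"
proof
  assume "X \<in> \<HH>"
  have "(\<lambda>x. x) \<in> alg_hom F X X" by (rule alg_homI) simp_all
  moreover have "bij_betw (\<lambda>x. x) (carrier X) (carrier X)" by (simp add: bij_betw_def)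
  ultimately have "alg_iso F X X" unfolding alg_iso_iff by blast
  with \<open>X \<in> \<HH>\<close> show "in_class F \<HH> X" unfolding in_class_def by blast
next
  assume "in_class F \<HH> X"
  moreover have "\<And>A B. A \<in> \<HH> \<Longrightarrow> soluble_leibniz F B \<Longrightarrow> alg_iso F A B \<Longrightarrow> B \<in> \<HH>"
    using SF unfolding schunck_formation_def schunck_class_def leibniz_class_def by blast
  ultimately show "X \<in> \<HH>" using assms unfolding in_class_def by blast
qed

lemma in_class_image:
  assumes X: "in_class F \<HH> X" and Y: "leibniz_algebra F Y" and t: "\<theta> \<in> alg_hom F X Y"
    and surj: "\<theta> ` carrier X = carrier Y"
  shows "in_class F \<HH> Y"
proof -
  interpret Y: leibniz_algebra F Y by fact
  obtain A \<psi> where A: "A \<in> \<HH>" "\<psi> \<in> alg_hom F A X" "bij_betw \<psi> (carrier A) (carrier X)"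
    using X by (auto simp: in_class_def alg_iso_iff)
  have Al: "leibniz_algebra F A" using class_soluble[OF A(1)] by (rule solubleD)
  define g where "g = \<theta> \<circ> \<psi>"
  have g: "g \<in> alg_hom F A Y" unfolding g_def by (rule alg_hom_comp[OF A(2) t])
  define N where "N = {a \<in> carrier A. g a \<in> {\<zero>\<^bsub>Y\<^esub>}}"
  have N: "alg_ideal F A N" unfolding N_def by (rule alg_hom_kernel_ideal[OF Al Y g Y.zero_ideal])
  then have "inq A N" using SF A(1) by (auto simp: schunck_formation_def alg_formation_def)
  moreover have "alg_iso F (quotient_alg A N) Y"
  proof (rule alg_with_ideal.first_isomorphism[OF alg_with_idealI[OF Al N] Y g])
    show "g ` carrier A = carrier Y"
    proof -
      have "g ` carrier A = \<theta> ` (\<psi> ` carrier A)" by (simp add: g_def image_image)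
      then show ?thesis using A(3) surj by (simp add: bij_betw_def)
    qed
  qed (auto simp: N_def)
  ultimately show ?thesis by (rule in_class_iso)
qed

text \<open>The map \<phi> induces a homomorphism of X/K onto Y/K', and a formation is closed under
  homomorphic images.\<close>

lemma inq_transfer:
  assumes X: "leibniz_algebra F X" and Y: "leibniz_algebra F Y"
    and K: "alg_ideal F X K" and K': "alg_ideal F Y K'" and h: "hom_mod F X Y K' \<phi>"
    and ker: "\<And>x. x \<in> K \<Longrightarrow> \<phi> x \<in> K'"
    and surj: "\<And>y. y \<in> carrier Y \<Longrightarrow> \<exists>x\<in>carrier X. eqmod Y K' y (\<phi> x)"
    and inq: "inq X K"
  shows "inq Y K'"
proof -
  interpret X: alg_with_ideal F X K using X K by (rule alg_with_idealI)
  interpret Y: alg_with_ideal F Y K' using Y K' by (rule alg_with_idealI)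
  have c: "\<And>x. x \<in> carrier X \<Longrightarrow> \<phi> x \<in> carrier Y" using h by (auto simp: hom_mod_def)
  have "\<exists>\<theta>\<in>alg_hom F X.Q Y.Q. \<forall>x\<in>carrier X. \<theta> (X.q x) = Y.q (\<phi> x)"
    using X.quotient_lift[OF Y.quotient_leibniz hom_mod_coset[OF X Y K' h]] ker c Y.q_zero_iff X.ideal_carrier[OF K]
    by blast
  then obtain \<theta> where \<theta>: "\<theta> \<in> alg_hom F X.Q Y.Q" "\<And>x. x \<in> carrier X \<Longrightarrow> \<theta> (X.q x) = Y.q (\<phi> x)"
    by blast
  have "\<theta> ` carrier X.Q = carrier Y.Q"
  proof
    show "\<theta> ` carrier X.Q \<subseteq> carrier Y.Q" using alg_homD(1)[OF \<theta>(1)] by blast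
    show "carrier Y.Q \<subseteq> \<theta> ` carrier X.Q"
    proof
      fix Z assume "Z \<in> carrier Y.Q"
      then obtain y where y: "y \<in> carrier Y" "Z = Y.q y" by (auto simp: Y.quotient_carrier)
      then obtain x where x: "x \<in> carrier X" "eqmod Y K' y (\<phi> x)" using surj by blast
      then have "Z = \<theta> (X.q x)" using y \<theta>(2) Y.q_eq c by simp
      then show "Z \<in> \<theta> ` carrier X.Q" using x(1) by (auto simp: X.quotient_carrier)
    qed
  qed
  then show ?thesis by (rule in_class_image[OF inq Y.quotient_leibniz \<theta>(1)])
qed

text \<open>Here K is the exact preimage of K', so the induced map is an isomorphism and membership
  can be pulled back as well.\<close>

lemma inq_transfer_back:
  assumes X: "leibniz_algebra F X" and Y: "leibniz_algebra F Y"
    and K: "alg_ideal F X K" and K': "alg_ideal F Y K'" and h: "hom_mod F X Y K' \<phi>"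
    and ker: "\<And>x. x \<in> carrier X \<Longrightarrow> \<phi> x \<in> K' \<longleftrightarrow> x \<in> K"
    and surj: "\<And>y. y \<in> carrier Y \<Longrightarrow> \<exists>x\<in>carrier X. eqmod Y K' y (\<phi> x)"
    and inq: "inq Y K'"
  shows "inq X K"
proof -
  interpret X: alg_with_ideal F X K using X K by (rule alg_with_idealI)
  interpret Y: alg_with_ideal F Y K' using Y K' by (rule alg_with_idealI)
  have c: "\<And>x. x \<in> carrier X \<Longrightarrow> \<phi> x \<in> carrier Y" using h by (auto simp: hom_mod_def)
  have "alg_iso F X.Q Y.Q"
  proof (rule X.first_isomorphism[OF Y.quotient_leibniz hom_mod_coset[OF X Y K' h]])
    show "(\<lambda>x. Y.q (\<phi> x)) ` carrier X = carrier Y.Q"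
    proof
      show "(\<lambda>x. Y.q (\<phi> x)) ` carrier X \<subseteq> carrier Y.Q" using c by (auto simp: Y.quotient_carrier)
      show "carrier Y.Q \<subseteq> (\<lambda>x. Y.q (\<phi> x)) ` carrier X"
      proof
        fix Z assume "Z \<in> carrier Y.Q"
        then obtain y where y: "y \<in> carrier Y" "Z = Y.q y" by (auto simp: Y.quotient_carrier)
        then obtain x where x: "x \<in> carrier X" "eqmod Y K' y (\<phi> x)" using surj by blast
        then have "Z = Y.q (\<phi> x)" using y Y.q_eq c by simp
        then show "Z \<in> (\<lambda>x. Y.q (\<phi> x)) ` carrier X" using x(1) by blast
      qed
    qed
    show "Y.q (\<phi> x) = \<zero>\<^bsub>Y.Q\<^esub> \<longleftrightarrow> x \<in> K" if "x \<in> carrier X" for x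
      using that c ker Y.q_zero_iff by simp
  qed
  then have "alg_iso F Y.Q X.Q" by (rule alg_iso_sym[OF X.quotient_leibniz])
  then show ?thesis by (rule in_class_iso[OF inq])
qed

lemma hom_hom_mod:
  assumes Y: "leibniz_algebra F Y" and K: "alg_ideal F Y K" and "\<phi> \<in> alg_hom F X Y"
  shows "hom_mod F X Y K \<phi>"
proof -
  interpret Y: alg_with_ideal F Y K using Y K by (rule alg_with_idealI)
  show ?thesis
    using alg_homD[OF assms(3)] Y.eqmod_refl[OF Y.subK] Y.mult_closed by (simp add: hom_mod_def)
qed

lemma in_class_iff_inq_zero:
  assumes X: "leibniz_algebra F X"
  shows "in_class F \<HH> X \<longleftrightarrow> inq X {\<zero>\<^bsub>X\<^esub>}"
proof -
  interpret X: leibniz_algebra F X by fact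
  interpret X: alg_with_ideal F X "{\<zero>\<^bsub>X\<^esub>}" using X X.zero_ideal by (rule alg_with_idealI)
  have id: "(\<lambda>x. x) \<in> alg_hom F X X" by (rule alg_homI) simp_all
  have "alg_iso F X.Q X" by (rule X.first_isomorphism[OF X id]) simp_all
  then show ?thesis
    using in_class_iso[OF _ alg_iso_sym[OF X.quotient_leibniz]] in_class_iso[of X.Q X] by (intro iffI) simp_all
qed

text \<open>The defining conditions of Schunck classes and formations speak about algebras with
  carriers in one fixed type. This copy of X/K in that type is what those conditions are applied to;
  \<pi> carries the ideals over.\<close>

lemma quotient_rep:
  assumes X: "soluble_leibniz F X" and K: "alg_ideal F X K"
  shows "\<exists>X' \<pi>. soluble_leibniz F (X' :: ('f, nat \<Rightarrow> 'f) module) \<and> \<pi> \<in> alg_hom F X X' \<and>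
    \<pi> ` carrier X = carrier X' \<and> (\<forall>x\<in>carrier X. \<pi> x = \<zero>\<^bsub>X'\<^esub> \<longleftrightarrow> x \<in> K) \<and> (X' \<in> \<HH> \<longleftrightarrow> inq X K)"
proof -
  have Xl: "leibniz_algebra F X" using X by (rule solubleD)
  interpret X: alg_with_ideal F X K using Xl K by (rule alg_with_idealI)
  interpret Q: leibniz_algebra F X.Q by (rule X.quotient_leibniz)
  have sQ: "soluble_leibniz F X.Q" by (rule X.quotient_soluble[OF X])
  obtain \<phi> :: "'a set \<Rightarrow> nat \<Rightarrow> 'f" where "inj_on \<phi> (carrier X.Q)"
    using Q.coordinates_exist[OF solubleD(2)[OF sQ]] by blast
  then obtain X' :: "('f, nat \<Rightarrow> 'f) module" where X': "soluble_leibniz F X'" "\<phi> \<in> alg_hom F X.Q X'"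
    "bij_betw \<phi> (carrier X.Q) (carrier X')"
    using transport_exists[OF sQ] by blast
  define \<pi> where "\<pi> = \<phi> \<circ> X.q"
  have \<pi>: "\<pi> \<in> alg_hom F X X'" unfolding \<pi>_def by (rule alg_hom_comp[OF X.q_hom X'(2)])
  have surj: "\<pi> ` carrier X = carrier X'"
  proof -
    have "\<pi> ` carrier X = \<phi> ` (X.q ` carrier X)" by (simp add: \<pi>_def image_image)
    then show ?thesis using X'(3) by (simp add: bij_betw_def X.quotient_carrier)
  qed
  have "\<pi> x = \<zero>\<^bsub>X'\<^esub> \<longleftrightarrow> x \<in> K" if x: "x \<in> carrier X" for x
  proof -
    have "\<pi> x = \<zero>\<^bsub>X'\<^esub> \<longleftrightarrow> \<phi> (X.q x) = \<phi> \<zero>\<^bsub>X.Q\<^esub>"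
      using alg_hom_zero[OF X.quotient_leibniz solubleD(1)[OF X'(1)] X'(2)] by (simp add: \<pi>_def)
    also have "\<dots> \<longleftrightarrow> X.q x = \<zero>\<^bsub>X.Q\<^esub>"
      using X'(3) x Q.M.zero_closed alg_homD(1)[OF X.q_hom]
      by (intro inj_on_eq_iff[of \<phi> "carrier X.Q"]) (simp_all add: bij_betw_def)
    finally show ?thesis using X.q_zero_iff[OF x] by simp
  qed
  moreover have "alg_iso F X.Q X'" using X'(2,3) by (auto simp: alg_iso_iff)
  then have "X' \<in> \<HH> \<longleftrightarrow> inq X K"
    unfolding in_class_member_iff[OF X'(1)]
    using in_class_iso[OF _ alg_iso_sym[OF X.quotient_leibniz]] in_class_iso[of X.Q X'] by (intro iffI) simp_all
  ultimately show ?thesis using X'(1) \<pi> surj by blast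
qed

lemma inq_Int:
  assumes X: "soluble_leibniz F X" and K: "alg_ideal F X K1" "alg_ideal F X K2"
    and inq: "inq X K1" "inq X K2"
  shows "inq X (K1 \<inter> K2)"
proof -
  have Xl: "leibniz_algebra F X" using X by (rule solubleD)
  interpret X: leibniz_algebra F X by (rule Xl)
  obtain X' :: "('f, nat \<Rightarrow> 'f) module" and \<pi> where X': "soluble_leibniz F X'"
    and \<pi>: "\<pi> \<in> alg_hom F X X'" "\<pi> ` carrier X = carrier X'"
    and ker: "\<And>x. x \<in> carrier X \<Longrightarrow> \<pi> x = \<zero>\<^bsub>X'\<^esub> \<longleftrightarrow> x \<in> K1 \<inter> K2"
    and iff: "X' \<in> \<HH> \<longleftrightarrow> inq X (K1 \<inter> K2)"
    using quotient_rep[OF X X.ideal_Int[OF K]] by blast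
  have X'l: "leibniz_algebra F X'" using X' by (rule solubleD)
  interpret X': leibniz_algebra F X' by (rule X'l)
  have im: "alg_ideal F X' (\<pi> ` K)" "inq X' (\<pi> ` K)" if K: "alg_ideal F X K" "inq X K" for K
  proof -
    show I: "alg_ideal F X' (\<pi> ` K)" by (rule alg_hom_image_ideal[OF Xl X'l \<pi> K(1)])
    show "inq X' (\<pi> ` K)"
    proof (rule inq_transfer[OF Xl X'l K(1) I hom_hom_mod[OF X'l I \<pi>(1)] _ _ K(2)])
      show "\<exists>x\<in>carrier X. eqmod X' (\<pi> ` K) y (\<pi> x)" if "y \<in> carrier X'" for y
        using that \<pi>(2) X'.eqmod_refl[OF X'.ideal_subspace[OF I]] by (metis imageE)
    qed auto
  qed
  \<comment> \<open>K1 contains the kernel of \<pi>: if elements of K1 and K2 have the same image,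
    the one in K2 also lies in K1, hence in the kernel.\<close>
  have "\<pi> ` K1 \<inter> \<pi> ` K2 \<subseteq> {\<zero>\<^bsub>X'\<^esub>}"
  proof
    fix y assume "y \<in> \<pi> ` K1 \<inter> \<pi> ` K2"
    then obtain a b where ab: "a \<in> K1" "b \<in> K2" "y = \<pi> a" "\<pi> a = \<pi> b" by blast
    have c: "a \<in> carrier X" "b \<in> carrier X" using ab X.ideal_carrier K by blast+
    have "\<pi> (b \<ominus>\<^bsub>X\<^esub> a) = \<zero>\<^bsub>X'\<^esub>"
      using alg_hom_minus[OF Xl X'l \<pi>(1) c(2,1)] ab(4) X'.minus_eq_zero_iff alg_homD(1)[OF \<pi>(1)] c by simp
    then have "b \<ominus>\<^bsub>X\<^esub> a \<in> K1" using ker c by simp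
    moreover have "b = (b \<ominus>\<^bsub>X\<^esub> a) \<oplus>\<^bsub>X\<^esub> a" using c by algebra
    ultimately have "b \<in> K1" using X.subspaceD(4)[OF X.ideal_subspace[OF K(1)]] ab(1) by metis
    then show "y \<in> {\<zero>\<^bsub>X'\<^esub>}" using ker[OF c(2)] ab by simp
  qed
  moreover have "\<zero>\<^bsub>X'\<^esub> \<in> \<pi> ` K1" "\<zero>\<^bsub>X'\<^esub> \<in> \<pi> ` K2"
    using X'.subspaceD(2)[OF X'.ideal_subspace] im(1) K inq by blast+
  ultimately have "\<Inter>{\<pi> ` K1, \<pi> ` K2} = {\<zero>\<^bsub>X'\<^esub>}" by auto
  moreover have "\<forall>K\<in>{\<pi> ` K1, \<pi> ` K2}. alg_ideal F X' K \<and> inq X' K" using im K inq by simp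
  moreover have "{\<pi> ` K1, \<pi> ` K2} \<noteq> {}" by simp
  moreover have fm: "\<forall>L \<K>. soluble_leibniz F L \<and> \<K> \<noteq> {} \<and> \<Inter>\<K> = {\<zero>\<^bsub>L\<^esub>} \<and>
        (\<forall>K\<in>\<K>. alg_ideal F L K \<and> inq L K) \<longrightarrow> L \<in> \<HH>"
    using SF unfolding schunck_formation_def alg_formation_def by (elim conjE) assumption
  ultimately have "X' \<in> \<HH>"
    using X' by (intro mp[OF spec[OF spec[OF fm, of X'], of "{\<pi> ` K1, \<pi> ` K2}"]] conjI)
  then show ?thesis using iff by blast
qed

text \<open>The Schunck condition for X/K with the primitive quotients pulled back to ideals J above
  K. Read backwards, a quotient outside the class has a primitive quotient outside the class; read
  forwards, membership is tested on primitive quotients, whose socle is known by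
  \<open>prim_quot_socle\<close>.\<close>

lemma inqI_primitive:
  assumes X: "soluble_leibniz F X" and K: "alg_ideal F X K"
    and prim: "\<And>J. alg_ideal F X J \<Longrightarrow> K \<subseteq> J \<Longrightarrow> prim_quot F X J \<Longrightarrow> inq X J"
  shows "inq X K"
proof -
  have Xl: "leibniz_algebra F X" using X by (rule solubleD)
  interpret X: leibniz_algebra F X by (rule Xl)
  obtain X' :: "('f, nat \<Rightarrow> 'f) module" and \<pi> where X': "soluble_leibniz F X'"
    and \<pi>: "\<pi> \<in> alg_hom F X X'" "\<pi> ` carrier X = carrier X'"
    and ker: "\<And>x. x \<in> carrier X \<Longrightarrow> \<pi> x = \<zero>\<^bsub>X'\<^esub> \<longleftrightarrow> x \<in> K"
    and iff: "X' \<in> \<HH> \<longleftrightarrow> inq X K"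
    using quotient_rep[OF X K] by blast
  have X'l: "leibniz_algebra F X'" using X' by (rule solubleD)
  have "inq X' N" if N: "alg_ideal F X' N" and P: "primitive_alg F (quotient_alg X' N)" for N
  proof -
    interpret X': alg_with_ideal F X' N using X'l N by (rule alg_with_idealI)
    define \<sigma> where "\<sigma> = X'.q \<circ> \<pi>"
    have \<sigma>: "\<sigma> \<in> alg_hom F X X'.Q" unfolding \<sigma>_def by (rule alg_hom_comp[OF \<pi>(1) X'.q_hom])
    have surj: "\<sigma> ` carrier X = carrier X'.Q"
    proof -
      have "\<sigma> ` carrier X = X'.q ` (\<pi> ` carrier X)" by (simp add: \<sigma>_def image_image)
      then show ?thesis using \<pi>(2) by (simp add: X'.quotient_carrier)
    qed
    define J where "J = {x \<in> carrier X. \<sigma> x = \<zero>\<^bsub>X'.Q\<^esub>}"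
    have prJ: "prim_quot F X J" unfolding J_def by (rule prim_quot_kernel[OF Xl P \<sigma> surj])
    have "alg_ideal F X {x \<in> carrier X. \<sigma> x \<in> {\<zero>\<^bsub>X'.Q\<^esub>}}"
      by (rule alg_hom_kernel_ideal[OF Xl X'.quotient_leibniz \<sigma>
            leibniz_algebra.zero_ideal[OF X'.quotient_leibniz]])
    then have J: "alg_ideal F X J" by (simp add: J_def)
    have "K \<subseteq> J"
    proof
      fix x assume "x \<in> K"
      then have "x \<in> carrier X" "\<pi> x = \<zero>\<^bsub>X'\<^esub>" using X.ideal_carrier[OF K] ker by blast+
      then show "x \<in> J" by (simp add: J_def \<sigma>_def X'.quotient_zero)
    qed
    then have "inq X J" using prim J prJ by blast
    moreover have "alg_iso F (quotient_alg X J) X'.Q"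
      by (rule alg_with_ideal.first_isomorphism[OF alg_with_idealI[OF Xl J] X'.quotient_leibniz \<sigma> surj])
        (simp add: J_def)
    ultimately show ?thesis by (rule in_class_iso)
  qed
  moreover have sc: "\<forall>L. L \<in> \<HH> \<longleftrightarrow> soluble_leibniz F L \<and>
        (\<forall>K. alg_ideal F L K \<and> primitive_alg F (quotient_alg L K) \<longrightarrow> inq L K)"
    using SF unfolding schunck_formation_def schunck_class_def by (elim conjE) assumption
  ultimately have "X' \<in> \<HH>"
    using X' by (intro iffD2[OF spec[OF sc, of X']] conjI allI impI) blast+
  then show ?thesis using iff by blast
qed

end

subsection \<open>Products and split extensions\<close>

text \<open>The vector space is always the direct sum; the product is left open so that direct
  products, split extensions and the twisted algebra \<open>Z\<close> of
  \<open>central_antisym_of_sym\<close> share their linear algebra.\<close>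

definition pair_alg :: "('f, 'a, 'n) module_scheme \<Rightarrow> ('f, 'b, 'k) module_scheme \<Rightarrow>
    ('a \<times> 'b \<Rightarrow> 'a \<times> 'b \<Rightarrow> 'a \<times> 'b) \<Rightarrow> ('f, 'a \<times> 'b) module" where
  "pair_alg M N \<mu> = (direct_sum M N)\<lparr>mult := \<mu>\<rparr>"

lemma pair_alg_simps [simp]:
  "carrier (pair_alg M N \<mu>) = carrier M \<times> carrier N"
  "\<zero>\<^bsub>pair_alg M N \<mu>\<^esub> = (\<zero>\<^bsub>M\<^esub>, \<zero>\<^bsub>N\<^esub>)"
  "(a, b) \<oplus>\<^bsub>pair_alg M N \<mu>\<^esub> (c, d) = (a \<oplus>\<^bsub>M\<^esub> c, b \<oplus>\<^bsub>N\<^esub> d)"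
  "k \<odot>\<^bsub>pair_alg M N \<mu>\<^esub> (a, b) = (k \<odot>\<^bsub>M\<^esub> a, k \<odot>\<^bsub>N\<^esub> b)"
  "x \<otimes>\<^bsub>pair_alg M N \<mu>\<^esub> y = \<mu> x y"
  by (simp_all add: pair_alg_def direct_sum_def)

locale vs_pair = M: vectorspace F M + N: vectorspace F N
  for F :: "('f, 'm) ring_scheme" and M :: "('f, 'a, 'n) module_scheme"
    and N :: "('f, 'b, 'k) module_scheme"
begin

lemma pair_vectorspace: "vectorspace F (pair_alg M N \<mu>)"
proof (rule vs_criteria, goal_cases)
  case 1 show ?case by (rule M.field.field_axioms)
next
  case 4 show ?case
  proof
    fix v assume "v \<in> carrier (pair_alg M N \<mu>)"
    then obtain a b where "v = (a, b)" "a \<in> carrier M" "b \<in> carrier N" by auto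
    then show "\<exists>w\<in>carrier (pair_alg M N \<mu>). v \<oplus>\<^bsub>pair_alg M N \<mu>\<^esub> w = \<zero>\<^bsub>pair_alg M N \<mu>\<^esub>"
      by (intro bexI[of _ "(\<ominus>\<^bsub>M\<^esub> a, \<ominus>\<^bsub>N\<^esub> b)"]) (simp_all add: M.M.r_neg N.M.r_neg)
  qed
qed (auto simp: M.M.a_ac N.M.a_ac M.smult_assoc1 N.smult_assoc1
    M.smult_l_distr N.smult_l_distr M.smult_r_distr N.smult_r_distr)

lemma pair_minus:
  assumes "a \<in> carrier M" "b \<in> carrier N" "c \<in> carrier M" "d \<in> carrier N"
  shows "(a, b) \<ominus>\<^bsub>pair_alg M N \<mu>\<^esub> (c, d) = (a \<ominus>\<^bsub>M\<^esub> c, b \<ominus>\<^bsub>N\<^esub> d)"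
proof -
  interpret P: vectorspace F "pair_alg M N \<mu>" by (rule pair_vectorspace)
  have "(\<ominus>\<^bsub>M\<^esub> c, \<ominus>\<^bsub>N\<^esub> d) = \<ominus>\<^bsub>pair_alg M N \<mu>\<^esub> (c, d)"
    using assms by (intro P.M.minus_equality[symmetric]) (simp_all add: M.M.l_neg N.M.l_neg)
  then show ?thesis by (simp add: a_minus_def flip: \<open>(\<ominus>\<^bsub>M\<^esub> c, \<ominus>\<^bsub>N\<^esub> d) = \<ominus>\<^bsub>pair_alg M N \<mu>\<^esub> (c, d)\<close>)
qed

lemma pair_eqmod:
  assumes "a \<in> carrier M" "b \<in> carrier N" "c \<in> carrier M" "d \<in> carrier N"
  shows "eqmod (pair_alg M N \<mu>) (A \<times> B) (a, b) (c, d) \<longleftrightarrow> eqmod M A a c \<and> eqmod N B b d"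
  using assms by (simp add: eqmod_def pair_minus)

lemma pair_subspace: "subspace F A M \<Longrightarrow> subspace F B N \<Longrightarrow> subspace F (A \<times> B) (pair_alg M N \<mu>)"
proof -
  assume *: "subspace F A M" "subspace F B N"
  interpret P: vectorspace F "pair_alg M N \<mu>" by (rule pair_vectorspace)
  show ?thesis
    using M.subspaceD[OF *(1)] N.subspaceD[OF *(2)] by (intro P.subspaceI) auto
qed

lemma pair_fin_dim:
  assumes "M.fin_dim" "N.fin_dim"
  shows "vectorspace.fin_dim F (pair_alg M N \<mu>)"
proof -
  interpret P: vectorspace F "pair_alg M N \<mu>" by (rule pair_vectorspace)
  obtain A B where A: "finite A" "A \<subseteq> carrier M" "M.span A = carrier M"
    and B: "finite B" "B \<subseteq> carrier N" "N.span B = carrier N"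
    using assms M.fin_dim_def N.fin_dim_def by auto
  define C where "C = (\<lambda>a. (a, \<zero>\<^bsub>N\<^esub>)) ` A \<union> (\<lambda>b. (\<zero>\<^bsub>M\<^esub>, b)) ` B"
  have C: "finite C" "C \<subseteq> carrier (pair_alg M N \<mu>)" using A B by (auto simp: C_def)
  have sub: "subspace F (P.span C) (pair_alg M N \<mu>)" by (rule P.span_is_subspace[OF C(2)])
  have in_span: "C \<subseteq> P.span C" by (rule P.in_own_span[OF C(2)])
  note s = P.subspaceD[OF sub]
  have "subspace F {a \<in> carrier M. (a, \<zero>\<^bsub>N\<^esub>) \<in> P.span C} M"
  proof (rule M.subspaceI)
    fix x y assume "x \<in> {a \<in> carrier M. (a, \<zero>\<^bsub>N\<^esub>) \<in> P.span C}" "y \<in> {a \<in> carrier M. (a, \<zero>\<^bsub>N\<^esub>) \<in> P.span C}"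
    then show "x \<oplus>\<^bsub>M\<^esub> y \<in> {a \<in> carrier M. (a, \<zero>\<^bsub>N\<^esub>) \<in> P.span C}"
      using s(4)[of "(x, \<zero>\<^bsub>N\<^esub>)" "(y, \<zero>\<^bsub>N\<^esub>)"] by simp
  next
    fix c x assume "c \<in> carrier F" "x \<in> {a \<in> carrier M. (a, \<zero>\<^bsub>N\<^esub>) \<in> P.span C}"
    then show "c \<odot>\<^bsub>M\<^esub> x \<in> {a \<in> carrier M. (a, \<zero>\<^bsub>N\<^esub>) \<in> P.span C}"
      using s(5)[of c "(x, \<zero>\<^bsub>N\<^esub>)"] by simp
  qed (use s(2) in auto)
  then have "M.span A \<subseteq> {a \<in> carrier M. (a, \<zero>\<^bsub>N\<^esub>) \<in> P.span C}"
    by (rule M.span_subsetI) (use A in_span in \<open>auto simp: C_def\<close>)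
  then have 1: "(a, \<zero>\<^bsub>N\<^esub>) \<in> P.span C" if "a \<in> carrier M" for a using A(3) that by auto
  have "subspace F {b \<in> carrier N. (\<zero>\<^bsub>M\<^esub>, b) \<in> P.span C} N"
  proof (rule N.subspaceI)
    fix x y assume "x \<in> {b \<in> carrier N. (\<zero>\<^bsub>M\<^esub>, b) \<in> P.span C}" "y \<in> {b \<in> carrier N. (\<zero>\<^bsub>M\<^esub>, b) \<in> P.span C}"
    then show "x \<oplus>\<^bsub>N\<^esub> y \<in> {b \<in> carrier N. (\<zero>\<^bsub>M\<^esub>, b) \<in> P.span C}"
      using s(4)[of "(\<zero>\<^bsub>M\<^esub>, x)" "(\<zero>\<^bsub>M\<^esub>, y)"] by simp
  next
    fix c x assume "c \<in> carrier F" "x \<in> {b \<in> carrier N. (\<zero>\<^bsub>M\<^esub>, b) \<in> P.span C}"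
    then show "c \<odot>\<^bsub>N\<^esub> x \<in> {b \<in> carrier N. (\<zero>\<^bsub>M\<^esub>, b) \<in> P.span C}"
      using s(5)[of c "(\<zero>\<^bsub>M\<^esub>, x)"] by simp
  qed (use s(2) in auto)
  then have "N.span B \<subseteq> {b \<in> carrier N. (\<zero>\<^bsub>M\<^esub>, b) \<in> P.span C}"
    by (rule N.span_subsetI) (use B in_span in \<open>auto simp: C_def\<close>)
  then have 2: "(\<zero>\<^bsub>M\<^esub>, b) \<in> P.span C" if "b \<in> carrier N" for b using B(3) that by auto
  have "carrier (pair_alg M N \<mu>) \<subseteq> P.span C"
  proof
    fix x assume "x \<in> carrier (pair_alg M N \<mu>)"
    then obtain a b where "x = (a, b)" "a \<in> carrier M" "b \<in> carrier N" by auto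
    then show "x \<in> P.span C" using s(4)[OF 1[of a] 2[of b]] by simp
  qed
  then show ?thesis using C s(1) by (auto simp: P.fin_dim_def)
qed

end

lemma vs_pairI: "vectorspace F M \<Longrightarrow> vectorspace F N \<Longrightarrow> vs_pair F M N"
  by (simp add: vs_pair_def)

section \<open>Direct products and fibre products\<close>

definition prod_alg :: "('f, 'a, 'n) module_scheme \<Rightarrow> ('f, 'b, 'k) module_scheme \<Rightarrow> ('f, 'a \<times> 'b) module" where
  "prod_alg X Y = pair_alg X Y (\<lambda>(a, b) (c, d). (a \<otimes>\<^bsub>X\<^esub> c, b \<otimes>\<^bsub>Y\<^esub> d))"

lemma prod_alg_simps [simp]:
  "carrier (prod_alg M N) = carrier M \<times> carrier N"
  "\<zero>\<^bsub>prod_alg M N\<^esub> = (\<zero>\<^bsub>M\<^esub>, \<zero>\<^bsub>N\<^esub>)"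
  "(a, b) \<oplus>\<^bsub>prod_alg M N\<^esub> (c, d) = (a \<oplus>\<^bsub>M\<^esub> c, b \<oplus>\<^bsub>N\<^esub> d)"
  "k \<odot>\<^bsub>prod_alg M N\<^esub> (a, b) = (k \<odot>\<^bsub>M\<^esub> a, k \<odot>\<^bsub>N\<^esub> b)"
  "(a, b) \<otimes>\<^bsub>prod_alg M N\<^esub> (c, d) = (a \<otimes>\<^bsub>M\<^esub> c, b \<otimes>\<^bsub>N\<^esub> d)"
  by (simp_all add: prod_alg_def)

lemma prod_soluble:
  assumes X: "soluble_leibniz F X" and Y: "soluble_leibniz F Y"
  shows "soluble_leibniz F (prod_alg X Y)"
proof -
  interpret X: leibniz_algebra F X using X by (rule solubleD)
  interpret Y: leibniz_algebra F Y using Y by (rule solubleD)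
  interpret P: vs_pair F X Y by (simp add: vs_pairI X.vectorspace_axioms Y.vectorspace_axioms)
  interpret P: vectorspace F "prod_alg X Y" unfolding prod_alg_def by (rule P.pair_vectorspace)
  have "leibniz_algebra_axioms F (prod_alg X Y)"
  proof (rule leibniz_algebra_axioms.intro, goal_cases)
    case (6 x y z)
    obtain a b where x: "x = (a, b)" "a \<in> carrier X" "b \<in> carrier Y" using 6(1) by auto
    obtain c d where y: "y = (c, d)" "c \<in> carrier X" "d \<in> carrier Y" using 6(2) by auto
    obtain e f where z: "z = (e, f)" "e \<in> carrier X" "f \<in> carrier Y" using 6(3) by auto
    show ?case using X.leibniz[of a c e] Y.leibniz[of b d f] x y z by simp
  qed (auto simp: X.mult_closed Y.mult_closed X.mult_add_left Y.mult_add_left X.mult_add_right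
      Y.mult_add_right X.mult_smult_left Y.mult_smult_left X.mult_smult_right Y.mult_smult_right)
  then interpret P: leibniz_algebra F "prod_alg X Y"
    using P.vectorspace_axioms by (simp add: leibniz_algebra_def)
  obtain m n where m: "X.D m = {\<zero>\<^bsub>X\<^esub>}" and n: "Y.D n = {\<zero>\<^bsub>Y\<^esub>}"
    using solubleD(3) X Y by metis
  show ?thesis
  proof (rule P.solubleI[where S = "\<lambda>i. X.D i \<times> Y.D i" and n = "max m n"])
    show P.fin_dim unfolding prod_alg_def by (rule P.pair_fin_dim[OF solubleD(2)[OF X] solubleD(2)[OF Y]])
    show "subspace F (X.D i \<times> Y.D i) (prod_alg X Y)" for i
      unfolding prod_alg_def
      by (rule P.pair_subspace[OF X.ideal_subspace[OF X.derived_ideal] Y.ideal_subspace[OF Y.derived_ideal]])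
    show "x \<otimes>\<^bsub>prod_alg X Y\<^esub> y \<in> X.D (Suc i) \<times> Y.D (Suc i)"
      if xy: "x \<in> X.D i \<times> Y.D i" "y \<in> X.D i \<times> Y.D i" for x y i
    proof -
      obtain a b where x: "x = (a, b)" "a \<in> X.D i" "b \<in> Y.D i" using xy(1) by blast
      obtain c d where y: "y = (c, d)" "c \<in> X.D i" "d \<in> Y.D i" using xy(2) by blast
      show ?thesis unfolding x y prod_alg_simps using X.derived_mult Y.derived_mult x y by blast
    qed
    have "X.D (max m n) = {\<zero>\<^bsub>X\<^esub>}"
      using X.derived_antimono[of m "max m n"] m X.subspaceD(2)[OF X.ideal_subspace[OF X.derived_ideal]] by auto
    moreover have "Y.D (max m n) = {\<zero>\<^bsub>Y\<^esub>}"
      using Y.derived_antimono[of n "max m n"] n Y.subspaceD(2)[OF Y.ideal_subspace[OF Y.derived_ideal]] by auto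
    ultimately show "X.D (max m n) \<times> Y.D (max m n) = {\<zero>\<^bsub>prod_alg X Y\<^esub>}" by simp
  qed simp
qed

definition fibre_alg :: "('f, 'a, 'n) module_scheme \<Rightarrow> 'a set \<Rightarrow> ('f, 'a \<times> 'a) module" where
  "fibre_alg X A = (prod_alg X X)\<lparr>carrier := {(x, y) \<in> carrier X \<times> carrier X. eqmod X A x y}\<rparr>"

lemma fibre_alg_simps [simp]:
  "carrier (fibre_alg X A) = {(x, y) \<in> carrier X \<times> carrier X. eqmod X A x y}"
  "\<zero>\<^bsub>fibre_alg X A\<^esub> = (\<zero>\<^bsub>X\<^esub>, \<zero>\<^bsub>X\<^esub>)"
  "(a, b) \<oplus>\<^bsub>fibre_alg X A\<^esub> (c, d) = (a \<oplus>\<^bsub>X\<^esub> c, b \<oplus>\<^bsub>X\<^esub> d)"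
  "k \<odot>\<^bsub>fibre_alg X A\<^esub> (a, b) = (k \<odot>\<^bsub>X\<^esub> a, k \<odot>\<^bsub>X\<^esub> b)"
  "(a, b) \<otimes>\<^bsub>fibre_alg X A\<^esub> (c, d) = (a \<otimes>\<^bsub>X\<^esub> c, b \<otimes>\<^bsub>X\<^esub> d)"
  by (simp_all add: fibre_alg_def)

lemma fibre_soluble:
  assumes X: "soluble_leibniz F X" and A: "alg_ideal F X A"
  shows "soluble_leibniz F (fibre_alg X A)"
proof -
  interpret X: leibniz_algebra F X using X by (rule solubleD)
  have P: "soluble_leibniz F (prod_alg X X)" using X X by (rule prod_soluble)
  interpret P: leibniz_algebra F "prod_alg X X" using P by (rule solubleD)
  note sA = X.ideal_subspace[OF A]
  have "subspace F {(x, y) \<in> carrier X \<times> carrier X. eqmod X A x y} (prod_alg X X)"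
    by (rule P.subspaceI) (auto simp: X.eqmod_refl[OF sA] X.eqmod_add[OF sA] X.eqmod_smult[OF sA])
  then have "subalgebra F (prod_alg X X) {(x, y) \<in> carrier X \<times> carrier X. eqmod X A x y}"
    by (auto simp: subalgebra_def X.mult_closed X.eqmod_mult[OF A])
  then show ?thesis unfolding fibre_alg_def by (rule restrict_soluble[OF P])
qed

text \<open>Both projections of the fibre product of \<open>X\<close> with itself over \<open>X/A\<close> are onto, so the fibre
  product lies in every formation containing \<open>X\<close>; it has many quotients that \<open>X\<close> itself lacks.\<close>

lemma (in schunck_formation_class) inq_fibre:
  assumes X: "soluble_leibniz F X" and A: "alg_ideal F X A" and K: "alg_ideal F X K" and inq: "inq X K"
  shows "alg_ideal F (fibre_alg X A) {(x, y) \<in> carrier (fibre_alg X A). x \<in> K \<and> y \<in> K}"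
    "inq (fibre_alg X A) {(x, y) \<in> carrier (fibre_alg X A). x \<in> K \<and> y \<in> K}"
proof -
  have Xl: "leibniz_algebra F X" using X by (rule solubleD)
  interpret X: leibniz_algebra F X by (rule Xl)
  have R: "soluble_leibniz F (fibre_alg X A)" using X A by (rule fibre_soluble)
  have Rl: "leibniz_algebra F (fibre_alg X A)" using R by (rule solubleD)
  interpret R: leibniz_algebra F "fibre_alg X A" by (rule Rl)
  have 1: "alg_ideal F (fibre_alg X A) {z \<in> carrier (fibre_alg X A). p z \<in> K}" (is "alg_ideal F _ ?K")
    "inq (fibre_alg X A) {z \<in> carrier (fibre_alg X A). p z \<in> K}"
    if p: "p = fst \<or> p = snd" for p
  proof -
    have hom: "p \<in> alg_hom F (fibre_alg X A) X" using p by (intro alg_homI) auto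
    show I: "alg_ideal F (fibre_alg X A) ?K" by (rule alg_hom_kernel_ideal[OF Rl Xl hom K])
    show "inq (fibre_alg X A) ?K"
    proof (rule inq_transfer_back[OF Rl Xl I K hom_hom_mod[OF Xl K hom] _ _ inq])
      fix y assume "y \<in> carrier X"
      then have "(y, y) \<in> carrier (fibre_alg X A)" "p (y, y) = y"
        using p by (auto simp: X.eqmod_refl[OF X.ideal_subspace[OF A]])
      then show "\<exists>x\<in>carrier (fibre_alg X A). eqmod X K y (p x)"
        using X.eqmod_refl[OF X.ideal_subspace[OF K] \<open>y \<in> carrier X\<close>] by metis
    qed simp
  qed
  \<comment> \<open>Each of the two ideals is the preimage of K under one projection, so its
    quotient is a copy of X/K; closure under intersections does the rest.\<close>
  have eq: "{z \<in> carrier (fibre_alg X A). fst z \<in> K} \<inter> {z \<in> carrier (fibre_alg X A). snd z \<in> K} =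
    {(x, y) \<in> carrier (fibre_alg X A). x \<in> K \<and> y \<in> K}"
    by auto
  show "alg_ideal F (fibre_alg X A) {(x, y) \<in> carrier (fibre_alg X A). x \<in> K \<and> y \<in> K}"
    unfolding eq[symmetric] using 1(1) by (intro R.ideal_Int) auto
  show "inq (fibre_alg X A) {(x, y) \<in> carrier (fibre_alg X A). x \<in> K \<and> y \<in> K}"
    unfolding eq[symmetric] using 1 by (intro inq_Int[OF R]) auto
qed

text \<open>The laws \<open>l_mult\<close>, \<open>l_r\<close> and \<open>r_mult\<close> are the
  identity a(bc) = (ab)c + b(ac) with the element of V in the third, second and first place.
  Together they say that V \<times> H, with VV = 0, is again a Leibniz algebra.\<close>

locale bimod = H: leibniz_algebra F H + V: vectorspace F V
  for F :: "('f, 'm) ring_scheme" and H :: "('f, 'h, 'n) module_scheme"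
    and V :: "('f, 'v, 'k) module_scheme" +
  fixes l :: "'h \<Rightarrow> 'v \<Rightarrow> 'v" and r :: "'v \<Rightarrow> 'h \<Rightarrow> 'v"
  assumes l_closed: "\<lbrakk>x \<in> carrier H; v \<in> carrier V\<rbrakk> \<Longrightarrow> l x v \<in> carrier V"
    and l_add1: "\<lbrakk>x \<in> carrier H; y \<in> carrier H; v \<in> carrier V\<rbrakk> \<Longrightarrow> l (x \<oplus>\<^bsub>H\<^esub> y) v = l x v \<oplus>\<^bsub>V\<^esub> l y v"
    and l_add2: "\<lbrakk>x \<in> carrier H; v \<in> carrier V; w \<in> carrier V\<rbrakk> \<Longrightarrow> l x (v \<oplus>\<^bsub>V\<^esub> w) = l x v \<oplus>\<^bsub>V\<^esub> l x w"
    and l_smult1: "\<lbrakk>c \<in> carrier F; x \<in> carrier H; v \<in> carrier V\<rbrakk> \<Longrightarrow> l (c \<odot>\<^bsub>H\<^esub> x) v = c \<odot>\<^bsub>V\<^esub> l x v"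
    and l_smult2: "\<lbrakk>c \<in> carrier F; x \<in> carrier H; v \<in> carrier V\<rbrakk> \<Longrightarrow> l x (c \<odot>\<^bsub>V\<^esub> v) = c \<odot>\<^bsub>V\<^esub> l x v"
    and r_closed: "\<lbrakk>x \<in> carrier H; v \<in> carrier V\<rbrakk> \<Longrightarrow> r v x \<in> carrier V"
    and r_add1: "\<lbrakk>x \<in> carrier H; v \<in> carrier V; w \<in> carrier V\<rbrakk> \<Longrightarrow> r (v \<oplus>\<^bsub>V\<^esub> w) x = r v x \<oplus>\<^bsub>V\<^esub> r w x"
    and r_add2: "\<lbrakk>x \<in> carrier H; y \<in> carrier H; v \<in> carrier V\<rbrakk> \<Longrightarrow> r v (x \<oplus>\<^bsub>H\<^esub> y) = r v x \<oplus>\<^bsub>V\<^esub> r v y"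
    and r_smult1: "\<lbrakk>c \<in> carrier F; x \<in> carrier H; v \<in> carrier V\<rbrakk> \<Longrightarrow> r (c \<odot>\<^bsub>V\<^esub> v) x = c \<odot>\<^bsub>V\<^esub> r v x"
    and r_smult2: "\<lbrakk>c \<in> carrier F; x \<in> carrier H; v \<in> carrier V\<rbrakk> \<Longrightarrow> r v (c \<odot>\<^bsub>H\<^esub> x) = c \<odot>\<^bsub>V\<^esub> r v x"
    and l_mult: "\<lbrakk>x \<in> carrier H; y \<in> carrier H; v \<in> carrier V\<rbrakk> \<Longrightarrow>
      l x (l y v) = l (x \<otimes>\<^bsub>H\<^esub> y) v \<oplus>\<^bsub>V\<^esub> l y (l x v)"
    and l_r: "\<lbrakk>x \<in> carrier H; y \<in> carrier H; v \<in> carrier V\<rbrakk> \<Longrightarrow>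
      l x (r v y) = r (l x v) y \<oplus>\<^bsub>V\<^esub> r v (x \<otimes>\<^bsub>H\<^esub> y)"
    and r_mult: "\<lbrakk>x \<in> carrier H; y \<in> carrier H; v \<in> carrier V\<rbrakk> \<Longrightarrow>
      r v (x \<otimes>\<^bsub>H\<^esub> y) = r (r v x) y \<oplus>\<^bsub>V\<^esub> l x (r v y)"

definition semidirect :: "('f, 'h, 'n) module_scheme \<Rightarrow> ('f, 'v, 'k) module_scheme \<Rightarrow>
    ('h \<Rightarrow> 'v \<Rightarrow> 'v) \<Rightarrow> ('v \<Rightarrow> 'h \<Rightarrow> 'v) \<Rightarrow> ('f, 'v \<times> 'h) module" where
  "semidirect H V l r =
     pair_alg V H (\<lambda>(v, x) (w, y). (r v y \<oplus>\<^bsub>V\<^esub> l x w, x \<otimes>\<^bsub>H\<^esub> y))"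

lemma semidirect_simps [simp]:
  "carrier (semidirect H V l r) = carrier V \<times> carrier H"
  "\<zero>\<^bsub>semidirect H V l r\<^esub> = (\<zero>\<^bsub>V\<^esub>, \<zero>\<^bsub>H\<^esub>)"
  "(a, b) \<oplus>\<^bsub>semidirect H V l r\<^esub> (c, d) = (a \<oplus>\<^bsub>V\<^esub> c, b \<oplus>\<^bsub>H\<^esub> d)"
  "k \<odot>\<^bsub>semidirect H V l r\<^esub> (a, b) = (k \<odot>\<^bsub>V\<^esub> a, k \<odot>\<^bsub>H\<^esub> b)"
  "(v, x) \<otimes>\<^bsub>semidirect H V l r\<^esub> (w, y) = (r v y \<oplus>\<^bsub>V\<^esub> l x w, x \<otimes>\<^bsub>H\<^esub> y)"
  by (simp_all add: semidirect_def)

context bimod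
begin

abbreviation SD where "SD \<equiv> semidirect H V l r"

lemma vs_pair: "vs_pair F V H"
  by (simp add: vs_pairI H.vectorspace_axioms V.vectorspace_axioms)

lemma semidirect_leibniz: "leibniz_algebra F SD"
proof -
  interpret P: vectorspace F SD
    unfolding semidirect_def by (rule vs_pair.pair_vectorspace[OF vs_pair])
  have "leibniz_algebra_axioms F SD"
  proof (rule leibniz_algebra_axioms.intro, goal_cases)
    case (1 x y)
    then show ?case by (auto simp: l_closed r_closed H.mult_closed)
  next
    case (2 x y z)
    then show ?case
      by (auto simp: l_closed r_closed H.mult_closed l_add1 r_add1 H.mult_add_left V.M.a_ac)
  next
    case (3 x y z)
    then show ?case
      by (auto simp: l_closed r_closed H.mult_closed l_add2 r_add2 H.mult_add_right V.M.a_ac)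
  next
    case (4 c x y)
    then show ?case
      by (auto simp: l_closed r_closed l_smult1 r_smult1 H.mult_smult_left V.smult_r_distr)
  next
    case (5 c x y)
    then show ?case
      by (auto simp: l_closed r_closed l_smult2 r_smult2 H.mult_smult_right V.smult_r_distr)
  next
    case (6 x y z)
    obtain u a where x: "x = (u, a)" "u \<in> carrier V" "a \<in> carrier H" using 6(1) by auto
    obtain v b where y: "y = (v, b)" "v \<in> carrier V" "b \<in> carrier H" using 6(2) by auto
    obtain w c where z: "z = (w, c)" "w \<in> carrier V" "c \<in> carrier H" using 6(3) by auto
    note c = x(2,3) y(2,3) z(2,3)
    have "r u (b \<otimes>\<^bsub>H\<^esub> c) \<oplus>\<^bsub>V\<^esub> l a (r v c \<oplus>\<^bsub>V\<^esub> l b w) =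
      (r (r u b \<oplus>\<^bsub>V\<^esub> l a v) c \<oplus>\<^bsub>V\<^esub> l (a \<otimes>\<^bsub>H\<^esub> b) w) \<oplus>\<^bsub>V\<^esub> (r v (a \<otimes>\<^bsub>H\<^esub> c) \<oplus>\<^bsub>V\<^esub> l b (r u c \<oplus>\<^bsub>V\<^esub> l a w))"
    proof -
      have "r u (b \<otimes>\<^bsub>H\<^esub> c) \<oplus>\<^bsub>V\<^esub> l a (r v c \<oplus>\<^bsub>V\<^esub> l b w) =
        (r (r u b) c \<oplus>\<^bsub>V\<^esub> l b (r u c)) \<oplus>\<^bsub>V\<^esub> ((r (l a v) c \<oplus>\<^bsub>V\<^esub> r v (a \<otimes>\<^bsub>H\<^esub> c)) \<oplus>\<^bsub>V\<^esub> (l (a \<otimes>\<^bsub>H\<^esub> b) w \<oplus>\<^bsub>V\<^esub> l b (l a w)))"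
        using c r_mult[of b c u] l_r[of a c v] l_mult[of a b w] l_add2[of a "r v c" "l b w"]
        by (simp add: l_closed r_closed)
      also have "\<dots> = (r (r u b \<oplus>\<^bsub>V\<^esub> l a v) c \<oplus>\<^bsub>V\<^esub> l (a \<otimes>\<^bsub>H\<^esub> b) w) \<oplus>\<^bsub>V\<^esub> (r v (a \<otimes>\<^bsub>H\<^esub> c) \<oplus>\<^bsub>V\<^esub> l b (r u c \<oplus>\<^bsub>V\<^esub> l a w))"
        using c by (simp add: l_closed r_closed l_add2 r_add1 H.mult_closed V.M.a_ac)
      finally show ?thesis .
    qed
    then show ?case using H.leibniz[of a b c] x y z by simp
  qed
  then show ?thesis using P.vectorspace_axioms by (simp add: leibniz_algebra_def)
qed

lemma l_zero: "x \<in> carrier H \<Longrightarrow> l x \<zero>\<^bsub>V\<^esub> = \<zero>\<^bsub>V\<^esub>" "v \<in> carrier V \<Longrightarrow> l \<zero>\<^bsub>H\<^esub> v = \<zero>\<^bsub>V\<^esub>"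
  using l_smult2[of "\<zero>\<^bsub>F\<^esub>" x "\<zero>\<^bsub>V\<^esub>"] l_smult1[of "\<zero>\<^bsub>F\<^esub>" "\<zero>\<^bsub>H\<^esub>" v] l_closed
  by simp_all

lemma r_zero: "x \<in> carrier H \<Longrightarrow> r \<zero>\<^bsub>V\<^esub> x = \<zero>\<^bsub>V\<^esub>" "v \<in> carrier V \<Longrightarrow> r v \<zero>\<^bsub>H\<^esub> = \<zero>\<^bsub>V\<^esub>"
  using r_smult1[of "\<zero>\<^bsub>F\<^esub>" x "\<zero>\<^bsub>V\<^esub>"] r_smult2[of "\<zero>\<^bsub>F\<^esub>" "\<zero>\<^bsub>H\<^esub>" v] r_closed
  by simp_all

lemma snd_hom: "snd \<in> alg_hom F SD H"
  by (rule alg_homI) auto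

lemma semidirect_soluble:
  assumes "soluble_leibniz F H" "V.fin_dim"
  shows "soluble_leibniz F SD"
proof (rule abelian_extension_soluble[OF semidirect_leibniz _ assms(1) snd_hom])
  show "vectorspace.fin_dim F SD"
    unfolding semidirect_def by (rule vs_pair.pair_fin_dim[OF vs_pair assms(2) solubleD(2)[OF assms(1)]])
  show "x \<otimes>\<^bsub>SD\<^esub> y = \<zero>\<^bsub>SD\<^esub>"
    if "x \<in> carrier SD" "y \<in> carrier SD" "snd x = \<zero>\<^bsub>H\<^esub>" "snd y = \<zero>\<^bsub>H\<^esub>" for x y
    using that by (auto simp: l_zero r_zero)
qed

definition submod :: "'v set \<Rightarrow> bool" where
  "submod U \<longleftrightarrow> subspace F U V \<and> (\<forall>x\<in>carrier H. \<forall>u\<in>U. l x u \<in> U \<and> r u x \<in> U)"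

lemma submod_subspace: "submod U \<Longrightarrow> subspace F U V"
  by (simp add: submod_def)

lemma submodD: "submod U \<Longrightarrow> x \<in> carrier H \<Longrightarrow> u \<in> U \<Longrightarrow> l x u \<in> U"
  "submod U \<Longrightarrow> x \<in> carrier H \<Longrightarrow> u \<in> U \<Longrightarrow> r u x \<in> U"
  by (auto simp: submod_def)

lemmas submod_carrier = V.subspaceD(3)[OF submod_subspace]

lemma carrier_submod: "submod (carrier V)"
  by (simp add: submod_def V.subspace_carrier l_closed r_closed)

lemma restrict_bimod:
  assumes U: "submod U"
  shows "bimod F H (V\<lparr>carrier := U\<rparr>) l r"
proof -
  note c = submod_carrier[OF U]
  interpret U: vectorspace F "V\<lparr>carrier := U\<rparr>" by (rule V.subspace_is_vs[OF submod_subspace[OF U]])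
  show ?thesis
  proof (intro bimod.intro bimod_axioms.intro, goal_cases)
    case 1 show ?case by (rule H.leibniz_algebra_axioms)
  next
    case 2 show ?case by (rule U.vectorspace_axioms)
  next
    case (13 x y v) then show ?case using l_mult[of x y v] c by simp
  next
    case (14 x y v) then show ?case using l_r[of x y v] c by simp
  next
    case (15 x y v) then show ?case using r_mult[of x y v] c by simp
  qed (use c submodD[OF U] in \<open>auto simp: l_add1 l_add2 l_smult1 l_smult2 r_add1 r_add2 r_smult1 r_smult2\<close>)
qed

lemma semidirect_ideal:
  assumes U: "submod U"
  shows "alg_ideal F SD (U \<times> {\<zero>\<^bsub>H\<^esub>})"
proof -
  have "subspace F (U \<times> {\<zero>\<^bsub>H\<^esub>}) SD"
    unfolding semidirect_def
    by (rule vs_pair.pair_subspace[OF vs_pair submod_subspace[OF U] H.subspace_zero])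
  then show ?thesis
    using submodD[OF U] submod_carrier[OF U] l_closed r_closed
    by (auto simp: alg_ideal_def l_zero r_zero)
qed

lemma ideal_submod:
  assumes J: "alg_ideal F SD J"
  shows "submod {v \<in> carrier V. (v, \<zero>\<^bsub>H\<^esub>) \<in> J}"
proof -
  interpret SD: leibniz_algebra F SD by (rule semidirect_leibniz)
  note s = SD.subspaceD[OF SD.ideal_subspace[OF J]]
  have "subspace F {v \<in> carrier V. (v, \<zero>\<^bsub>H\<^esub>) \<in> J} V"
  proof (rule V.subspaceI)
    fix x y assume "x \<in> {v \<in> carrier V. (v, \<zero>\<^bsub>H\<^esub>) \<in> J}" "y \<in> {v \<in> carrier V. (v, \<zero>\<^bsub>H\<^esub>) \<in> J}"
    then show "x \<oplus>\<^bsub>V\<^esub> y \<in> {v \<in> carrier V. (v, \<zero>\<^bsub>H\<^esub>) \<in> J}"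
      using s(4)[of "(x, \<zero>\<^bsub>H\<^esub>)" "(y, \<zero>\<^bsub>H\<^esub>)"] by simp
  next
    fix c x assume "c \<in> carrier F" "x \<in> {v \<in> carrier V. (v, \<zero>\<^bsub>H\<^esub>) \<in> J}"
    then show "c \<odot>\<^bsub>V\<^esub> x \<in> {v \<in> carrier V. (v, \<zero>\<^bsub>H\<^esub>) \<in> J}"
      using s(5)[of c "(x, \<zero>\<^bsub>H\<^esub>)"] by simp
  qed (use s(2) in auto)
  moreover have "(l x v, \<zero>\<^bsub>H\<^esub>) \<in> J \<and> (r v x, \<zero>\<^bsub>H\<^esub>) \<in> J"
    if "x \<in> carrier H" "v \<in> carrier V" "(v, \<zero>\<^bsub>H\<^esub>) \<in> J" for x v
    using that SD.ideal_mult[OF J, of "(\<zero>\<^bsub>V\<^esub>, x)" "(v, \<zero>\<^bsub>H\<^esub>)"]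
    by (simp add: l_zero r_zero l_closed r_closed)
  ultimately show ?thesis by (simp add: submod_def l_closed r_closed)
qed

end

lemma (in bimod) restrict_submod_iff:
  assumes U: "submod U"
  shows "bimod.submod F H (V\<lparr>carrier := U\<rparr>) l r W \<longleftrightarrow> submod W \<and> W \<subseteq> U"
proof -
  interpret U: bimod F H "V\<lparr>carrier := U\<rparr>" l r by (rule restrict_bimod[OF U])
  show ?thesis
    by (auto simp: U.submod_def submod_def V.subspace_restrict_iff[OF submod_subspace[OF U]])
qed

subsection \<open>Simple bimodules\<close>

lemma (in vectorspace) eqmod_sum_mem:
  assumes S: "subspace K S V" and "eqmod V S z (p \<oplus>\<^bsub>V\<^esub> q)" "z \<in> S" "p \<in> S" and q: "q \<in> carrier V"
  shows "q \<in> S"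
proof -
  have c: "z \<in> carrier V" "p \<in> carrier V" using assms subspaceD(3)[OF S] by auto
  have "q = (z \<ominus>\<^bsub>V\<^esub> p) \<ominus>\<^bsub>V\<^esub> (z \<ominus>\<^bsub>V\<^esub> (p \<oplus>\<^bsub>V\<^esub> q))" using c q by algebra
  then show ?thesis using assms subspaceD(7)[OF S] by (metis eqmod_def)
qed

context bimod
begin

lemma l_uminus: "x \<in> carrier H \<Longrightarrow> v \<in> carrier V \<Longrightarrow> l x (\<ominus>\<^bsub>V\<^esub> v) = \<ominus>\<^bsub>V\<^esub> l x v"
  using l_smult2[of "\<ominus>\<^bsub>F\<^esub> \<one>\<^bsub>F\<^esub>" x v] l_closed V.smult_minus_1 by simp

lemma r_uminus: "x \<in> carrier H \<Longrightarrow> v \<in> carrier V \<Longrightarrow> r (\<ominus>\<^bsub>V\<^esub> v) x = \<ominus>\<^bsub>V\<^esub> r v x"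
  using r_smult1[of "\<ominus>\<^bsub>F\<^esub> \<one>\<^bsub>F\<^esub>" x v] r_closed V.smult_minus_1 by simp

lemma l_minus: "x \<in> carrier H \<Longrightarrow> v \<in> carrier V \<Longrightarrow> w \<in> carrier V \<Longrightarrow> l x (v \<ominus>\<^bsub>V\<^esub> w) = l x v \<ominus>\<^bsub>V\<^esub> l x w"
  by (simp add: V.M.minus_eq l_add2 l_uminus)

lemma r_minus: "x \<in> carrier H \<Longrightarrow> v \<in> carrier V \<Longrightarrow> w \<in> carrier V \<Longrightarrow> r (v \<ominus>\<^bsub>V\<^esub> w) x = r v x \<ominus>\<^bsub>V\<^esub> r w x"
  by (simp add: V.M.minus_eq r_add1 r_uminus)

lemma l_eqmod:
  assumes "submod W" "eqmod V W v w" "x \<in> carrier H" "v \<in> carrier V" "w \<in> carrier V"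
  shows "eqmod V W (l x v) (l x w)"
  using assms submodD(1)[OF assms(1,3)] by (simp add: eqmod_def l_minus[symmetric])

lemma r_eqmod:
  assumes "submod W" "eqmod V W v w" "x \<in> carrier H" "v \<in> carrier V" "w \<in> carrier V"
  shows "eqmod V W (r v x) (r w x)"
  using assms submodD(2)[OF assms(1,3)] by (simp add: eqmod_def r_minus[symmetric])

lemma l_mult_left:
  assumes "x \<in> carrier H" "y \<in> carrier H" "v \<in> carrier V"
  shows "l (x \<otimes>\<^bsub>H\<^esub> y) v = l x (l y v) \<ominus>\<^bsub>V\<^esub> l y (l x v)"
proof -
  have c: "l (x \<otimes>\<^bsub>H\<^esub> y) v \<in> carrier V" "l y (l x v) \<in> carrier V" using assms l_closed H.mult_closed by auto
  have "(l (x \<otimes>\<^bsub>H\<^esub> y) v \<oplus>\<^bsub>V\<^esub> l y (l x v)) \<ominus>\<^bsub>V\<^esub> l y (l x v) = l (x \<otimes>\<^bsub>H\<^esub> y) v" using c by algebra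
  then show ?thesis using l_mult[OF assms] by simp
qed

lemma r_l_swap:
  assumes "x \<in> carrier H" "y \<in> carrier H" "v \<in> carrier V"
  shows "r (l x v) y = l x (r v y) \<ominus>\<^bsub>V\<^esub> r v (x \<otimes>\<^bsub>H\<^esub> y)"
proof -
  have c: "r (l x v) y \<in> carrier V" "r v (x \<otimes>\<^bsub>H\<^esub> y) \<in> carrier V"
    using assms l_closed r_closed H.mult_closed by auto
  have "(r (l x v) y \<oplus>\<^bsub>V\<^esub> r v (x \<otimes>\<^bsub>H\<^esub> y)) \<ominus>\<^bsub>V\<^esub> r v (x \<otimes>\<^bsub>H\<^esub> y) = r (l x v) y" using c by algebra
  then show ?thesis using l_r[OF assms] by simp
qed

lemma submod_Int: "submod U \<Longrightarrow> submod W \<Longrightarrow> submod (U \<inter> W)"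
  by (auto simp: submod_def V.subspace_Int)

abbreviation SDU where "SDU U \<equiv> semidirect H (V\<lparr>carrier := U\<rparr>) l r"

lemma SDU_leibniz: "submod U \<Longrightarrow> leibniz_algebra F (SDU U)"
  by (rule bimod.semidirect_leibniz[OF restrict_bimod])

lemma SDU_eqmod:
  assumes U: "submod U" and "u \<in> U" "v \<in> U" "x \<in> carrier H" "y \<in> carrier H"
  shows "eqmod (SDU U) (W \<times> {\<zero>\<^bsub>H\<^esub>}) (u, x) (v, y) \<longleftrightarrow> eqmod V W u v \<and> x = y"
proof -
  interpret U: bimod F H "V\<lparr>carrier := U\<rparr>" l r by (rule restrict_bimod[OF U])
  show ?thesis
    unfolding semidirect_def using assms
    by (simp add: vs_pair.pair_eqmod[OF U.vs_pair] V.restrict_eqmod[OF submod_subspace[OF U]])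
      (simp add: eqmod_def H.minus_eq_zero_iff)
qed

lemma SDU_ideal: "submod U \<Longrightarrow> submod W \<Longrightarrow> W \<subseteq> U \<Longrightarrow> alg_ideal F (SDU U) (W \<times> {\<zero>\<^bsub>H\<^esub>})"
  using bimod.semidirect_ideal[OF restrict_bimod] restrict_submod_iff by blast

lemma SDU_ideal_submod:
  assumes U: "submod U" and J: "alg_ideal F (SDU U) J"
  shows "submod {u \<in> U. (u, \<zero>\<^bsub>H\<^esub>) \<in> J}"
  using bimod.ideal_submod[OF restrict_bimod[OF U] J] restrict_submod_iff[OF U] by simp

definition simple_over :: "'v set \<Rightarrow> 'v set \<Rightarrow> bool" where
  "simple_over W W0 \<longleftrightarrow> submod W \<and> submod W0 \<and> W0 \<subset> W \<and>
     (\<forall>U. submod U \<and> W0 \<subseteq> U \<and> U \<subseteq> W \<longrightarrow> U = W0 \<or> U = W)"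

lemma simple_overD:
  assumes "simple_over W W0"
  shows "submod W" "submod W0" "W0 \<subseteq> W" "W0 \<noteq> W"
    "\<And>U. submod U \<Longrightarrow> W0 \<subseteq> U \<Longrightarrow> U \<subseteq> W \<Longrightarrow> U = W0 \<or> U = W"
  using assms by (auto simp: simple_over_def)

definition annihilator :: "'v set \<Rightarrow> 'v set \<Rightarrow> 'h set" where
  "annihilator W W0 = {k \<in> carrier H. \<forall>w\<in>W. l k w \<in> W0 \<and> r w k \<in> W0}"

text \<open>Each bimodule law expresses the action of xk and kx by the actions of x and k one after
  the other, and as W and W0 are submodules every such term falls into W0.\<close>

lemma annihilator_ideal:
  assumes W: "submod W" and W0: "submod W0"
  shows "alg_ideal F H (annihilator W W0)"
proof -
  note c = submod_carrier[OF W]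
  note s = V.subspaceD[OF submod_subspace[OF W0]]
  have sub: "subspace F (annihilator W W0) H"
    by (rule H.subspaceI)
      (auto simp: annihilator_def c s l_zero r_zero l_add1 r_add2 l_smult1 r_smult2)
  have "x \<otimes>\<^bsub>H\<^esub> k \<in> annihilator W W0 \<and> k \<otimes>\<^bsub>H\<^esub> x \<in> annihilator W W0"
    if x: "x \<in> carrier H" and "k \<in> annihilator W W0" for x k
  proof -
    have k: "k \<in> carrier H" "\<And>w. w \<in> W \<Longrightarrow> l k w \<in> W0" "\<And>w. w \<in> W \<Longrightarrow> r w k \<in> W0"
      using that by (auto simp: annihilator_def)
    have "l (x \<otimes>\<^bsub>H\<^esub> k) w \<in> W0" "l (k \<otimes>\<^bsub>H\<^esub> x) w \<in> W0" "r w (x \<otimes>\<^bsub>H\<^esub> k) \<in> W0" "r w (k \<otimes>\<^bsub>H\<^esub> x) \<in> W0"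
      if w: "w \<in> W" for w
      using l_mult_left[OF x k(1) c[OF w]] l_mult_left[OF k(1) x c[OF w]]
        r_mult[OF x k(1) c[OF w]] r_mult[OF k(1) x c[OF w]]
        k(2)[OF w] k(3)[OF w] k(2)[OF submodD(1)[OF W x w]] k(2)[OF submodD(2)[OF W x w]]
        k(3)[OF submodD(2)[OF W x w]] submodD[OF W0 x] s(4,7)
      by simp_all
    then show ?thesis using x k(1) H.mult_closed by (simp add: annihilator_def)
  qed
  then show ?thesis using sub by (simp add: alg_ideal_def)
qed

text \<open>The laws \<open>l_r\<close> and \<open>r_mult\<close> combine to (wx + xw)y = 0. Hence
  every wx + xw lies in N, the elements of zero right action modulo W0, and N is a submodule.
  Simplicity leaves N = W, where the right action is zero, or N = W0, where it is the negative of
  the left action.\<close>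

lemma simple_sym_or_antisym:
  assumes S: "simple_over W W0"
  shows "(\<forall>x\<in>carrier H. \<forall>w\<in>W. r w x \<in> W0) \<or>
    (\<forall>x\<in>carrier H. \<forall>w\<in>W. eqmod V W0 (r w x) (\<ominus>\<^bsub>V\<^esub> l x w))"
proof -
  note S = simple_overD[OF S]
  note c = submod_carrier[OF S(1)]
  note s = V.subspaceD[OF submod_subspace[OF S(2)]]
  define N where "N = {w \<in> W. \<forall>x\<in>carrier H. r w x \<in> W0}"
  have sub: "subspace F N V"
    using V.subspaceD[OF submod_subspace[OF S(1)]] s
    by (intro V.subspaceI) (auto simp: N_def r_zero r_add1 r_smult1)
  have "submod N"
  proof -
    have "l x w \<in> N \<and> r w x \<in> N" if x: "x \<in> carrier H" and w: "w \<in> N" for x w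
    proof -
      have w': "w \<in> W" "\<And>y. y \<in> carrier H \<Longrightarrow> r w y \<in> W0" using w by (auto simp: N_def)
      have "r (l x w) y \<in> W0" if y: "y \<in> carrier H" for y
        using r_l_swap[OF x y c[OF w'(1)]] w'(2) H.mult_closed x y submodD(1)[OF S(2) x] s(7) by simp
      moreover have "r (r w x) y \<in> W0" if y: "y \<in> carrier H" for y
        using w'(2)[OF x] submodD(2)[OF S(2) y] by simp
      ultimately show ?thesis using submodD[OF S(1) x w'(1)] by (simp add: N_def)
    qed
    then show ?thesis using sub by (simp add: submod_def)
  qed
  moreover have "W0 \<subseteq> N" using S(3) submodD(2)[OF S(2)] by (auto simp: N_def)
  moreover have "N \<subseteq> W" by (auto simp: N_def)
  ultimately consider "N = W0" | "N = W" using S(5) by blast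
  then show ?thesis
  proof cases
    case 1
    have "eqmod V W0 (r w x) (\<ominus>\<^bsub>V\<^esub> l x w)" if x: "x \<in> carrier H" and w: "w \<in> W" for x w
    proof -
      note wc = c[OF w]
      have z: "r w x \<oplus>\<^bsub>V\<^esub> l x w \<in> W"
        using submodD[OF S(1) x w] V.subspaceD(4)[OF submod_subspace[OF S(1)]] by simp
      have "r (r w x \<oplus>\<^bsub>V\<^esub> l x w) y = \<zero>\<^bsub>V\<^esub>" if y: "y \<in> carrier H" for y
      proof -
        define p q where "p = r (r w x) y" and "q = l x (r w y)"
        have pq: "p \<in> carrier V" "q \<in> carrier V" using x y wc l_closed r_closed by (auto simp: p_def q_def)
        have "r (r w x \<oplus>\<^bsub>V\<^esub> l x w) y = p \<oplus>\<^bsub>V\<^esub> (q \<ominus>\<^bsub>V\<^esub> (p \<oplus>\<^bsub>V\<^esub> q))"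
          using r_add1[OF y, of "r w x" "l x w"] r_l_swap[OF x y wc] r_mult[OF x y wc] x wc
          by (simp add: l_closed r_closed p_def q_def)
        also have "\<dots> = \<zero>\<^bsub>V\<^esub>" using pq by algebra
        finally show ?thesis .
      qed
      then have "r w x \<oplus>\<^bsub>V\<^esub> l x w \<in> N" using z s(2) by (simp add: N_def)
      then have *: "r w x \<oplus>\<^bsub>V\<^esub> l x w \<in> W0" using 1 by simp
      have rl: "r w x \<in> carrier V" "l x w \<in> carrier V" using x wc l_closed r_closed by auto
      have "r w x \<ominus>\<^bsub>V\<^esub> (\<ominus>\<^bsub>V\<^esub> l x w) = r w x \<oplus>\<^bsub>V\<^esub> l x w" using rl by algebra
      then show ?thesis using * by (simp add: eqmod_def)
    qed
    then show ?thesis by blast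
  next
    case 2
    then show ?thesis by (auto simp: N_def)
  qed
qed

text \<open>On a simple module the right action is zero or minus the left action, so left invariance
  of a subspace already implies right invariance.\<close>

lemma simple_left_submod:
  assumes S: "simple_over W W0" and T: "subspace F T V" "W0 \<subseteq> T" "T \<subseteq> W"
    and l: "\<And>x t. x \<in> carrier H \<Longrightarrow> t \<in> T \<Longrightarrow> l x t \<in> T"
  shows "T = W0 \<or> T = W"
proof -
  have "r t x \<in> T" if x: "x \<in> carrier H" and t: "t \<in> T" for x t
  proof -
    have tW: "t \<in> W" using t T(3) by blast
    have tc: "t \<in> carrier V" using V.subspaceD(3)[OF T(1)] t by blast
    consider "r t x \<in> W0" | "eqmod V W0 (r t x) (\<ominus>\<^bsub>V\<^esub> l x t)"
      using simple_sym_or_antisym[OF S] x tW by blast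
    then show ?thesis
    proof cases
      case 1 then show ?thesis using T(2) by blast
    next
      case 2
      moreover have "\<ominus>\<^bsub>V\<^esub> l x t \<in> T" using l[OF x t] V.subspaceD(6)[OF T(1)] by blast
      ultimately show ?thesis
        using V.eqmod_mem[OF submod_subspace[OF simple_overD(2)[OF S]] 2 T(1,2)]
          r_closed[OF x tc] V.subspaceD(3)[OF T(1)] by blast
    qed
  qed
  then have "submod T" using T(1) l by (simp add: submod_def)
  then show ?thesis using simple_overD(5)[OF S] T by blast
qed

section \<open>Fitting null components, nilpotent and injective actions\<close>

primrec nil_part :: "'v set \<Rightarrow> 'v set \<Rightarrow> 'h \<Rightarrow> nat \<Rightarrow> 'v set" where
  "nil_part W W0 a 0 = W0"
| "nil_part W W0 a (Suc n) = {w \<in> W. l a w \<in> nil_part W W0 a n}"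

lemma nil_part_facts:
  assumes W: "submod W" and W0: "submod W0" "W0 \<subseteq> W" and a: "a \<in> carrier H"
  shows "subspace F (nil_part W W0 a n) V \<and> nil_part W W0 a n \<subseteq> W \<and>
    nil_part W W0 a n \<subseteq> nil_part W W0 a (Suc n)"
proof (induction n)
  case 0
  show ?case using submod_subspace[OF W0(1)] submodD(1)[OF W0(1) a] W0(2) by auto
next
  case (Suc n)
  note s = V.subspaceD[OF submod_subspace[OF W]]
  have "subspace F (nil_part W W0 a (Suc n)) V"
    using V.subspaceD[of "nil_part W W0 a n"] Suc s a
    by (intro V.subspaceI) (auto simp: l_zero l_add2 l_smult2)
  moreover have "nil_part W W0 a (Suc n) \<subseteq> nil_part W W0 a (Suc (Suc n))"
    using Suc by auto
  ultimately show ?case by auto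
qed

text \<open>If \<open>A\<close> acts commutatively then the Fitting null component of any \<open>a \<in> A\<close> is a submodule,
  because \<open>[a, [a, x]]\<close> annihilates. Over a simple module each \<open>a\<close> is therefore nilpotent or
  injective, and not all of them are nilpotent.\<close>

lemma nil_part_invariant:
  assumes W: "submod W" and W0: "submod W0" "W0 \<subseteq> W"
    and A: "alg_ideal F H A" and AA: "\<And>b c. b \<in> A \<Longrightarrow> c \<in> A \<Longrightarrow> b \<otimes>\<^bsub>H\<^esub> c \<in> annihilator W W0"
    and a: "a \<in> A"
  shows "b \<in> A \<Longrightarrow> w \<in> nil_part W W0 a n \<Longrightarrow> l b w \<in> nil_part W W0 a n"
    and "x \<in> carrier H \<Longrightarrow> w \<in> nil_part W W0 a n \<Longrightarrow> l x w \<in> nil_part W W0 a (Suc n)"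
proof -
  note c = submod_carrier[OF W]
  have ac: "a \<in> carrier H" using a H.ideal_carrier[OF A] by blast
  note nf = nil_part_facts[OF W W0 ac]
  have W0n: "W0 \<subseteq> nil_part W W0 a n" for n
    by (induction n) (use nf in auto)
  have 1: "l b w \<in> nil_part W W0 a n" if b: "b \<in> A" and "w \<in> nil_part W W0 a n" for b w n
    using that(2)
  proof (induction n arbitrary: w)
    case 0
    then show ?case using submodD(1)[OF W0(1)] b H.ideal_carrier[OF A] by auto
  next
    case (Suc n)
    have bc: "b \<in> carrier H" using b H.ideal_carrier[OF A] by blast
    have w: "w \<in> W" "l a w \<in> nil_part W W0 a n" using Suc.prems by auto
    \<comment> \<open>The product ab annihilates, so a and b commute on W modulo W0.\<close>
    have "l (a \<otimes>\<^bsub>H\<^esub> b) w \<in> nil_part W W0 a n" using AA[OF a b] w(1) W0n by (auto simp: annihilator_def)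
    moreover have "l b (l a w) \<in> nil_part W W0 a n" using Suc.IH w(2) by simp
    ultimately have "l a (l b w) \<in> nil_part W W0 a n"
      using l_mult[OF ac bc c[OF w(1)]] nf[of n] V.subspaceD(4)[of "nil_part W W0 a n"] by simp
    then show ?case using submodD(1)[OF W bc w(1)] by simp
  qed
  then show "b \<in> A \<Longrightarrow> w \<in> nil_part W W0 a n \<Longrightarrow> l b w \<in> nil_part W W0 a n" by simp
  assume x: "x \<in> carrier H" and "w \<in> nil_part W W0 a n"
  from this(2) show "l x w \<in> nil_part W W0 a (Suc n)"
  proof (induction n arbitrary: w)
    case 0
    then show ?case using submodD(1)[OF W0(1) x] nf[of 0] by auto
  next
    case (Suc n)
    have w: "w \<in> W" "l a w \<in> nil_part W W0 a n" using Suc.prems by auto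
    have "a \<otimes>\<^bsub>H\<^esub> x \<in> A" using H.ideal_mult(2)[OF A x a] .
    then have "l (a \<otimes>\<^bsub>H\<^esub> x) w \<in> nil_part W W0 a (Suc n)" using 1 Suc.prems by blast
    moreover have "l x (l a w) \<in> nil_part W W0 a (Suc n)" using Suc.IH w(2) by simp
    ultimately have "l a (l x w) \<in> nil_part W W0 a (Suc n)"
      using l_mult[OF ac x c[OF w(1)]] nf[of "Suc n"] V.subspaceD(4)[of "nil_part W W0 a (Suc n)"] by simp
    then show ?case using submodD(1)[OF W x w(1)] by simp
  qed
qed

lemma simple_nil_or_inj:
  assumes S: "simple_over W W0" and A: "alg_ideal F H A"
    and AA: "\<And>b c. b \<in> A \<Longrightarrow> c \<in> A \<Longrightarrow> b \<otimes>\<^bsub>H\<^esub> c \<in> annihilator W W0" and a: "a \<in> A"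
  shows "W \<subseteq> (\<Union>n. nil_part W W0 a n) \<or> (\<forall>w\<in>W. l a w \<in> W0 \<longrightarrow> w \<in> W0)"
proof -
  note S' = simple_overD[OF S]
  have ac: "a \<in> carrier H" using a H.ideal_carrier[OF A] by blast
  note nf = nil_part_facts[OF S'(1-3) ac]
  have ns: "subspace F (nil_part W W0 a n) V" for n using nf[of n] by (elim conjE)
  let ?N = "\<Union>n. nil_part W W0 a n"
  have mono: "nil_part W W0 a m \<subseteq> nil_part W W0 a n" if "m \<le> n" for m n
  proof (rule lift_Suc_mono_le[OF _ that])
    show "nil_part W W0 a k \<subseteq> nil_part W W0 a (Suc k)" for k using nf[of k] by (elim conjE)
  qed
  have sub: "subspace F ?N V"
  proof (rule V.subspaceI)
    show "?N \<subseteq> carrier V" using ns V.subspaceD(1) by blast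
    show "\<zero>\<^bsub>V\<^esub> \<in> ?N" using V.subspaceD(2)[OF ns[of 0]] by blast
    show "c \<odot>\<^bsub>V\<^esub> x \<in> ?N" if cx: "c \<in> carrier F" "x \<in> ?N" for c x
    proof -
      obtain n where "x \<in> nil_part W W0 a n" using cx(2) by blast
      then show ?thesis using V.subspaceD(5)[OF ns[of n] cx(1)] by blast
    qed
    fix x y assume "x \<in> ?N" "y \<in> ?N"
    then obtain m n where "x \<in> nil_part W W0 a m" "y \<in> nil_part W W0 a n" by blast
    then have "x \<in> nil_part W W0 a (max m n)" "y \<in> nil_part W W0 a (max m n)"
      using mono[of m "max m n"] mono[of n "max m n"] by auto
    then show "x \<oplus>\<^bsub>V\<^esub> y \<in> ?N" using V.subspaceD(4)[OF ns[of "max m n"]] by blast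
  qed
  have "?N = W0 \<or> ?N = W"
  proof (rule simple_left_submod[OF S sub])
    show "W0 \<subseteq> ?N" using nil_part.simps(1)[of W W0 a] by blast
    show "?N \<subseteq> W" by (intro UN_least conjunct1[OF conjunct2[OF nf]])
    show "l x t \<in> ?N" if "x \<in> carrier H" "t \<in> ?N" for x t
      using that nil_part_invariant(2)[OF S'(1-3) A AA a] by blast
  qed
  then show ?thesis
  proof
    assume N: "?N = W0"
    have "w \<in> W0" if "w \<in> W" "l a w \<in> W0" for w
    proof -
      have "w \<in> nil_part W W0 a (Suc 0)" using that by simp
      then show ?thesis using N by blast
    qed
    then show ?thesis by blast
  qed blast
qed

text \<open>An Engel argument. If every a in A were nilpotent, take T minimal among the A-invariant
  subspaces properly above W0. Each a has a kernel in T beyond W0; that kernel is A-invariant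
  because A acts commutatively, so it is all of T. The elements killed by A from the left thus form
  a left submodule larger than W0, hence all of W, and then A kills W from the right too.\<close>

lemma simple_injective_exists:
  assumes fd: "V.fin_dim" and S: "simple_over W W0" and A: "alg_ideal F H A"
    and AA: "\<And>b c. b \<in> A \<Longrightarrow> c \<in> A \<Longrightarrow> b \<otimes>\<^bsub>H\<^esub> c \<in> annihilator W W0"
    and nA: "\<not> A \<subseteq> annihilator W W0"
  shows "\<exists>a\<in>A. \<forall>w\<in>W. l a w \<in> W0 \<longrightarrow> w \<in> W0"
proof (rule ccontr)
  assume "\<not> ?thesis"
  then have nil: "W \<subseteq> (\<Union>n. nil_part W W0 a n)" if "a \<in> A" for a
    using simple_nil_or_inj[OF S A AA that] that by blast
  note S' = simple_overD[OF S]
  note c = submod_carrier[OF S'(1)]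
  note s = V.subspaceD[OF submod_subspace[OF S'(1)]]
  note s0 = V.subspaceD[OF submod_subspace[OF S'(2)]]
  have Ac: "\<And>a. a \<in> A \<Longrightarrow> a \<in> carrier H" using H.ideal_carrier[OF A] by blast
  define P where "P T \<longleftrightarrow> subspace F T V \<and> W0 \<subset> T \<and> T \<subseteq> W \<and> (\<forall>a\<in>A. \<forall>t\<in>T. l a t \<in> T)" for T
  have "P W" using S' submodD(1)[OF S'(1)] Ac submod_subspace by (auto simp: P_def)
  moreover have "\<And>T. P T \<Longrightarrow> subspace F T V" by (simp add: P_def)
  ultimately obtain T where T: "P T" and min: "\<And>T'. P T' \<Longrightarrow> T' \<subseteq> T \<Longrightarrow> T' = T"
    using V.minimal_subspace_exists[OF fd, of P] by metis
  then have sT: "subspace F T V" "W0 \<subset> T" "T \<subseteq> W" "\<And>a t. a \<in> A \<Longrightarrow> t \<in> T \<Longrightarrow> l a t \<in> T"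
    by (auto simp: P_def)
  note tT = V.subspaceD[OF sT(1)]
  have ann: "l a t \<in> W0" if a: "a \<in> A" and t: "t \<in> T" for a t
  proof -
    define T' where "T' = {t \<in> T. l a t \<in> W0}"
    \<comment> \<open>Along t, at, a(at), ... the last term outside W0 is sent into W0 by a.\<close>
    have "\<exists>t\<in>T. t \<notin> W0 \<and> l a t \<in> W0" if "t \<in> T" "t \<notin> W0" "t \<in> nil_part W W0 a n" for t n
      using that
    proof (induction n arbitrary: t)
      case (Suc n)
      show ?case
      proof (cases "l a t \<in> W0")
        case False
        then show ?thesis using Suc.IH[of "l a t"] Suc.prems sT(4)[OF a] by simp
      qed (use Suc.prems in blast)
    qed simp
    moreover obtain t0 where "t0 \<in> T" "t0 \<notin> W0" using sT(2) by blast
    moreover from this obtain n where "t0 \<in> nil_part W W0 a n" using nil[OF a] sT(3) by blast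
    ultimately obtain t1 where t1: "t1 \<in> T" "t1 \<notin> W0" "l a t1 \<in> W0" by blast
    have "P T'"
    proof -
      have "subspace F T' V"
        using tT s0 Ac[OF a] by (intro V.subspaceI) (auto simp: T'_def l_zero l_add2 l_smult2)
      moreover have "W0 \<subset> T'" using sT(2) t1 submodD(1)[OF S'(2) Ac[OF a]] by (auto simp: T'_def)
      moreover have "l b u \<in> T'" if b: "b \<in> A" and u: "u \<in> T'" for b u
      proof -
        have u': "u \<in> T" "l a u \<in> W0" "u \<in> W" using u sT(3) by (auto simp: T'_def)
        have "l (a \<otimes>\<^bsub>H\<^esub> b) u \<in> W0" using AA[OF a b] u'(3) by (simp add: annihilator_def)
        moreover have "l b (l a u) \<in> W0" using u'(2) submodD(1)[OF S'(2) Ac[OF b]] by simp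
        ultimately have "l a (l b u) \<in> W0"
          using l_mult[OF Ac[OF a] Ac[OF b] c[OF u'(3)]] s0(4) by simp
        then show ?thesis using sT(4)[OF b u'(1)] by (simp add: T'_def)
      qed
      ultimately show ?thesis using sT(3) by (auto simp: P_def T'_def)
    qed
    then have "T' = T" using min by (auto simp: T'_def)
    then show ?thesis using t by (auto simp: T'_def)
  qed
  define N where "N = {w \<in> W. \<forall>a\<in>A. l a w \<in> W0}"
  have "N = W0 \<or> N = W"
  proof (rule simple_left_submod[OF S])
    show "subspace F N V"
      using s s0 Ac by (intro V.subspaceI) (auto simp: N_def l_zero l_add2 l_smult2)
    show "W0 \<subseteq> N" using S'(3) submodD(1)[OF S'(2)] Ac by (auto simp: N_def)
    show "N \<subseteq> W" by (auto simp: N_def)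
    fix x w assume x: "x \<in> carrier H" and w: "w \<in> N"
    have w': "w \<in> W" "\<And>a. a \<in> A \<Longrightarrow> l a w \<in> W0" using w by (auto simp: N_def)
    have "l a (l x w) \<in> W0" if a: "a \<in> A" for a
      using l_mult[OF Ac[OF a] x c[OF w'(1)]] w'(2)[OF H.ideal_mult(2)[OF A x a]]
        submodD(1)[OF S'(2) x w'(2)[OF a]] s0(4) by simp
    then show "l x w \<in> N" using submodD(1)[OF S'(1) x w'(1)] by (simp add: N_def)
  qed
  moreover have "T \<subseteq> N" using ann sT(3) by (auto simp: N_def)
  ultimately have N: "N = W" using sT(2) by blast
  have "a \<in> annihilator W W0" if a: "a \<in> A" for a
  proof -
    have la: "l a w \<in> W0" if "w \<in> W" for w using N a that by (auto simp: N_def)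
    have "r w a \<in> W0" if w: "w \<in> W" for w
    proof -
      consider "r w a \<in> W0" | "eqmod V W0 (r w a) (\<ominus>\<^bsub>V\<^esub> l a w)"
        using simple_sym_or_antisym[OF S] Ac[OF a] w by blast
      then show ?thesis
      proof cases
        case 2
        have "\<ominus>\<^bsub>V\<^esub> l a w \<in> W0" using la[OF w] s0(6) by blast
        then show ?thesis
          using V.eqmod_mem[OF submod_subspace[OF S'(2)] 2 submod_subspace[OF S'(2)] order_refl]
            r_closed[OF Ac[OF a] c[OF w]] s0(3) by blast
      qed
    qed
    then show ?thesis using la Ac[OF a] by (simp add: annihilator_def)
  qed
  then show False using nA by blast
qed

text \<open>The subspaces T n, which are a^n W modulo W0, descend and so become stationary. From a^n
  w congruent to a^(n+1) v the injectivity of a cancels a^n, leaving w congruent to av.\<close>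

lemma injective_imp_surjective:
  assumes fd: "V.fin_dim" and W: "submod W" and W0: "submod W0" "W0 \<subseteq> W" and a: "a \<in> carrier H"
    and inj: "\<And>w. w \<in> W \<Longrightarrow> l a w \<in> W0 \<Longrightarrow> w \<in> W0" and w: "w \<in> W"
  shows "\<exists>w'\<in>W. eqmod V W0 w (l a w')"
proof -
  note c = submod_carrier[OF W]
  note s = V.subspaceD[OF submod_subspace[OF W]]
  note sub0 = submod_subspace[OF W0(1)]
  have pow: "(l a ^^ n) u \<in> W" if "u \<in> W" for n u
    using that by (induction n) (auto intro: submodD(1)[OF W a])
  have pow_add: "(l a ^^ n) (u \<oplus>\<^bsub>V\<^esub> v) = (l a ^^ n) u \<oplus>\<^bsub>V\<^esub> (l a ^^ n) v" if "u \<in> W" "v \<in> W" for n u v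
    by (induction n) (use that in \<open>auto simp: l_add2 a c pow\<close>)
  have pow_smult: "(l a ^^ n) (k \<odot>\<^bsub>V\<^esub> u) = k \<odot>\<^bsub>V\<^esub> (l a ^^ n) u" if "k \<in> carrier F" "u \<in> W" for n k u
    by (induction n) (use that in \<open>auto simp: l_smult2 a c pow\<close>)
  have pow_minus: "(l a ^^ n) (u \<ominus>\<^bsub>V\<^esub> v) = (l a ^^ n) u \<ominus>\<^bsub>V\<^esub> (l a ^^ n) v" if "u \<in> W" "v \<in> W" for n u v
    by (induction n) (use that in \<open>auto simp: l_minus a c pow\<close>)
  have pow_zero: "(l a ^^ n) \<zero>\<^bsub>V\<^esub> = \<zero>\<^bsub>V\<^esub>" for n
    by (induction n) (auto simp: l_zero a)
  have pow_inj: "u \<in> W0" if "u \<in> W" "(l a ^^ n) u \<in> W0" for n u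
    using that by (induction n) (auto simp: inj pow)
  define T where "T n = {u \<in> W. \<exists>v\<in>W. eqmod V W0 u ((l a ^^ n) v)}" for n
  have subT: "subspace F (T n) V" for n
  proof (rule V.subspaceI)
    show "T n \<subseteq> carrier V" using c by (auto simp: T_def)
    show "\<zero>\<^bsub>V\<^esub> \<in> T n"
      using s(2) pow_zero[of n] V.eqmod_refl[OF sub0] by (auto simp: T_def intro!: bexI[of _ "\<zero>\<^bsub>V\<^esub>"])
    show "x \<oplus>\<^bsub>V\<^esub> y \<in> T n" if xy: "x \<in> T n" "y \<in> T n" for x y
    proof -
      obtain u v where uv: "u \<in> W" "v \<in> W" "eqmod V W0 x ((l a ^^ n) u)" "eqmod V W0 y ((l a ^^ n) v)"
        "x \<in> W" "y \<in> W" using xy by (auto simp: T_def)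
      then have "eqmod V W0 (x \<oplus>\<^bsub>V\<^esub> y) ((l a ^^ n) (u \<oplus>\<^bsub>V\<^esub> v))"
        using V.eqmod_add[OF sub0 uv(3,4)] c pow by (simp add: pow_add)
      then show ?thesis using uv s(4) by (auto simp: T_def)
    qed
    show "k \<odot>\<^bsub>V\<^esub> x \<in> T n" if k: "k \<in> carrier F" and x: "x \<in> T n" for k x
    proof -
      obtain u where u: "u \<in> W" "eqmod V W0 x ((l a ^^ n) u)" "x \<in> W" using x by (auto simp: T_def)
      then have "eqmod V W0 (k \<odot>\<^bsub>V\<^esub> x) ((l a ^^ n) (k \<odot>\<^bsub>V\<^esub> u))"
        using V.eqmod_smult[OF sub0 u(2) k] c pow k by (simp add: pow_smult)
      then show ?thesis using u s(5) k by (auto simp: T_def)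
    qed
  qed
  have step: "T (Suc n) \<subseteq> T n" for n
  proof
    fix u assume "u \<in> T (Suc n)"
    then obtain v where v: "u \<in> W" "v \<in> W" "eqmod V W0 u ((l a ^^ Suc n) v)" by (auto simp: T_def)
    then show "u \<in> T n"
      using submodD(1)[OF W a v(2)] by (auto simp: T_def funpow_Suc_right simp del: funpow.simps)
  qed
  define P where "P S \<longleftrightarrow> (\<exists>n. S = T n)" for S
  have "P (T 0)" by (auto simp: P_def)
  moreover have "\<And>S. P S \<Longrightarrow> subspace F S V" using subT by (auto simp: P_def)
  ultimately obtain S where "P S" "\<And>S'. P S' \<Longrightarrow> S' \<subseteq> S \<Longrightarrow> S' = S"
    using V.minimal_subspace_exists[OF fd, of P] by metis
  then obtain n where n: "T (Suc n) = T n" using step by (auto simp: P_def)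
  have "(l a ^^ n) w \<in> T n"
    using w pow[OF w, of n] V.eqmod_refl[OF sub0 c[OF pow[OF w, of n]]] unfolding T_def by blast
  then obtain v where v: "v \<in> W" "eqmod V W0 ((l a ^^ n) w) ((l a ^^ Suc n) v)"
    using n by (auto simp: T_def)
  have av: "l a v \<in> W" by (rule submodD(1)[OF W a v(1)])
  have "(l a ^^ n) (w \<ominus>\<^bsub>V\<^esub> l a v) \<in> W0"
    using v(2) pow_minus[OF w av] by (simp add: eqmod_def funpow_Suc_right del: funpow.simps)
  then have "w \<ominus>\<^bsub>V\<^esub> l a v \<in> W0" using pow_inj s(7)[OF w av] by blast
  then show ?thesis using v(1) by (auto simp: eqmod_def)
qed

end

subsection \<open>Cocycles in modules without central submodules\<close>

lemma (in vectorspace) eqmod_absorb: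
  assumes S: "subspace K S V" and "p \<in> S" "q \<in> carrier V"
  shows "eqmod V S (p \<oplus>\<^bsub>V\<^esub> q) q" "eqmod V S (q \<oplus>\<^bsub>V\<^esub> p) q"
proof -
  have p: "p \<in> carrier V" using assms subspaceD(3)[OF S] by blast
  have "(p \<oplus>\<^bsub>V\<^esub> q) \<ominus>\<^bsub>V\<^esub> q = p" "(q \<oplus>\<^bsub>V\<^esub> p) \<ominus>\<^bsub>V\<^esub> q = p" using p assms(3) by algebra+
  then show "eqmod V S (p \<oplus>\<^bsub>V\<^esub> q) q" "eqmod V S (q \<oplus>\<^bsub>V\<^esub> p) q" using assms(2) by (simp_all add: eqmod_def)
qed

locale class_bimod = bimod F H V l r + schunck_formation_class F \<HH>
  for F :: "('f, 'm) ring_scheme" and H :: "('f, 'h, 'n) module_scheme"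
    and V :: "('f, 'v, 'k) module_scheme" and l r and \<HH> :: "'f alg_class" +
  assumes solH: "soluble_leibniz F H" and inH: "in_class F \<HH> H" and fd: "V.fin_dim"
begin

text \<open>\<open>central U W\<close> says that the split extension of \<open>U/W\<close> by \<open>H\<close> lies in the class.\<close>

definition central :: "'v set \<Rightarrow> 'v set \<Rightarrow> bool" where
  "central U W \<longleftrightarrow> inq (SDU U) (W \<times> {\<zero>\<^bsub>H\<^esub>})"

definition central_free :: "'v set \<Rightarrow> bool" where
  "central_free W \<longleftrightarrow> submod W \<and> (\<forall>U. submod U \<and> W \<subset> U \<longrightarrow> \<not> central U W)"

text \<open>Equivalently, x \<mapsto> (f x, x) is a homomorphism of H into the split extension of
  V/W. The inner cocycles are x \<mapsto> \<open>r v x\<close>: in a left Leibniz algebra left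
  multiplication by v is a derivation.\<close>

definition cocycle :: "'v set \<Rightarrow> ('h \<Rightarrow> 'v) \<Rightarrow> bool" where
  "cocycle W f \<longleftrightarrow> (\<forall>x\<in>carrier H. f x \<in> carrier V) \<and>
     (\<forall>x\<in>carrier H. \<forall>y\<in>carrier H. eqmod V W (f (x \<oplus>\<^bsub>H\<^esub> y)) (f x \<oplus>\<^bsub>V\<^esub> f y)) \<and>
     (\<forall>c\<in>carrier F. \<forall>x\<in>carrier H. eqmod V W (f (c \<odot>\<^bsub>H\<^esub> x)) (c \<odot>\<^bsub>V\<^esub> f x)) \<and>
     (\<forall>x\<in>carrier H. \<forall>y\<in>carrier H. eqmod V W (f (x \<otimes>\<^bsub>H\<^esub> y)) (r (f x) y \<oplus>\<^bsub>V\<^esub> l x (f y)))"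

lemma SDU_soluble: "submod U \<Longrightarrow> soluble_leibniz F (SDU U)"
  using bimod.semidirect_soluble[OF restrict_bimod solH] V.subspace_fin_dim[OF fd submod_subspace]
  by blast

lemma SDU_incl_hom: "U \<subseteq> W \<Longrightarrow> (\<lambda>x. x) \<in> alg_hom F (SDU U) (SDU W)"
  by (rule alg_homI) auto

text \<open>T/W0 and U/W are isomorphic as bimodules since T + W = U and T meets W in W0; the
  inclusion of T in U induces an isomorphism of the split extensions.\<close>

lemma central_complement:
  assumes sm: "submod U" "submod T" "submod W" "submod W0" and sub: "T \<subseteq> U" "W \<subseteq> U" "W0 \<subseteq> T"
    and compl: "\<And>u. u \<in> U \<Longrightarrow> \<exists>t\<in>T. eqmod V W u t" and int: "T \<inter> W = W0" and cen: "central U W"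
  shows "central T W0"
  unfolding central_def
proof (rule inq_transfer_back[OF SDU_leibniz[OF sm(2)] SDU_leibniz[OF sm(1)]
      SDU_ideal[OF sm(2,4) sub(3)] SDU_ideal[OF sm(1,3) sub(2)]])
  show "hom_mod F (SDU T) (SDU U) (W \<times> {\<zero>\<^bsub>H\<^esub>}) (\<lambda>x. x)"
    by (rule hom_hom_mod[OF SDU_leibniz[OF sm(1)] SDU_ideal[OF sm(1,3) sub(2)] SDU_incl_hom[OF sub(1)]])
  show "x \<in> W \<times> {\<zero>\<^bsub>H\<^esub>} \<longleftrightarrow> x \<in> W0 \<times> {\<zero>\<^bsub>H\<^esub>}" if "x \<in> carrier (SDU T)" for x
    using that int by auto
  show "\<exists>x\<in>carrier (SDU T). eqmod (SDU U) (W \<times> {\<zero>\<^bsub>H\<^esub>}) y x" if y: "y \<in> carrier (SDU U)" for y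
  proof -
    obtain u h where y: "y = (u, h)" "u \<in> U" "h \<in> carrier H" using y by auto
    then obtain t where t: "t \<in> T" "eqmod V W u t" using compl by blast
    then have "eqmod (SDU U) (W \<times> {\<zero>\<^bsub>H\<^esub>}) (u, h) (t, h)"
      using SDU_eqmod[OF sm(1)] y sub(1) by blast
    then show ?thesis using y t by auto
  qed
  show "inq (SDU U) (W \<times> {\<zero>\<^bsub>H\<^esub>})" using cen by (simp add: central_def)
qed

text \<open>Lets the induction in \<open>cocycle_inner\<close> climb past a simple submodule: a
  central U/W would split off from U/W0 and become a non-zero central submodule of V/W0.\<close>

lemma central_free_quotient:
  assumes free: "central_free W0" and S: "simple_over W W0"
  shows "central_free W"
proof -
  note S' = simple_overD[OF S]
  have "\<not> central U W" if U: "submod U" and WU: "W \<subset> U" for U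
  proof
    assume cen: "central U W"
    have Xs: "soluble_leibniz F (SDU U)" by (rule SDU_soluble[OF U])
    have Xl: "leibniz_algebra F (SDU U)" by (rule SDU_leibniz[OF U])
    interpret X: leibniz_algebra F "SDU U" by (rule Xl)
    have W0U: "W0 \<subset> U" using WU S' by blast
    have iW0: "alg_ideal F (SDU U) (W0 \<times> {\<zero>\<^bsub>H\<^esub>})" using SDU_ideal U S' W0U by blast
    have iW: "alg_ideal F (SDU U) (W \<times> {\<zero>\<^bsub>H\<^esub>})" using SDU_ideal U S' WU by blast
    have iU: "alg_ideal F (SDU U) (U \<times> {\<zero>\<^bsub>H\<^esub>})" using SDU_ideal[OF U U] by blast
    have "\<not> central U W0" using free U W0U by (simp add: central_free_def)
    then obtain J where J: "alg_ideal F (SDU U) J" "W0 \<times> {\<zero>\<^bsub>H\<^esub>} \<subseteq> J" "prim_quot F (SDU U) J"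
      "\<not> inq (SDU U) J"
      using inqI_primitive[OF Xs iW0] unfolding central_def by blast
    \<comment> \<open>Otherwise X/J would be a quotient of the split extension of U/W, which lies in
      the class.\<close>
    have WJ: "\<not> W \<times> {\<zero>\<^bsub>H\<^esub>} \<subseteq> J"
    proof
      assume *: "W \<times> {\<zero>\<^bsub>H\<^esub>} \<subseteq> J"
      have "inq (SDU U) J"
      proof (rule inq_transfer[OF Xl Xl iW J(1)])
        show "hom_mod F (SDU U) (SDU U) J (\<lambda>x. x)"
          by (rule hom_hom_mod[OF Xl J(1) SDU_incl_hom[OF order_refl]])
        show "\<exists>x\<in>carrier (SDU U). eqmod (SDU U) J y x" if "y \<in> carrier (SDU U)" for y
          using that X.eqmod_refl[OF X.ideal_subspace[OF J(1)]] by blast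
        show "inq (SDU U) (W \<times> {\<zero>\<^bsub>H\<^esub>})" using cen by (simp add: central_def)
      qed (use * in blast)
      then show False using J(4) by blast
    qed
    have UJ: "\<not> U \<times> {\<zero>\<^bsub>H\<^esub>} \<subseteq> J" using WJ WU by blast
    have zJ: "(\<zero>\<^bsub>V\<^esub>, \<zero>\<^bsub>H\<^esub>) \<in> J" using X.subspaceD(2)[OF X.ideal_subspace[OF J(1)]] by simp
    have prod: "x \<otimes>\<^bsub>SDU U\<^esub> y \<in> J" if "x \<in> U \<times> {\<zero>\<^bsub>H\<^esub>}" "y \<in> U \<times> {\<zero>\<^bsub>H\<^esub>}" for x y
      using that zJ submod_carrier[OF U] by (auto simp: l_zero r_zero)
    have prodW: "x \<otimes>\<^bsub>SDU U\<^esub> y \<in> J" if "x \<in> W \<times> {\<zero>\<^bsub>H\<^esub>}" "y \<in> W \<times> {\<zero>\<^bsub>H\<^esub>}" for x y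
      by (rule prod) (use that WU in auto)
    \<comment> \<open>The complement: T meets W in W0 because W/W0 is simple and W does not lie in
      J, and T + W = U because U and W have the same image in the primitive quotient.\<close>
    define T where "T = {u \<in> U. (u, \<zero>\<^bsub>H\<^esub>) \<in> J}"
    have T: "submod T" unfolding T_def by (rule SDU_ideal_submod[OF U J(1)])
    have TW: "T \<inter> W = W0"
    proof -
      have "W0 \<subseteq> T \<inter> W" using J(2) W0U S'(3) by (auto simp: T_def)
      then have "T \<inter> W = W0 \<or> T \<inter> W = W" using S'(5)[OF submod_Int[OF T S'(1)]] by blast
      moreover have "T \<inter> W \<noteq> W" using WJ by (auto simp: T_def)
      ultimately show ?thesis by blast
    qed
    have compl: "\<exists>t\<in>T. eqmod V W u t" if u: "u \<in> U" for u
    proof -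
      have "\<exists>y\<in>W \<times> {\<zero>\<^bsub>H\<^esub>}. eqmod (SDU U) J (u, \<zero>\<^bsub>H\<^esub>) y"
        by (rule X.prim_quot_socle[OF J(1,3) iW WJ prodW iU UJ prod]) (use u in simp_all)
      then obtain w where w: "w \<in> W" "eqmod (SDU U) J (u, \<zero>\<^bsub>H\<^esub>) (w, \<zero>\<^bsub>H\<^esub>)" by blast
      have wU: "w \<in> U" using w WU by blast
      interpret U: bimod F H "V\<lparr>carrier := U\<rparr>" l r by (rule restrict_bimod[OF U])
      have "(u, \<zero>\<^bsub>H\<^esub>) \<ominus>\<^bsub>SDU U\<^esub> (w, \<zero>\<^bsub>H\<^esub>) = (u \<ominus>\<^bsub>V\<^esub> w, \<zero>\<^bsub>H\<^esub>)"
        unfolding semidirect_def using u wU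
        by (simp add: vs_pair.pair_minus[OF U.vs_pair] V.restrict_minus[OF submod_subspace[OF U]] H.minus_eq_zero_iff)
      then have "(u \<ominus>\<^bsub>V\<^esub> w, \<zero>\<^bsub>H\<^esub>) \<in> J" using w(2) by (simp add: eqmod_def)
      then have uw: "u \<ominus>\<^bsub>V\<^esub> w \<in> T"
        using u wU V.subspaceD(7)[OF submod_subspace[OF U]] by (simp add: T_def)
      have c: "u \<in> carrier V" "w \<in> carrier V" using u wU submod_carrier[OF U] by auto
      have "u \<ominus>\<^bsub>V\<^esub> (u \<ominus>\<^bsub>V\<^esub> w) = w" using c by algebra
      then have "eqmod V W u (u \<ominus>\<^bsub>V\<^esub> w)" using w(1) by (simp add: eqmod_def)
      then show ?thesis using uw by blast
    qed
    have W0T: "W0 \<subseteq> T" using TW by blast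
    have "central T W0"
      by (rule central_complement[OF U T S'(1,2) _ _ W0T compl TW cen]) (use WU in \<open>auto simp: T_def\<close>)
    moreover have "W0 \<noteq> T"
    proof
      assume "W0 = T"
      have "u \<in> W" if u: "u \<in> U" for u
      proof -
        obtain t where t: "t \<in> T" "eqmod V W u t" using compl[OF u] by blast
        then have "t \<in> W" using \<open>W0 = T\<close> S'(3) by blast
        then show ?thesis
          using V.eqmod_mem[OF submod_subspace[OF S'(1)] t(2) submod_subspace[OF S'(1)] order_refl]
            u submod_carrier[OF U] submod_carrier[OF S'(1)] by blast
      qed
      then show False using WU by blast
    qed
    ultimately show False using free T W0T by (auto simp: central_free_def)
  qed
  then show ?thesis using S'(1) by (simp add: central_free_def)
qed

lemma cocycleD:
  assumes "cocycle W f"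
  shows "\<And>x. x \<in> carrier H \<Longrightarrow> f x \<in> carrier V"
    "\<And>x y. x \<in> carrier H \<Longrightarrow> y \<in> carrier H \<Longrightarrow> eqmod V W (f (x \<oplus>\<^bsub>H\<^esub> y)) (f x \<oplus>\<^bsub>V\<^esub> f y)"
    "\<And>c x. c \<in> carrier F \<Longrightarrow> x \<in> carrier H \<Longrightarrow> eqmod V W (f (c \<odot>\<^bsub>H\<^esub> x)) (c \<odot>\<^bsub>V\<^esub> f x)"
    "\<And>x y. x \<in> carrier H \<Longrightarrow> y \<in> carrier H \<Longrightarrow>
      eqmod V W (f (x \<otimes>\<^bsub>H\<^esub> y)) (r (f x) y \<oplus>\<^bsub>V\<^esub> l x (f y))"
  using assms by (auto simp: cocycle_def)

lemma cocycle_minus_inner: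
  assumes W: "submod W" and f: "cocycle W f" and v: "v \<in> carrier V"
  shows "cocycle W (\<lambda>x. f x \<ominus>\<^bsub>V\<^esub> r v x)"
proof -
  note f = cocycleD[OF f]
  note em = V.eqmod_minus[OF submod_subspace[OF W]] V.eqmod_refl[OF submod_subspace[OF W]]
  note [simp] = f(1) v r_closed l_closed H.mult_closed
  show ?thesis
    unfolding cocycle_def
  proof (intro conjI ballI)
    fix x assume "x \<in> carrier H"
    then show "f x \<ominus>\<^bsub>V\<^esub> r v x \<in> carrier V" by simp
  next
    fix x y assume xy: "x \<in> carrier H" "y \<in> carrier H"
    have "eqmod V W (f (x \<oplus>\<^bsub>H\<^esub> y) \<ominus>\<^bsub>V\<^esub> r v (x \<oplus>\<^bsub>H\<^esub> y)) ((f x \<oplus>\<^bsub>V\<^esub> f y) \<ominus>\<^bsub>V\<^esub> r v (x \<oplus>\<^bsub>H\<^esub> y))"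
      by (rule em(1)[OF f(2)[OF xy] em(2)]) (use xy in simp_all)
    moreover have "(f x \<oplus>\<^bsub>V\<^esub> f y) \<ominus>\<^bsub>V\<^esub> r v (x \<oplus>\<^bsub>H\<^esub> y) = (f x \<ominus>\<^bsub>V\<^esub> r v x) \<oplus>\<^bsub>V\<^esub> (f y \<ominus>\<^bsub>V\<^esub> r v y)"
    proof -
      have c: "f x \<in> carrier V" "f y \<in> carrier V" "r v x \<in> carrier V" "r v y \<in> carrier V" using xy by auto
      show ?thesis unfolding r_add2[OF xy v] using c by algebra
    qed
    ultimately show "eqmod V W (f (x \<oplus>\<^bsub>H\<^esub> y) \<ominus>\<^bsub>V\<^esub> r v (x \<oplus>\<^bsub>H\<^esub> y)) ((f x \<ominus>\<^bsub>V\<^esub> r v x) \<oplus>\<^bsub>V\<^esub> (f y \<ominus>\<^bsub>V\<^esub> r v y))"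
      by simp
    have "eqmod V W (f (x \<otimes>\<^bsub>H\<^esub> y) \<ominus>\<^bsub>V\<^esub> r v (x \<otimes>\<^bsub>H\<^esub> y)) ((r (f x) y \<oplus>\<^bsub>V\<^esub> l x (f y)) \<ominus>\<^bsub>V\<^esub> r v (x \<otimes>\<^bsub>H\<^esub> y))"
      by (rule em(1)[OF f(4)[OF xy] em(2)]) (use xy in simp_all)
    moreover have "(r (f x) y \<oplus>\<^bsub>V\<^esub> l x (f y)) \<ominus>\<^bsub>V\<^esub> r v (x \<otimes>\<^bsub>H\<^esub> y) =
      r (f x \<ominus>\<^bsub>V\<^esub> r v x) y \<oplus>\<^bsub>V\<^esub> l x (f y \<ominus>\<^bsub>V\<^esub> r v y)"
    proof -
      have c: "r (f x) y \<in> carrier V" "l x (f y) \<in> carrier V" "r (r v x) y \<in> carrier V" "l x (r v y) \<in> carrier V"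
        using xy by auto
      have "(r (f x) y \<oplus>\<^bsub>V\<^esub> l x (f y)) \<ominus>\<^bsub>V\<^esub> (r (r v x) y \<oplus>\<^bsub>V\<^esub> l x (r v y)) =
        (r (f x) y \<ominus>\<^bsub>V\<^esub> r (r v x) y) \<oplus>\<^bsub>V\<^esub> (l x (f y) \<ominus>\<^bsub>V\<^esub> l x (r v y))"
        using c by algebra
      then show ?thesis using xy by (simp add: r_mult l_minus r_minus)
    qed
    ultimately show "eqmod V W (f (x \<otimes>\<^bsub>H\<^esub> y) \<ominus>\<^bsub>V\<^esub> r v (x \<otimes>\<^bsub>H\<^esub> y))
      (r (f x \<ominus>\<^bsub>V\<^esub> r v x) y \<oplus>\<^bsub>V\<^esub> l x (f y \<ominus>\<^bsub>V\<^esub> r v y))" by simp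
  next
    fix c x assume cx: "c \<in> carrier F" "x \<in> carrier H"
    have "eqmod V W (f (c \<odot>\<^bsub>H\<^esub> x) \<ominus>\<^bsub>V\<^esub> r v (c \<odot>\<^bsub>H\<^esub> x)) ((c \<odot>\<^bsub>V\<^esub> f x) \<ominus>\<^bsub>V\<^esub> r v (c \<odot>\<^bsub>H\<^esub> x))"
      by (rule em(1)[OF f(3)[OF cx] em(2)]) (use cx in simp_all)
    moreover have "(c \<odot>\<^bsub>V\<^esub> f x) \<ominus>\<^bsub>V\<^esub> r v (c \<odot>\<^bsub>H\<^esub> x) = c \<odot>\<^bsub>V\<^esub> (f x \<ominus>\<^bsub>V\<^esub> r v x)"
      using cx by (simp add: r_smult2 V.M.minus_eq V.smult_r_distr V.smult_r_minus)
    ultimately show "eqmod V W (f (c \<odot>\<^bsub>H\<^esub> x) \<ominus>\<^bsub>V\<^esub> r v (c \<odot>\<^bsub>H\<^esub> x)) (c \<odot>\<^bsub>V\<^esub> (f x \<ominus>\<^bsub>V\<^esub> r v x))" by simp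
  qed
qed

lemma cocycle_zero_mem:
  assumes W: "submod W" and f: "cocycle W f"
  shows "f \<zero>\<^bsub>H\<^esub> \<in> W"
proof -
  have "eqmod V W (f (\<zero>\<^bsub>F\<^esub> \<odot>\<^bsub>H\<^esub> \<zero>\<^bsub>H\<^esub>)) (\<zero>\<^bsub>F\<^esub> \<odot>\<^bsub>V\<^esub> f \<zero>\<^bsub>H\<^esub>)"
    by (rule cocycleD(3)[OF f]) simp_all
  then show ?thesis
    using cocycleD(1)[OF f] V.eqmod_zero[OF submod_subspace[OF W]] by simp
qed

lemma inqH: "inq H {\<zero>\<^bsub>H\<^esub>}"
  using inH in_class_iff_inq_zero[OF H.leibniz_algebra_axioms] by simp

text \<open>One of the two terms of the cocycle identity is k acting on the value f x in W, which
  lies in W0. So on the annihilator f is a bimodule homomorphism into W/W0.\<close>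

lemma cocycle_l_kernel:
  assumes f: "cocycle W0 f" and S: "simple_over W W0" and fW: "\<And>x. x \<in> carrier H \<Longrightarrow> f x \<in> W"
    and x: "x \<in> carrier H" and k: "k \<in> annihilator W W0"
  shows "eqmod V W0 (f (x \<otimes>\<^bsub>H\<^esub> k)) (l x (f k))" "eqmod V W0 (f (k \<otimes>\<^bsub>H\<^esub> x)) (r (f k) x)"
proof -
  note S' = simple_overD[OF S]
  note sub0 = submod_subspace[OF S'(2)]
  have kc: "k \<in> carrier H" using k by (simp add: annihilator_def)
  note c = cocycleD(1)[OF f x] cocycleD(1)[OF f kc]
  have "r (f x) k \<in> W0" "l k (f x) \<in> W0" using k fW[OF x] by (auto simp: annihilator_def)
  then have "eqmod V W0 (r (f x) k \<oplus>\<^bsub>V\<^esub> l x (f k)) (l x (f k))"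
    "eqmod V W0 (r (f k) x \<oplus>\<^bsub>V\<^esub> l k (f x)) (r (f k) x)"
    using V.eqmod_absorb[OF sub0] l_closed r_closed x c by simp_all
  moreover note cocycleD(4)[OF f x kc] cocycleD(4)[OF f kc x]
  moreover have "f (x \<otimes>\<^bsub>H\<^esub> k) \<in> carrier V" "f (k \<otimes>\<^bsub>H\<^esub> x) \<in> carrier V"
    using cocycleD(1)[OF f] H.mult_closed x kc by auto
  ultimately show "eqmod V W0 (f (x \<otimes>\<^bsub>H\<^esub> k)) (l x (f k))" "eqmod V W0 (f (k \<otimes>\<^bsub>H\<^esub> x)) (r (f k) x)"
    using V.eqmod_trans[OF sub0] x kc c by (simp_all add: l_closed r_closed)
qed

text \<open>If a cocycle does not vanish on the annihilator \<open>K\<close>, it identifies \<open>W/W0\<close> with a chief factor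
  of \<open>H\<close> inside \<open>K\<close>, and \<open>(x, y) \<mapsto> (f (x - y), y)\<close> maps the fibre product of \<open>H\<close> with itself
  over \<open>H/K\<close> onto the split extension.\<close>

lemma central_of_cocycle:
  assumes f: "cocycle W0 f" and S: "simple_over W W0" and fW: "\<And>x. x \<in> carrier H \<Longrightarrow> f x \<in> W"
    and onto: "\<And>w. w \<in> W \<Longrightarrow> \<exists>k\<in>annihilator W W0. eqmod V W0 w (f k)"
  shows "central W W0"
proof -
  note S' = simple_overD[OF S]
  note sub0 = submod_subspace[OF S'(2)]
  define K where "K = annihilator W W0"
  have K: "alg_ideal F H K" unfolding K_def by (rule annihilator_ideal[OF S'(1,2)])
  have Kc: "\<And>k. k \<in> K \<Longrightarrow> k \<in> carrier H" by (simp add: K_def annihilator_def)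
  define R where "R = fibre_alg H K"
  have Rl: "leibniz_algebra F R" unfolding R_def by (rule solubleD(1)[OF fibre_soluble[OF solH K]])
  have RK: "alg_ideal F R {(x, y) \<in> carrier R. x \<in> {\<zero>\<^bsub>H\<^esub>} \<and> y \<in> {\<zero>\<^bsub>H\<^esub>}}"
    "inq R {(x, y) \<in> carrier R. x \<in> {\<zero>\<^bsub>H\<^esub>} \<and> y \<in> {\<zero>\<^bsub>H\<^esub>}}"
    unfolding R_def using inq_fibre[OF solH K H.zero_ideal inqH] by blast+
  note fc = cocycleD(1)[OF f]
  note em = SDU_eqmod[OF S'(1)]
  define \<phi> where "\<phi> = (\<lambda>(x, y). (f (x \<ominus>\<^bsub>H\<^esub> y), y))"
  have Rc: "x \<in> carrier H \<and> y \<in> carrier H \<and> x \<ominus>\<^bsub>H\<^esub> y \<in> K" if "(x, y) \<in> carrier R" for x y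
    using that by (auto simp: R_def eqmod_def)
  have hom: "hom_mod F R (SDU W) (W0 \<times> {\<zero>\<^bsub>H\<^esub>}) \<phi>"
    unfolding hom_mod_def
  proof (intro conjI ballI)
    fix z assume "z \<in> carrier R"
    then show "\<phi> z \<in> carrier (SDU W)" using Rc fW by (cases z) (auto simp: \<phi>_def)
  next
    fix z z' assume zR: "z \<in> carrier R" "z' \<in> carrier R"
    obtain x y x' y' where z: "z = (x, y)" "z' = (x', y')" by (cases z, cases z')
    define u u' where "u = x \<ominus>\<^bsub>H\<^esub> y" and "u' = x' \<ominus>\<^bsub>H\<^esub> y'"
    have c: "x \<in> carrier H" "y \<in> carrier H" "x' \<in> carrier H" "y' \<in> carrier H"
      and uK: "u \<in> K" "u' \<in> K" using zR Rc unfolding z u_def u'_def by auto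
    note uc = Kc[OF uK(1)] Kc[OF uK(2)]
    have "(x \<oplus>\<^bsub>H\<^esub> x') \<ominus>\<^bsub>H\<^esub> (y \<oplus>\<^bsub>H\<^esub> y') = u \<oplus>\<^bsub>H\<^esub> u'" unfolding u_def u'_def using c by algebra
    then show "eqmod (SDU W) (W0 \<times> {\<zero>\<^bsub>H\<^esub>}) (\<phi> (z \<oplus>\<^bsub>R\<^esub> z')) (\<phi> z \<oplus>\<^bsub>SDU W\<^esub> \<phi> z')"
      unfolding z using c uc cocycleD(2)[OF f uc] fW V.subspaceD(4)[OF submod_subspace[OF S'(1)]]
      by (simp add: \<phi>_def R_def em u_def[symmetric] u'_def[symmetric])
    \<comment> \<open>Both products on the right have a factor in the annihilator K, so f of each of
      them is given by \<open>cocycle_l_kernel\<close>.\<close>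
    have uu: "(x \<otimes>\<^bsub>H\<^esub> x') \<ominus>\<^bsub>H\<^esub> (y \<otimes>\<^bsub>H\<^esub> y') = (u \<otimes>\<^bsub>H\<^esub> x') \<oplus>\<^bsub>H\<^esub> (y \<otimes>\<^bsub>H\<^esub> u')"
    proof -
      have p: "x \<otimes>\<^bsub>H\<^esub> x' \<in> carrier H" "y \<otimes>\<^bsub>H\<^esub> x' \<in> carrier H" "y \<otimes>\<^bsub>H\<^esub> y' \<in> carrier H" using c H.mult_closed by auto
      show ?thesis unfolding u_def u'_def H.mult_minus(2)[OF c(1,2,3)] H.mult_minus(1)[OF c(2,3,4)] using p by algebra
    qed
    have m: "u \<otimes>\<^bsub>H\<^esub> x' \<in> carrier H" "y \<otimes>\<^bsub>H\<^esub> u' \<in> carrier H" using c uc H.mult_closed by auto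
    note rl = r_closed[OF c(3) fc[OF uc(1)]] r_closed[OF c(4) fc[OF uc(1)]] l_closed[OF c(2) fc[OF uc(2)]]
      r_closed[OF uc(2) fc[OF uc(1)]]
    have "eqmod V W0 (f (u \<otimes>\<^bsub>H\<^esub> x')) (r (f u) y')"
    proof (rule V.eqmod_trans[OF sub0])
      show "eqmod V W0 (f (u \<otimes>\<^bsub>H\<^esub> x')) (r (f u) x')"
        by (rule cocycle_l_kernel(2)[OF f S fW c(3)]) (use uK in \<open>auto simp: K_def\<close>)
      \<comment> \<open>Exchanging x' for y' costs only the action of u', an element of the
        annihilator, on f u.\<close>
      have "x' = u' \<oplus>\<^bsub>H\<^esub> y'" unfolding u'_def using c by algebra
      then have "r (f u) x' = r (f u) u' \<oplus>\<^bsub>V\<^esub> r (f u) y'" using r_add2[OF uc(2) c(4) fc[OF uc(1)]] by simp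
      moreover have "r (f u) u' \<in> W0" using uK(2) fW[OF uc(1)] by (simp add: K_def annihilator_def)
      ultimately show "eqmod V W0 (r (f u) x') (r (f u) y')"
        using V.eqmod_absorb(1)[OF sub0] rl by simp
    qed (use m rl fc in auto)
    moreover have "eqmod V W0 (f (y \<otimes>\<^bsub>H\<^esub> u')) (l y (f u'))"
      by (rule cocycle_l_kernel(1)[OF f S fW c(2)]) (use uK in \<open>auto simp: K_def\<close>)
    ultimately have "eqmod V W0 (f (u \<otimes>\<^bsub>H\<^esub> x') \<oplus>\<^bsub>V\<^esub> f (y \<otimes>\<^bsub>H\<^esub> u')) (r (f u) y' \<oplus>\<^bsub>V\<^esub> l y (f u'))"
      by (rule V.eqmod_add[OF sub0]) (use m rl fc in auto)
    then have "eqmod V W0 (f ((u \<otimes>\<^bsub>H\<^esub> x') \<oplus>\<^bsub>H\<^esub> (y \<otimes>\<^bsub>H\<^esub> u'))) (r (f u) y' \<oplus>\<^bsub>V\<^esub> l y (f u'))"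
      by (rule V.eqmod_trans[OF sub0 cocycleD(2)[OF f m]]) (simp_all add: m rl fc)
    moreover have "r (f u) y' \<oplus>\<^bsub>V\<^esub> l y (f u') \<in> W"
      by (intro V.subspaceD(4)[OF submod_subspace[OF S'(1)]] submodD[OF S'(1)] fW uc c)
    ultimately show "eqmod (SDU W) (W0 \<times> {\<zero>\<^bsub>H\<^esub>}) (\<phi> (z \<otimes>\<^bsub>R\<^esub> z')) (\<phi> z \<otimes>\<^bsub>SDU W\<^esub> \<phi> z')"
      unfolding z using c uc m fW H.mult_closed
      by (simp add: \<phi>_def R_def em u_def[symmetric] u'_def[symmetric] uu)
  next
    fix k z assume k: "k \<in> carrier F" and zR: "z \<in> carrier R"
    obtain x y where z: "z = (x, y)" by (cases z)
    define u where "u = x \<ominus>\<^bsub>H\<^esub> y"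
    have c: "x \<in> carrier H" "y \<in> carrier H" and uK: "u \<in> K" using zR Rc unfolding z u_def by auto
    have "(k \<odot>\<^bsub>H\<^esub> x) \<ominus>\<^bsub>H\<^esub> (k \<odot>\<^bsub>H\<^esub> y) = k \<odot>\<^bsub>H\<^esub> u"
      using k c by (simp add: u_def H.M.minus_eq H.smult_r_distr H.smult_r_minus)
    then show "eqmod (SDU W) (W0 \<times> {\<zero>\<^bsub>H\<^esub>}) (\<phi> (k \<odot>\<^bsub>R\<^esub> z)) (k \<odot>\<^bsub>SDU W\<^esub> \<phi> z)"
      unfolding z using c k Kc[OF uK] cocycleD(3)[OF f k Kc[OF uK]] fW V.subspaceD(5)[OF submod_subspace[OF S'(1)]]
      by (simp add: \<phi>_def R_def em u_def[symmetric])
  qed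
  show ?thesis
    unfolding central_def
  proof (rule inq_transfer[OF Rl SDU_leibniz[OF S'(1)] RK(1) SDU_ideal[OF S'(1,2,3)] hom _ _ RK(2)])
    have z: "\<zero>\<^bsub>H\<^esub> \<ominus>\<^bsub>H\<^esub> \<zero>\<^bsub>H\<^esub> = \<zero>\<^bsub>H\<^esub>" by (simp add: H.minus_eq_zero_iff)
    show "\<phi> z \<in> W0 \<times> {\<zero>\<^bsub>H\<^esub>}" if "z \<in> {(x, y) \<in> carrier R. x \<in> {\<zero>\<^bsub>H\<^esub>} \<and> y \<in> {\<zero>\<^bsub>H\<^esub>}}" for z
      using that cocycle_zero_mem[OF S'(2) f] by (auto simp: \<phi>_def z)
    show "\<exists>z\<in>carrier R. eqmod (SDU W) (W0 \<times> {\<zero>\<^bsub>H\<^esub>}) y (\<phi> z)" if y: "y \<in> carrier (SDU W)" for y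
    proof -
      obtain w h where wh: "y = (w, h)" "w \<in> W" "h \<in> carrier H" using y by auto
      obtain k where k: "k \<in> K" "eqmod V W0 w (f k)" using onto[OF wh(2)] by (auto simp: K_def)
      have "(k \<oplus>\<^bsub>H\<^esub> h) \<ominus>\<^bsub>H\<^esub> h = k" using Kc[OF k(1)] wh(3) by algebra
      then have "(k \<oplus>\<^bsub>H\<^esub> h, h) \<in> carrier R" "\<phi> (k \<oplus>\<^bsub>H\<^esub> h, h) = (f k, h)"
        using Kc[OF k(1)] wh(3) k(1) by (auto simp: R_def eqmod_def \<phi>_def)
      moreover have "eqmod (SDU W) (W0 \<times> {\<zero>\<^bsub>H\<^esub>}) (w, h) (f k, h)"
        using em wh k fW Kc by blast
      ultimately show ?thesis using wh(1) by metis
    qed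
  qed
qed

lemma simple_cocycle_inner:
  assumes f: "cocycle W0 f" and S: "simple_over W W0" and fW: "\<And>x. x \<in> carrier H \<Longrightarrow> f x \<in> W"
    and ncen: "\<not> central W W0"
  shows "\<exists>v\<in>W. \<forall>x\<in>carrier H. eqmod V W0 (f x) (r v x)"
proof -
  note S' = simple_overD[OF S]
  note sub0 = submod_subspace[OF S'(2)]
  note c = submod_carrier[OF S'(1)]
  define K where "K = annihilator W W0"
  have K: "alg_ideal F H K" unfolding K_def by (rule annihilator_ideal[OF S'(1,2)])
  have Kc: "\<And>k. k \<in> K \<Longrightarrow> k \<in> carrier H" by (simp add: K_def annihilator_def)
  note fc = cocycleD(1)[OF f]
  \<comment> \<open>The image of the annihilator under f. It is a submodule, since f is a bimodule
    map there; being all of W would make W/W0 central, so it is W0 and f vanishes on K.\<close>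
  define T where "T = {t \<in> W. \<exists>k\<in>K. eqmod V W0 t (f k)}"
  have sT: "subspace F T V"
  proof (rule V.subspaceI)
    show "T \<subseteq> carrier V" using c by (auto simp: T_def)
    have "eqmod V W0 \<zero>\<^bsub>V\<^esub> (f \<zero>\<^bsub>H\<^esub>)"
      using cocycle_zero_mem[OF S'(2) f] V.eqmod_zero[OF sub0] V.eqmod_sym[OF sub0] fc by simp
    then show "\<zero>\<^bsub>V\<^esub> \<in> T"
      using H.subspaceD(2)[OF H.ideal_subspace[OF K]] V.subspaceD(2)[OF submod_subspace[OF S'(1)]]
      by (auto simp: T_def)
  next
    fix t t' assume "t \<in> T" "t' \<in> T"
    then obtain k k' where k: "k \<in> K" "k' \<in> K" "eqmod V W0 t (f k)" "eqmod V W0 t' (f k')" "t \<in> W" "t' \<in> W"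
      by (auto simp: T_def)
    note kc = Kc[OF k(1)] Kc[OF k(2)]
    have "eqmod V W0 (t \<oplus>\<^bsub>V\<^esub> t') (f k \<oplus>\<^bsub>V\<^esub> f k')"
      by (rule V.eqmod_add[OF sub0 k(3,4)]) (use k c kc fc in auto)
    moreover have "eqmod V W0 (f k \<oplus>\<^bsub>V\<^esub> f k') (f (k \<oplus>\<^bsub>H\<^esub> k'))"
      using V.eqmod_sym[OF sub0 cocycleD(2)[OF f kc]] fc kc by simp
    ultimately have "eqmod V W0 (t \<oplus>\<^bsub>V\<^esub> t') (f (k \<oplus>\<^bsub>H\<^esub> k'))"
      by (rule V.eqmod_trans[OF sub0]) (use k c kc fc in auto)
    then show "t \<oplus>\<^bsub>V\<^esub> t' \<in> T"
      using k V.subspaceD(4)[OF submod_subspace[OF S'(1)]] H.subspaceD(4)[OF H.ideal_subspace[OF K] k(1,2)]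
      by (auto simp: T_def)
  next
    fix a t assume a: "a \<in> carrier F" and "t \<in> T"
    then obtain k where k: "k \<in> K" "eqmod V W0 t (f k)" "t \<in> W" by (auto simp: T_def)
    note kc = Kc[OF k(1)]
    have "eqmod V W0 (a \<odot>\<^bsub>V\<^esub> t) (a \<odot>\<^bsub>V\<^esub> f k)"
      by (rule V.eqmod_smult[OF sub0 k(2) a]) (use k c kc fc in auto)
    moreover have "eqmod V W0 (a \<odot>\<^bsub>V\<^esub> f k) (f (a \<odot>\<^bsub>H\<^esub> k))"
      using V.eqmod_sym[OF sub0 cocycleD(3)[OF f a kc]] fc kc a by simp
    ultimately have "eqmod V W0 (a \<odot>\<^bsub>V\<^esub> t) (f (a \<odot>\<^bsub>H\<^esub> k))"
      by (rule V.eqmod_trans[OF sub0]) (use k c kc fc a in auto)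
    then show "a \<odot>\<^bsub>V\<^esub> t \<in> T"
      using k a V.subspaceD(5)[OF submod_subspace[OF S'(1)]] H.subspaceD(5)[OF H.ideal_subspace[OF K] a k(1)]
      by (auto simp: T_def)
  qed
  have "l x t \<in> T \<and> r t x \<in> T" if x: "x \<in> carrier H" and t: "t \<in> T" for x t
  proof -
    obtain k where k: "k \<in> K" "eqmod V W0 t (f k)" "t \<in> W" using t by (auto simp: T_def)
    note kc = Kc[OF k(1)]
    note kk = cocycle_l_kernel[OF f S fW x k(1)[unfolded K_def]]
    have m: "x \<otimes>\<^bsub>H\<^esub> k \<in> carrier H" "k \<otimes>\<^bsub>H\<^esub> x \<in> carrier H" using x kc H.mult_closed by auto
    have "eqmod V W0 (l x t) (f (x \<otimes>\<^bsub>H\<^esub> k))"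
      by (rule V.eqmod_trans[OF sub0 l_eqmod[OF S'(2) k(2) x] V.eqmod_sym[OF sub0 kk(1)]])
        (use x kc fc m k c l_closed in auto)
    moreover have "eqmod V W0 (r t x) (f (k \<otimes>\<^bsub>H\<^esub> x))"
      by (rule V.eqmod_trans[OF sub0 r_eqmod[OF S'(2) k(2) x] V.eqmod_sym[OF sub0 kk(2)]])
        (use x kc fc m k c r_closed in auto)
    ultimately show ?thesis
      using submodD[OF S'(1) x k(3)] H.ideal_mult[OF K x k(1)] unfolding T_def by blast
  qed
  then have "submod T" using sT by (simp add: submod_def)
  moreover have "W0 \<subseteq> T"
  proof
    fix w assume w: "w \<in> W0"
    have "\<zero>\<^bsub>V\<^esub> \<in> T" by (rule V.subspaceD(2)[OF sT])
    then obtain k where k: "k \<in> K" "eqmod V W0 \<zero>\<^bsub>V\<^esub> (f k)" by (auto simp: T_def)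
    have "eqmod V W0 w (f k)"
      by (rule V.eqmod_trans[OF sub0 _ k(2)])
        (use w V.subspaceD(3)[OF sub0] V.eqmod_zero[OF sub0] fc Kc k in auto)
    then show "w \<in> T" using w k S'(3) by (auto simp: T_def)
  qed
  moreover have "T \<subseteq> W" by (auto simp: T_def)
  ultimately have "T = W0 \<or> T = W" using S'(5) by blast
  moreover have "T \<noteq> W"
  proof
    assume "T = W"
    then have "\<exists>k\<in>annihilator W W0. eqmod V W0 w (f k)" if "w \<in> W" for w
      using that by (auto simp: T_def K_def)
    then show False using central_of_cocycle[OF f S fW] ncen by blast
  qed
  ultimately have "T = W0" by blast
  then have fK: "f k \<in> W0" if "k \<in> K" for k
    using that fW[OF Kc[OF that]] V.eqmod_refl[OF sub0 fc[OF Kc[OF that]]] unfolding T_def by blast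
  show ?thesis
  proof (cases "K = carrier H")
    case True
    have "\<zero>\<^bsub>V\<^esub> \<in> W" by (rule V.subspaceD(2)[OF submod_subspace[OF S'(1)]])
    moreover have "eqmod V W0 (f x) (r \<zero>\<^bsub>V\<^esub> x)" if "x \<in> carrier H" for x
      using fK True that V.eqmod_zero[OF sub0] fc by (simp add: r_zero)
    ultimately show ?thesis by blast
  next
    case False
    then have nK: "\<not> H.D 0 \<subseteq> K" using Kc by auto
    obtain n0 where "H.D n0 = {\<zero>\<^bsub>H\<^esub>}" using solubleD(3)[OF solH] by blast
    then have "H.D n0 \<subseteq> K" using H.subspaceD(2)[OF H.ideal_subspace[OF K]] by simp
    \<comment> \<open>The last term of the derived series that acts non-trivially. The product of
      any two of its elements annihilates, so it acts commutatively.\<close>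
    then obtain i where i: "\<not> H.D i \<subseteq> K" "H.D (Suc i) \<subseteq> K"
      using nK by (induction n0) blast+
    define A where "A = H.D i"
    have A: "alg_ideal F H A" unfolding A_def by (rule H.derived_ideal)
    have AA: "b \<otimes>\<^bsub>H\<^esub> b' \<in> annihilator W W0" if "b \<in> A" "b' \<in> A" for b b'
      using H.derived_mult that i(2) unfolding A_def K_def by blast
    obtain a where a: "a \<in> A" and inj: "\<And>w. w \<in> W \<Longrightarrow> l a w \<in> W0 \<Longrightarrow> w \<in> W0"
      using simple_injective_exists[OF fd S A AA] i(1) unfolding A_def K_def by blast
    have ac: "a \<in> carrier H" using a H.ideal_carrier[OF A] by blast
    have "\<exists>v\<in>W. eqmod V W0 (f a) (r v a)"
      using simple_sym_or_antisym[OF S]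
    proof
      assume anti: "\<forall>x\<in>carrier H. \<forall>w\<in>W. r w x \<in> W0"
      \<comment> \<open>With zero right action inner cocycles vanish, so f a itself has to lie in
        W0. The identity at the pair a, a gives a(f a) congruent to f(aa), and aa
        annihilates.\<close>
      have "l a (f a) \<in> W0"
      proof (rule V.eqmod_sum_mem[OF sub0 cocycleD(4)[OF f ac ac]])
        show "f (a \<otimes>\<^bsub>H\<^esub> a) \<in> W0" using fK AA[OF a a] by (simp add: K_def)
      qed (use anti fW[OF ac] ac l_closed fc in auto)
      then have "f a \<in> W0" using inj fW[OF ac] by blast
      then have "eqmod V W0 (f a) (r \<zero>\<^bsub>V\<^esub> a)" using V.eqmod_zero[OF sub0] fc ac by (simp add: r_zero)
      then show ?thesis using V.subspaceD(2)[OF submod_subspace[OF S'(1)]] by blast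
    next
      assume sym: "\<forall>x\<in>carrier H. \<forall>w\<in>W. eqmod V W0 (r w x) (\<ominus>\<^bsub>V\<^esub> l x w)"
      have "\<ominus>\<^bsub>V\<^esub> f a \<in> W" using V.subspaceD(6)[OF submod_subspace[OF S'(1)]] fW[OF ac] by blast
      then obtain v where v: "v \<in> W" "eqmod V W0 (\<ominus>\<^bsub>V\<^esub> f a) (l a v)"
        using injective_imp_surjective[OF fd S'(1,2,3) ac inj] by blast
      have cc: "f a \<in> carrier V" "l a v \<in> carrier V" "r v a \<in> carrier V" using fc ac c v l_closed r_closed by auto
      have "eqmod V W0 (\<ominus>\<^bsub>V\<^esub> (\<ominus>\<^bsub>V\<^esub> f a)) (\<ominus>\<^bsub>V\<^esub> l a v)"
        by (rule V.eqmod_uminus[OF sub0 v(2)]) (use cc in auto)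
      then have "eqmod V W0 (f a) (\<ominus>\<^bsub>V\<^esub> l a v)" using cc by simp
      moreover have "eqmod V W0 (r v a) (\<ominus>\<^bsub>V\<^esub> l a v)" using sym ac v by blast
      then have "eqmod V W0 (\<ominus>\<^bsub>V\<^esub> l a v) (r v a)" using V.eqmod_sym[OF sub0] cc by simp
      ultimately have "eqmod V W0 (f a) (r v a)" by (rule V.eqmod_trans[OF sub0]) (use cc in auto)
      then show ?thesis using v(1) by blast
    qed
    then obtain v where v: "v \<in> W" "eqmod V W0 (f a) (r v a)" by blast
    define g where "g x = f x \<ominus>\<^bsub>V\<^esub> r v x" for x
    have g: "cocycle W0 g" unfolding g_def by (rule cocycle_minus_inner[OF S'(2) f c[OF v(1)]])
    have gW: "g x \<in> W" if "x \<in> carrier H" for x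
      unfolding g_def using that V.subspaceD(7)[OF submod_subspace[OF S'(1)]] fW submodD(2)[OF S'(1) that v(1)] by blast
    have ga: "g a \<in> W0" using v(2) by (simp add: g_def eqmod_def)
    have gK: "g k \<in> W0" if "k \<in> K" for k
      unfolding g_def using that fK v(1) V.subspaceD(7)[OF sub0] by (auto simp: K_def annihilator_def)
    \<comment> \<open>In g(ax) = g(a)x + a g(x) the term with g(a) vanishes, and a is injective.
      This is used first for x in A, where ax annihilates, and then for arbitrary x, where ax lies
      in A.\<close>
    have key: "g x \<in> W0" if x: "x \<in> carrier H" and gx: "g (a \<otimes>\<^bsub>H\<^esub> x) \<in> W0" for x
    proof -
      have "l a (g x) \<in> W0"
        by (rule V.eqmod_sum_mem[OF sub0 cocycleD(4)[OF g ac x] gx submodD(2)[OF S'(2) x ga]])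
          (use ac x cocycleD(1)[OF g] l_closed in auto)
      then show ?thesis using inj gW[OF x] by blast
    qed
    have gA: "g b \<in> W0" if "b \<in> A" for b
      using key[of b] gK AA[OF a that] that H.ideal_carrier[OF A] by (auto simp: K_def)
    have "g x \<in> W0" if "x \<in> carrier H" for x
      using key[OF that] gA H.ideal_mult(2)[OF A that a] by blast
    then show ?thesis using v(1) by (auto simp: g_def eqmod_def)
  qed
qed

text \<open>Take W0 maximal among the central-free submodules with a non-inner cocycle, and W
  minimal above it. Since \<open>central_free_quotient\<close> keeps W central-free, the obstruction
  is pushed into the simple layer W/W0, where \<open>simple_cocycle_inner\<close> removes
  it.\<close>

lemma cocycle_inner:
  assumes free: "central_free W" and f: "cocycle W f"
  shows "\<exists>v\<in>carrier V. \<forall>x\<in>carrier H. eqmod V W (f x) (r v x)"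
proof (rule ccontr)
  assume neg: "\<not> ?thesis"
  define P where "P W \<longleftrightarrow> central_free W \<and> (\<exists>f. cocycle W f \<and>
    \<not> (\<exists>v\<in>carrier V. \<forall>x\<in>carrier H. eqmod V W (f x) (r v x)))" for W
  have "P W" using free f neg by (auto simp: P_def)
  moreover have "\<And>T. P T \<Longrightarrow> subspace F T V" by (simp add: P_def central_free_def submod_subspace)
  ultimately obtain W0 where W0: "P W0" and max: "\<And>T. P T \<Longrightarrow> W0 \<subseteq> T \<Longrightarrow> T = W0"
    using V.maximal_subspace_exists[OF fd, of P] by metis
  obtain f where free0: "central_free W0" and f: "cocycle W0 f"
    and neg: "\<not> (\<exists>v\<in>carrier V. \<forall>x\<in>carrier H. eqmod V W0 (f x) (r v x))"
    using W0 by (auto simp: P_def)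
  have sm0: "submod W0" using free0 by (simp add: central_free_def)
  note sub0 = submod_subspace[OF sm0]
  have "W0 \<noteq> carrier V"
  proof
    assume "W0 = carrier V"
    then have "eqmod V W0 (f x) (r \<zero>\<^bsub>V\<^esub> x)" if "x \<in> carrier H" for x
      using cocycleD(1)[OF f that] that V.eqmod_zero[OF sub0] by (simp add: r_zero)
    then show False using neg by blast
  qed
  then have "submod (carrier V) \<and> W0 \<subset> carrier V" using carrier_submod V.subspaceD(1)[OF sub0] by blast
  then obtain W where W: "submod W \<and> W0 \<subset> W" and min: "\<And>T. submod T \<and> W0 \<subset> T \<Longrightarrow> T \<subseteq> W \<Longrightarrow> T = W"
    using V.minimal_subspace_exists[OF fd, of "\<lambda>T. submod T \<and> W0 \<subset> T"] submod_subspace by metis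
  have S: "simple_over W W0" unfolding simple_over_def using W min sm0 by blast
  have "central_free W" by (rule central_free_quotient[OF free0 S])
  \<comment> \<open>W lies properly above the maximal counterexample, so f is inner modulo W; after
    subtraction of that inner cocycle the values of f lie in W.\<close>
  moreover have "\<not> P W" using max W by blast
  moreover have "cocycle W f" using f W V.eqmod_mono unfolding cocycle_def by blast
  ultimately obtain v1 where v1: "v1 \<in> carrier V" "\<And>x. x \<in> carrier H \<Longrightarrow> eqmod V W (f x) (r v1 x)"
    unfolding P_def by blast
  define g where "g x = f x \<ominus>\<^bsub>V\<^esub> r v1 x" for x
  have g: "cocycle W0 g" unfolding g_def by (rule cocycle_minus_inner[OF sm0 f v1(1)])
  have gW: "g x \<in> W" if "x \<in> carrier H" for x using v1(2)[OF that] by (simp add: g_def eqmod_def)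
  have "\<not> central W W0" using free0 W by (simp add: central_free_def)
  then obtain v2 where v2: "v2 \<in> W" "\<And>x. x \<in> carrier H \<Longrightarrow> eqmod V W0 (g x) (r v2 x)"
    using simple_cocycle_inner[OF g S gW] by blast
  have v2c: "v2 \<in> carrier V" using v2(1) submod_carrier W by blast
  have "eqmod V W0 (f x) (r (v1 \<oplus>\<^bsub>V\<^esub> v2) x)" if x: "x \<in> carrier H" for x
  proof -
    have c: "f x \<in> carrier V" "r v1 x \<in> carrier V" "r v2 x \<in> carrier V"
      using x v1(1) v2c cocycleD(1)[OF f] r_closed by auto
    have "f x \<ominus>\<^bsub>V\<^esub> (r v1 x \<oplus>\<^bsub>V\<^esub> r v2 x) = (f x \<ominus>\<^bsub>V\<^esub> r v1 x) \<ominus>\<^bsub>V\<^esub> r v2 x" using c by algebra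
    then show ?thesis using v2(2)[OF x] r_add1[OF x v1(1) v2c] by (simp add: eqmod_def g_def)
  qed
  then show False using neg v1(1) v2c by blast
qed

end

subsection \<open>Symmetric and antisymmetric modules\<close>

lemma (in abelian_group) minus_zero_right [simp]: "x \<in> carrier G \<Longrightarrow> x \<ominus> \<zero> = x"
  by (simp add: minus_eq add.inv_one)

lemma (in abelian_group) minus_add_cancel_right:
  "\<lbrakk>a \<in> carrier G; b \<in> carrier G; c \<in> carrier G\<rbrakk> \<Longrightarrow> (a \<oplus> c) \<ominus> (b \<oplus> c) = a \<ominus> b"
  by algebra

text \<open>Provides a non-zero functional on H that kills products, as needed for the twisted
  product in \<open>central_antisym_of_sym\<close>. For M maximal among the proper subspaces above S
  and t outside M, each x is congruent modulo M to exactly one multiple c t, and c is the value at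
  x.\<close>

lemma (in vectorspace) functional_exists:
  assumes fd: fin_dim and S: "subspace K S V" and SV: "S \<noteq> carrier V"
  shows "\<exists>\<omega>. (\<forall>x\<in>carrier V. \<omega> x \<in> carrier K) \<and>
    (\<forall>x\<in>carrier V. \<forall>y\<in>carrier V. \<omega> (x \<oplus>\<^bsub>V\<^esub> y) = \<omega> x \<oplus>\<^bsub>K\<^esub> \<omega> y) \<and>
    (\<forall>c\<in>carrier K. \<forall>x\<in>carrier V. \<omega> (c \<odot>\<^bsub>V\<^esub> x) = c \<otimes>\<^bsub>K\<^esub> \<omega> x) \<and>
    (\<forall>x\<in>S. \<omega> x = \<zero>\<^bsub>K\<^esub>) \<and> (\<exists>x\<in>carrier V. \<omega> x = \<one>\<^bsub>K\<^esub>)"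
proof -
  define P where "P M \<longleftrightarrow> subspace K M V \<and> S \<subseteq> M \<and> M \<noteq> carrier V" for M
  have "P S" using S SV by (simp add: P_def)
  moreover have "\<And>M. P M \<Longrightarrow> subspace K M V" by (simp add: P_def)
  ultimately obtain M where PM: "P M" and max: "\<And>N. P N \<Longrightarrow> M \<subseteq> N \<Longrightarrow> N = M"
    using maximal_subspace_exists[OF fd, of P] by metis
  then have M: "subspace K M V" and SM: "S \<subseteq> M" and MV: "M \<noteq> carrier V" by (auto simp: P_def)
  note m = subspaceD[OF M]
  obtain t where t: "t \<in> carrier V" "t \<notin> M" using MV m(1) by blast
  define rel where "rel x c \<longleftrightarrow> c \<in> carrier K \<and> x \<ominus>\<^bsub>V\<^esub> c \<odot>\<^bsub>V\<^esub> t \<in> M" for x c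
  have rel_add: "rel (x \<oplus>\<^bsub>V\<^esub> y) (c \<oplus>\<^bsub>K\<^esub> d)" if "rel x c" "rel y d" "x \<in> carrier V" "y \<in> carrier V" for x y c d
  proof -
    have cd: "c \<in> carrier K" "d \<in> carrier K" using that by (auto simp: rel_def)
    have p: "c \<odot>\<^bsub>V\<^esub> t \<in> carrier V" "d \<odot>\<^bsub>V\<^esub> t \<in> carrier V" using cd t by auto
    have "(x \<oplus>\<^bsub>V\<^esub> y) \<ominus>\<^bsub>V\<^esub> (c \<odot>\<^bsub>V\<^esub> t \<oplus>\<^bsub>V\<^esub> d \<odot>\<^bsub>V\<^esub> t) = (x \<ominus>\<^bsub>V\<^esub> c \<odot>\<^bsub>V\<^esub> t) \<oplus>\<^bsub>V\<^esub> (y \<ominus>\<^bsub>V\<^esub> d \<odot>\<^bsub>V\<^esub> t)"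
      using p that(3,4) by algebra
    then show ?thesis using that m(4) cd t by (simp add: rel_def smult_l_distr)
  qed
  have rel_smult: "rel (k \<odot>\<^bsub>V\<^esub> x) (k \<otimes>\<^bsub>K\<^esub> c)" if "rel x c" "k \<in> carrier K" "x \<in> carrier V" for x k c
  proof -
    have c: "c \<in> carrier K" using that by (auto simp: rel_def)
    have "k \<odot>\<^bsub>V\<^esub> (x \<ominus>\<^bsub>V\<^esub> c \<odot>\<^bsub>V\<^esub> t) = k \<odot>\<^bsub>V\<^esub> x \<ominus>\<^bsub>V\<^esub> (k \<otimes>\<^bsub>K\<^esub> c) \<odot>\<^bsub>V\<^esub> t"
      using c that t by (simp add: M.minus_eq smult_r_distr smult_r_minus smult_assoc1)
    then show ?thesis using that m(5) c by (simp add: rel_def) metis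
  qed
  have rel_M: "rel x \<zero>\<^bsub>K\<^esub>" if "x \<in> M" for x
    using that m(3)[OF that] t by (simp add: rel_def)
  have rel_t: "rel t \<one>\<^bsub>K\<^esub>"
  proof -
    have "t \<ominus>\<^bsub>V\<^esub> t = \<zero>\<^bsub>V\<^esub>" using t by (simp add: minus_eq_zero_iff)
    then have "t \<ominus>\<^bsub>V\<^esub> \<one>\<^bsub>K\<^esub> \<odot>\<^bsub>V\<^esub> t \<in> M" using t(1) m(2) by (metis smult_one)
    then show ?thesis unfolding rel_def by simp
  qed
  have uniq: "c = d" if "rel x c" "rel x d" "x \<in> carrier V" for x c d
  proof (rule ccontr)
    assume "c \<noteq> d"
    have cd: "c \<in> carrier K" "d \<in> carrier K" using that by (auto simp: rel_def)
    define e where "e = c \<ominus>\<^bsub>K\<^esub> d"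
    have e: "e \<in> carrier K" "e \<noteq> \<zero>\<^bsub>K\<^esub>"
      using \<open>c \<noteq> d\<close> cd R.minus_eq_zero_iff by (auto simp: e_def)
    have p: "c \<odot>\<^bsub>V\<^esub> t \<in> carrier V" "d \<odot>\<^bsub>V\<^esub> t \<in> carrier V" using cd t by auto
    have "(x \<ominus>\<^bsub>V\<^esub> d \<odot>\<^bsub>V\<^esub> t) \<ominus>\<^bsub>V\<^esub> (x \<ominus>\<^bsub>V\<^esub> c \<odot>\<^bsub>V\<^esub> t) = c \<odot>\<^bsub>V\<^esub> t \<ominus>\<^bsub>V\<^esub> d \<odot>\<^bsub>V\<^esub> t"
      using p that(3) by algebra
    also have "\<dots> = e \<odot>\<^bsub>V\<^esub> t" using cd t by (simp add: e_def M.minus_eq R.minus_eq smult_l_distr smult_l_minus)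
    finally have "e \<odot>\<^bsub>V\<^esub> t \<in> M" using that m(7) by (metis rel_def)
    then have "inv\<^bsub>K\<^esub> e \<odot>\<^bsub>V\<^esub> (e \<odot>\<^bsub>V\<^esub> t) \<in> M" using m(5) e by simp
    moreover have "inv\<^bsub>K\<^esub> e \<odot>\<^bsub>V\<^esub> (e \<odot>\<^bsub>V\<^esub> t) = t"
      using e t by (simp add: smult_assoc1[symmetric] field_Units)
    ultimately show False using t(2) by simp
  qed
  have ex: "\<exists>c. rel x c" if x: "x \<in> carrier V" for x
  proof -
    define N where "N = {x \<in> carrier V. \<exists>c. rel x c}"
    have "subspace K N V"
    proof (rule subspaceI)
      show "\<zero>\<^bsub>V\<^esub> \<in> N" using rel_M[OF m(2)] by (auto simp: N_def)
    qed (auto simp: N_def intro: rel_add rel_smult)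
    moreover have "M \<subseteq> N" using rel_M m(3) by (auto simp: N_def)
    moreover have "t \<in> N" using rel_t t by (auto simp: N_def)
    ultimately have "N = carrier V" using max[of N] SM t(2) by (auto simp: P_def)
    then show ?thesis using x by (auto simp: N_def)
  qed
  define \<omega>' where "\<omega>' x = (SOME c. rel x c)" for x
  have l: "rel x (\<omega>' x)" if "x \<in> carrier V" for x
    unfolding \<omega>'_def using ex[OF that] by (rule someI_ex)
  show ?thesis
  proof (intro exI[of _ \<omega>'] conjI ballI)
    show "\<omega>' x \<in> carrier K" if "x \<in> carrier V" for x using l[OF that] by (simp add: rel_def)
    show "\<omega>' (x \<oplus>\<^bsub>V\<^esub> y) = \<omega>' x \<oplus>\<^bsub>K\<^esub> \<omega>' y" if "x \<in> carrier V" "y \<in> carrier V" for x y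
      using uniq[OF l rel_add[OF l l]] that by simp
    show "\<omega>' (c \<odot>\<^bsub>V\<^esub> x) = c \<otimes>\<^bsub>K\<^esub> \<omega>' x" if "c \<in> carrier K" "x \<in> carrier V" for c x
      using uniq[OF l rel_smult[OF l]] that by simp
    show "\<omega>' x = \<zero>\<^bsub>K\<^esub>" if "x \<in> S" for x
      using uniq[OF l rel_M] that SM m(3) by blast
    have "\<omega>' t = \<one>\<^bsub>K\<^esub>" using uniq[OF l rel_t] t by blast
    then show "\<exists>x\<in>carrier V. \<omega>' x = \<one>\<^bsub>K\<^esub>" using t by blast
  qed
qed

context class_bimod
begin

text \<open>In the extension \<open>Z\<close> below, \<open>C = V \<times> 0\<close> has zero right action, and
  \<open>(0, ((c, 0), 0)) (0, ((0, 0), k)) = (\<omega> k c, 0)\<close>. If \<open>C\<close> survived in a primitive quotient of \<open>Z\<close>, its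
  image and the image of the larger ideal \<open>I\<close>, both with zero multiplication, would be the socle and
  so coincide, which this product forbids. Hence \<open>Z\<close> lies in the class, and a fibre product over \<open>Z/C\<close>
  has the split extension by \<open>C\<close> as a quotient. The converse fails: the algebras \<open>L\<close> with
  \<open>L/Leib(L)\<close> nilpotent form a Schunck formation in which antisymmetric modules are always central.\<close>

lemma central_antisym_of_sym:
  assumes bs: "bimod F H V l s" and sym: "\<And>x v. x \<in> carrier H \<Longrightarrow> v \<in> carrier V \<Longrightarrow> s v x = \<ominus>\<^bsub>V\<^esub> l x v"
    and W: "submod W" and anti: "\<And>x v. x \<in> carrier H \<Longrightarrow> v \<in> carrier V \<Longrightarrow> r v x \<in> W"
    and inq: "inq (semidirect H V l s) (W \<times> {\<zero>\<^bsub>H\<^esub>})"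
  shows "inq SD (W \<times> {\<zero>\<^bsub>H\<^esub>})"
proof -
  interpret S: bimod F H V l s by (rule bs)
  note subW = submod_subspace[OF W]
  note w = V.subspaceD[OF subW]
  have Hl: "leibniz_algebra F H" by (rule H.leibniz_algebra_axioms)
  have Sl: "leibniz_algebra F S.SD" by (rule S.semidirect_leibniz)
  have SDl: "leibniz_algebra F SD" by (rule semidirect_leibniz)
  interpret SD: leibniz_algebra F SD by (rule SDl)
  interpret SS: leibniz_algebra F S.SD by (rule Sl)
  have sW: "S.submod W"
    using W w(6) by (auto simp: S.submod_def submod_def sym w(3))
  have iSW: "alg_ideal F S.SD (W \<times> {\<zero>\<^bsub>H\<^esub>})" by (rule S.semidirect_ideal[OF sW])
  have iW: "alg_ideal F SD (W \<times> {\<zero>\<^bsub>H\<^esub>})" by (rule semidirect_ideal[OF W])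
  have em: "eqmod SD (W \<times> {\<zero>\<^bsub>H\<^esub>}) (u, x) (v, y) \<longleftrightarrow> eqmod V W u v \<and> x = y"
    if "u \<in> carrier V" "v \<in> carrier V" "x \<in> carrier H" "y \<in> carrier H" for u v x y
    using SDU_eqmod[OF carrier_submod that] by simp
  show ?thesis
  proof (cases "H.D 1 = carrier H")
    \<comment> \<open>A functional that is non-zero but kills products needs a derived algebra
      smaller than H. If the two agree, solubility gives H = 0, and both split extensions are V
      alone.\<close>
    case True
    have "H.D n = carrier H" for n
    proof (induction n)
      case (Suc n)
      then show ?case using True by simp
    qed simp
    then have H0: "carrier H = {\<zero>\<^bsub>H\<^esub>}" using solubleD(3)[OF solH] by metis
    show ?thesis
    proof (rule inq_transfer[OF Sl SDl iSW iW _ _ _ inq])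
      show "hom_mod F S.SD SD (W \<times> {\<zero>\<^bsub>H\<^esub>}) (\<lambda>x. x)"
        unfolding hom_mod_def using H0
        by (auto simp: em r_zero l_zero S.r_zero V.eqmod_refl[OF subW])
    qed (use SD.eqmod_refl[OF SD.ideal_subspace[OF iW]] in auto)
  next
    case False
    obtain \<omega> where lc: "\<And>x. x \<in> carrier H \<Longrightarrow> \<omega> x \<in> carrier F"
      and la: "\<And>x y. x \<in> carrier H \<Longrightarrow> y \<in> carrier H \<Longrightarrow> \<omega> (x \<oplus>\<^bsub>H\<^esub> y) = \<omega> x \<oplus>\<^bsub>F\<^esub> \<omega> y"
      and ls: "\<And>c x. c \<in> carrier F \<Longrightarrow> x \<in> carrier H \<Longrightarrow> \<omega> (c \<odot>\<^bsub>H\<^esub> x) = c \<otimes>\<^bsub>F\<^esub> \<omega> x"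
      and lD: "\<And>x. x \<in> H.D 1 \<Longrightarrow> \<omega> x = \<zero>\<^bsub>F\<^esub>" and l1: "\<exists>x\<in>carrier H. \<omega> x = \<one>\<^bsub>F\<^esub>"
      using H.functional_exists[OF solubleD(2)[OF solH] H.ideal_subspace[OF H.derived_ideal] False]
      by blast
    have lm: "\<omega> (x \<otimes>\<^bsub>H\<^esub> y) = \<zero>\<^bsub>F\<^esub>" if "x \<in> carrier H" "y \<in> carrier H" for x y
      using lD H.derived_mult[of x 0 y] that by simp
    have l0: "\<omega> \<zero>\<^bsub>H\<^esub> = \<zero>\<^bsub>F\<^esub>"
      using lD H.subspaceD(2)[OF H.ideal_subspace[OF H.derived_ideal]] by blast
    \<comment> \<open>The symmetric split extension together with a second copy of H. The second
      copy acts on the new coordinate of Z only, as a scalar through \<omega>, independently of the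
      first copy, which acts through l.\<close>
    define Y where "Y = prod_alg S.SD H"
    have Ys: "soluble_leibniz F Y" unfolding Y_def by (rule prod_soluble[OF S.semidirect_soluble[OF solH fd] solH])
    have Yl: "leibniz_algebra F Y" by (rule solubleD[OF Ys])
    interpret Y: leibniz_algebra F Y by (rule Yl)
    have Yc: "carrier Y = (carrier V \<times> carrier H) \<times> carrier H" by (simp add: Y_def)
    define \<mu> where "\<mu> = (\<lambda>(u :: 'v, ((a, x), i)) (v, ((b, y), j)).
      (l x v \<oplus>\<^bsub>V\<^esub> \<omega> j \<odot>\<^bsub>V\<^esub> a, ((s a y \<oplus>\<^bsub>V\<^esub> l x b, x \<otimes>\<^bsub>H\<^esub> y), i \<otimes>\<^bsub>H\<^esub> j)))"
    define Z where "Z = pair_alg V Y \<mu>"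
    have vp: "vs_pair F V Y" by (simp add: vs_pairI V.vectorspace_axioms Y.vectorspace_axioms)
    interpret Z: vectorspace F Z unfolding Z_def by (rule vs_pair.pair_vectorspace[OF vp])
    have Zc: "carrier Z = carrier V \<times> ((carrier V \<times> carrier H) \<times> carrier H)" by (simp add: Z_def Yc)
    have Zadd: "(u, ((a, x), i)) \<oplus>\<^bsub>Z\<^esub> (v, ((b, y), j)) = (u \<oplus>\<^bsub>V\<^esub> v, ((a \<oplus>\<^bsub>V\<^esub> b, x \<oplus>\<^bsub>H\<^esub> y), i \<oplus>\<^bsub>H\<^esub> j))"
      for u a x i v b y j by (simp add: Z_def Y_def)
    have Zsmult: "c \<odot>\<^bsub>Z\<^esub> (u, ((a, x), i)) = (c \<odot>\<^bsub>V\<^esub> u, ((c \<odot>\<^bsub>V\<^esub> a, c \<odot>\<^bsub>H\<^esub> x), c \<odot>\<^bsub>H\<^esub> i))"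
      for c u a x i by (simp add: Z_def Y_def)
    have Zmult: "(u, ((a, x), i)) \<otimes>\<^bsub>Z\<^esub> (v, ((b, y), j)) =
        (l x v \<oplus>\<^bsub>V\<^esub> \<omega> j \<odot>\<^bsub>V\<^esub> a, ((s a y \<oplus>\<^bsub>V\<^esub> l x b, x \<otimes>\<^bsub>H\<^esub> y), i \<otimes>\<^bsub>H\<^esub> j))"
      for u a x i v b y j by (simp add: Z_def \<mu>_def)
    have Zzero: "\<zero>\<^bsub>Z\<^esub> = (\<zero>\<^bsub>V\<^esub>, ((\<zero>\<^bsub>V\<^esub>, \<zero>\<^bsub>H\<^esub>), \<zero>\<^bsub>H\<^esub>))" by (simp add: Z_def Y_def)
    have Zcases: "\<exists>u a x i. z = (u, ((a, x), i)) \<and> u \<in> carrier V \<and> a \<in> carrier V \<and> x \<in> carrier H \<and> i \<in> carrier H"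
      if "z \<in> carrier Z" for z using that by (auto simp: Zc)
    have "leibniz_algebra_axioms F Z"
    proof (rule leibniz_algebra_axioms.intro, goal_cases)
      case (1 p q)
      then show ?case
        by (auto simp: Zc Zmult l_closed S.r_closed lc H.mult_closed)
    next
      case (2 p q t)
      then show ?case
        by (auto simp: Zc Zmult Zadd l_closed S.r_closed lc l_add1 S.r_add1 H.mult_add_left V.smult_r_distr V.M.a_ac)
    next
      case (3 p q t)
      then show ?case
        by (auto simp: Zc Zmult Zadd l_closed S.r_closed lc la l_add2 S.r_add2 H.mult_add_right V.smult_l_distr V.M.a_ac)
    next
      case (4 c p q)
      then show ?case
        by (auto simp: Zc Zmult Zsmult l_closed S.r_closed lc l_smult1 S.r_smult1 H.mult_smult_left
            V.smult_r_distr V.smult_assoc1[symmetric] H.R.m_comm)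
    next
      case (5 c p q)
      then show ?case
        by (auto simp: Zc Zmult Zsmult l_closed S.r_closed lc ls l_smult2 S.r_smult2 H.mult_smult_right
            V.smult_r_distr V.smult_assoc1)
    next
      case (6 p q t)
      obtain u a x i where p: "p = (u, ((a, x), i))" "u \<in> carrier V" "a \<in> carrier V" "x \<in> carrier H" "i \<in> carrier H"
        using Zcases[OF 6(1)] by blast
      obtain v b y j where q: "q = (v, ((b, y), j))" "v \<in> carrier V" "b \<in> carrier V" "y \<in> carrier H" "j \<in> carrier H"
        using Zcases[OF 6(2)] by blast
      obtain w' c z k where t: "t = (w', ((c, z), k))" "w' \<in> carrier V" "c \<in> carrier V" "z \<in> carrier H" "k \<in> carrier H"
        using Zcases[OF 6(3)] by blast
      have "((a, x), i) \<otimes>\<^bsub>Y\<^esub> (((b, y), j) \<otimes>\<^bsub>Y\<^esub> ((c, z), k)) =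
        (((a, x), i) \<otimes>\<^bsub>Y\<^esub> ((b, y), j)) \<otimes>\<^bsub>Y\<^esub> ((c, z), k) \<oplus>\<^bsub>Y\<^esub> ((b, y), j) \<otimes>\<^bsub>Y\<^esub> (((a, x), i) \<otimes>\<^bsub>Y\<^esub> ((c, z), k))"
        by (rule Y.leibniz) (use p q t in \<open>auto simp: Yc\<close>)
      then have Yeq: "((s a (y \<otimes>\<^bsub>H\<^esub> z) \<oplus>\<^bsub>V\<^esub> l x (s b z \<oplus>\<^bsub>V\<^esub> l y c), x \<otimes>\<^bsub>H\<^esub> (y \<otimes>\<^bsub>H\<^esub> z)), i \<otimes>\<^bsub>H\<^esub> (j \<otimes>\<^bsub>H\<^esub> k)) =
        ((s (s a y \<oplus>\<^bsub>V\<^esub> l x b) z \<oplus>\<^bsub>V\<^esub> l (x \<otimes>\<^bsub>H\<^esub> y) c \<oplus>\<^bsub>V\<^esub> (s b (x \<otimes>\<^bsub>H\<^esub> z) \<oplus>\<^bsub>V\<^esub> l y (s a z \<oplus>\<^bsub>V\<^esub> l x c)),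
          x \<otimes>\<^bsub>H\<^esub> y \<otimes>\<^bsub>H\<^esub> z \<oplus>\<^bsub>H\<^esub> y \<otimes>\<^bsub>H\<^esub> (x \<otimes>\<^bsub>H\<^esub> z)), i \<otimes>\<^bsub>H\<^esub> j \<otimes>\<^bsub>H\<^esub> k \<oplus>\<^bsub>H\<^esub> j \<otimes>\<^bsub>H\<^esub> (i \<otimes>\<^bsub>H\<^esub> k))"
        by (simp add: Y_def)
      define e where "e = \<omega> k"
      have e: "e \<in> carrier F" using lc t by (simp add: e_def)
      \<comment> \<open>The first coordinate of the Leibniz identity. The unwanted y(e a) on the
        right cancels against e(a y) = - e(y a), which is where the symmetric action is used; terms
        with \<omega> of a product vanish.\<close>
      have "l x (l y w' \<oplus>\<^bsub>V\<^esub> e \<odot>\<^bsub>V\<^esub> b) =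
        (l (x \<otimes>\<^bsub>H\<^esub> y) w' \<oplus>\<^bsub>V\<^esub> e \<odot>\<^bsub>V\<^esub> (s a y \<oplus>\<^bsub>V\<^esub> l x b)) \<oplus>\<^bsub>V\<^esub> l y (l x w' \<oplus>\<^bsub>V\<^esub> e \<odot>\<^bsub>V\<^esub> a)"
      proof -
        define m1 m2 m3 m4 where "m1 = l (x \<otimes>\<^bsub>H\<^esub> y) w'" and "m2 = l y (l x w')" and "m3 = e \<odot>\<^bsub>V\<^esub> l x b"
          and "m4 = e \<odot>\<^bsub>V\<^esub> l y a"
        have mc: "m1 \<in> carrier V" "m2 \<in> carrier V" "m3 \<in> carrier V" "m4 \<in> carrier V"
          using p q t e l_closed H.mult_closed by (auto simp: m1_def m2_def m3_def m4_def)
        have "l x (l y w' \<oplus>\<^bsub>V\<^esub> e \<odot>\<^bsub>V\<^esub> b) = (m1 \<oplus>\<^bsub>V\<^esub> m2) \<oplus>\<^bsub>V\<^esub> m3"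
          using p q t e l_closed l_mult[of x y w'] by (simp add: l_add2 l_smult2 m1_def m2_def m3_def)
        also have "\<dots> = (m1 \<oplus>\<^bsub>V\<^esub> (\<ominus>\<^bsub>V\<^esub> m4 \<oplus>\<^bsub>V\<^esub> m3)) \<oplus>\<^bsub>V\<^esub> (m2 \<oplus>\<^bsub>V\<^esub> m4)" using mc by algebra
        also have "e \<odot>\<^bsub>V\<^esub> (s a y \<oplus>\<^bsub>V\<^esub> l x b) = \<ominus>\<^bsub>V\<^esub> m4 \<oplus>\<^bsub>V\<^esub> m3"
          using p q e l_closed by (simp add: sym V.smult_r_distr V.smult_r_minus m3_def m4_def)
        then have "m1 \<oplus>\<^bsub>V\<^esub> (\<ominus>\<^bsub>V\<^esub> m4 \<oplus>\<^bsub>V\<^esub> m3) \<oplus>\<^bsub>V\<^esub> (m2 \<oplus>\<^bsub>V\<^esub> m4) =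
          (l (x \<otimes>\<^bsub>H\<^esub> y) w' \<oplus>\<^bsub>V\<^esub> e \<odot>\<^bsub>V\<^esub> (s a y \<oplus>\<^bsub>V\<^esub> l x b)) \<oplus>\<^bsub>V\<^esub> l y (l x w' \<oplus>\<^bsub>V\<^esub> e \<odot>\<^bsub>V\<^esub> a)"
          using p q t e l_closed by (simp add: l_add2 l_smult2 m1_def m2_def m4_def)
        finally show ?thesis .
      qed
      then show ?case
        using Yeq p q t e l_closed S.r_closed H.mult_closed
        by (simp add: Zmult Zadd lm e_def[symmetric])
    qed
    then have Zl: "leibniz_algebra F Z" using Z.vectorspace_axioms by (simp add: leibniz_algebra_def)
    interpret Z: leibniz_algebra F Z by (rule Zl)
    have sndZ: "snd \<in> alg_hom F Z Y"
      by (rule alg_homI) (auto simp: Zc Yc Zadd Zmult Zsmult, auto simp: Y_def)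
    have Zs: "soluble_leibniz F Z"
    proof (rule abelian_extension_soluble[OF Zl _ Ys sndZ])
      show "vectorspace.fin_dim F Z"
        unfolding Z_def by (rule vs_pair.pair_fin_dim[OF vp fd solubleD(2)[OF Ys]])
      show "p \<otimes>\<^bsub>Z\<^esub> q = \<zero>\<^bsub>Z\<^esub>"
        if "p \<in> carrier Z" "q \<in> carrier Z" "snd p = \<zero>\<^bsub>Y\<^esub>" "snd q = \<zero>\<^bsub>Y\<^esub>" for p q
        using that by (auto simp: Zc Y_def Zmult Zzero l_zero S.r_zero l0)
    qed
    define KY where "KY = (W \<times> {\<zero>\<^bsub>H\<^esub>}) \<times> {\<zero>\<^bsub>H\<^esub>}"
    define KZ where "KZ = W \<times> KY"
    define C where "C = carrier V \<times> {\<zero>\<^bsub>Y\<^esub>}"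
    define I where "I = carrier V \<times> ((carrier V \<times> {\<zero>\<^bsub>H\<^esub>}) \<times> {\<zero>\<^bsub>H\<^esub>})"
    have Yzero: "\<zero>\<^bsub>Y\<^esub> = ((\<zero>\<^bsub>V\<^esub>, \<zero>\<^bsub>H\<^esub>), \<zero>\<^bsub>H\<^esub>)" by (simp add: Y_def)
    have inqY: "inq Y KY \<and> alg_ideal F Y KY"
    proof -
      have f: "fst \<in> alg_hom F Y S.SD" and s: "snd \<in> alg_hom F Y H"
        by (rule alg_homI; auto simp: Y_def)+
      let ?K1 = "{y \<in> carrier Y. fst y \<in> W \<times> {\<zero>\<^bsub>H\<^esub>}}" and ?K2 = "{y \<in> carrier Y. snd y \<in> {\<zero>\<^bsub>H\<^esub>}}"
      have i1: "alg_ideal F Y ?K1" by (rule alg_hom_kernel_ideal[OF Yl Sl f iSW])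
      have i2: "alg_ideal F Y ?K2" by (rule alg_hom_kernel_ideal[OF Yl Hl s H.zero_ideal])
      have "inq Y ?K1"
      proof (rule inq_transfer_back[OF Yl Sl i1 iSW hom_hom_mod[OF Sl iSW f] _ _ inq])
        fix y assume y: "y \<in> carrier S.SD"
        then have "(y, \<zero>\<^bsub>H\<^esub>) \<in> carrier Y" by (simp add: Y_def)
        then show "\<exists>x\<in>carrier Y. eqmod S.SD (W \<times> {\<zero>\<^bsub>H\<^esub>}) y (fst x)"
          using SS.eqmod_refl[OF SS.ideal_subspace[OF iSW] y] by (metis fst_conv)
      qed simp
      moreover have "inq Y ?K2"
      proof (rule inq_transfer_back[OF Yl Hl i2 H.zero_ideal hom_hom_mod[OF Hl H.zero_ideal s] _ _ inqH])
        fix y assume y: "y \<in> carrier H"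
        then have "(\<zero>\<^bsub>S.SD\<^esub>, y) \<in> carrier Y" by (simp add: Y_def)
        then show "\<exists>x\<in>carrier Y. eqmod H {\<zero>\<^bsub>H\<^esub>} y (snd x)"
          using H.eqmod_refl[OF H.subspace_zero y] by (metis snd_conv)
      qed simp
      moreover have "?K1 \<inter> ?K2 = KY" using w(3) by (auto simp: Yc KY_def)
      ultimately show ?thesis using inq_Int[OF Ys i1 i2] Y.ideal_Int[OF i1 i2] by simp
    qed
    have iKZ: "alg_ideal F Z KZ"
    proof -
      have "subspace F KZ Z" unfolding KZ_def Z_def
        using inqY by (intro vs_pair.pair_subspace[OF vp subW] Y.ideal_subspace) simp
      then show ?thesis
        using w submodD[OF W] S.submodD[OF sW]
        by (auto simp: alg_ideal_def KZ_def KY_def Zc Zmult lc l_zero S.r_zero l0 l_closed S.r_closed)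
    qed
    have iC: "alg_ideal F Z C"
    proof -
      have "subspace F C Z" unfolding C_def Z_def
        by (rule vs_pair.pair_subspace[OF vp V.subspace_carrier Y.subspace_zero])
      then show ?thesis
        by (auto simp: alg_ideal_def C_def Yzero Zc Zmult lc l_zero S.r_zero l0 l_closed S.r_closed)
    qed
    have iI: "alg_ideal F Z I"
    proof -
      have "subspace F ((carrier V \<times> {\<zero>\<^bsub>H\<^esub>}) \<times> {\<zero>\<^bsub>H\<^esub>}) Y"
        unfolding Y_def prod_alg_def semidirect_def
        by (rule vs_pair.pair_subspace[OF vs_pairI] vs_pair.pair_subspace[OF vs_pair]
            vs_pair.pair_vectorspace[OF vs_pair] V.subspace_carrier H.subspace_zero H.vectorspace_axioms)+
      then have "subspace F I Z" unfolding I_def Z_def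
        by (rule vs_pair.pair_subspace[OF vp V.subspace_carrier])
      then show ?thesis
        by (auto simp: alg_ideal_def I_def Zc Zmult lc l_zero S.r_zero l0 l_closed S.r_closed)
    qed
    have inqZ: "inq Z KZ"
    proof (rule inqI_primitive[OF Zs iKZ])
      fix J assume J: "alg_ideal F Z J" "KZ \<subseteq> J" "prim_quot F Z J"
      note j = Z.subspaceD[OF Z.ideal_subspace[OF J(1)]]
      have "C \<subseteq> J"
      proof (rule ccontr)
        assume CJ: "\<not> C \<subseteq> J"
        have CI: "C \<subseteq> I" by (auto simp: C_def I_def Yzero)
        then have IJ: "\<not> I \<subseteq> J" using CJ by blast
        have prod: "p \<otimes>\<^bsub>Z\<^esub> q \<in> J" if "p \<in> I" "q \<in> I" for p q
          using that j(2) by (auto simp: I_def Zmult Zzero l_zero S.r_zero l0)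
        have prodC: "p \<otimes>\<^bsub>Z\<^esub> q \<in> J" if "p \<in> C" "q \<in> C" for p q
          using that CI by (intro prod) blast+
        obtain k where k: "k \<in> carrier H" "\<omega> k = \<one>\<^bsub>F\<^esub>" using l1 by blast
        have "(c, \<zero>\<^bsub>Y\<^esub>) \<in> J" if c: "c \<in> carrier V" for c
        proof -
          have "\<exists>q\<in>C. eqmod Z J (\<zero>\<^bsub>V\<^esub>, ((c, \<zero>\<^bsub>H\<^esub>), \<zero>\<^bsub>H\<^esub>)) q"
            by (rule Z.prim_quot_socle[OF J(1,3) iC CJ prodC iI IJ prod]) (use c in \<open>simp_all add: I_def\<close>)
          then obtain g where g: "g \<in> carrier V" "eqmod Z J (\<zero>\<^bsub>V\<^esub>, ((c, \<zero>\<^bsub>H\<^esub>), \<zero>\<^bsub>H\<^esub>)) (g, \<zero>\<^bsub>Y\<^esub>)"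
            by (auto simp: C_def)
          define p where "p = (\<zero>\<^bsub>V\<^esub>, ((c, \<zero>\<^bsub>H\<^esub>), \<zero>\<^bsub>H\<^esub>))"
          define q where "q = (g, \<zero>\<^bsub>Y\<^esub>)"
          define t where "t = (\<zero>\<^bsub>V\<^esub>, ((\<zero>\<^bsub>V\<^esub>, \<zero>\<^bsub>H\<^esub>), k))"
          have pqt: "p \<in> carrier Z" "q \<in> carrier Z" "t \<in> carrier Z"
            using c g k by (auto simp: p_def q_def t_def Zc Yzero)
          have "p \<ominus>\<^bsub>Z\<^esub> q \<in> J" using g(2) by (simp add: eqmod_def p_def q_def)
          then have "(p \<ominus>\<^bsub>Z\<^esub> q) \<otimes>\<^bsub>Z\<^esub> t \<in> J" using Z.ideal_mult(2)[OF J(1) pqt(3)] by blast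
          moreover have "(p \<ominus>\<^bsub>Z\<^esub> q) \<otimes>\<^bsub>Z\<^esub> t = p \<otimes>\<^bsub>Z\<^esub> t \<ominus>\<^bsub>Z\<^esub> q \<otimes>\<^bsub>Z\<^esub> t"
            by (rule Z.mult_minus(2)[OF pqt])
          moreover have "q \<otimes>\<^bsub>Z\<^esub> t = \<zero>\<^bsub>Z\<^esub>"
            using g k by (simp add: q_def t_def Yzero Zmult Zzero l_zero S.r_zero lc)
          moreover have "p \<otimes>\<^bsub>Z\<^esub> t = (c, \<zero>\<^bsub>Y\<^esub>)"
            using c k by (simp add: p_def t_def Yzero Zmult l_zero S.r_zero)
          moreover have "(c, \<zero>\<^bsub>Y\<^esub>) \<in> carrier Z" using c by (simp add: Zc Yzero)
          ultimately show ?thesis by simp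
        qed
        then show False using CJ by (auto simp: C_def)
      qed
      have iKY: "alg_ideal F Y KY" and qKY: "inq Y KY" using inqY by auto
      \<comment> \<open>Modulo C the algebra Z is just Y. As J contains C, the zero section makes
        Z/J an image of the class member Y/KY.\<close>
      define \<phi> where "\<phi> y = (\<zero>\<^bsub>V\<^esub>, y)" for y :: "('v \<times> 'h) \<times> 'h"
      have CJ: "eqmod Z J (u, y) (v, y)" if "u \<in> carrier V" "v \<in> carrier V" "y \<in> carrier Y" for u v y
      proof -
        have "(u, y) \<ominus>\<^bsub>Z\<^esub> (v, y) = (u \<ominus>\<^bsub>V\<^esub> v, \<zero>\<^bsub>Y\<^esub>)"
          unfolding Z_def using that Y.minus_eq_zero_iff by (simp add: vs_pair.pair_minus[OF vp])
        then show ?thesis using \<open>C \<subseteq> J\<close> that by (auto simp: eqmod_def C_def)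
      qed
      have hom: "hom_mod F Y Z J \<phi>"
        unfolding hom_mod_def
      proof (intro conjI ballI)
        fix y y' assume y: "y \<in> carrier Y" "y' \<in> carrier Y"
        have "\<phi> y \<otimes>\<^bsub>Z\<^esub> \<phi> y' \<in> carrier Z" "snd (\<phi> y \<otimes>\<^bsub>Z\<^esub> \<phi> y') = y \<otimes>\<^bsub>Y\<^esub> y'"
          using y alg_homD(3)[OF sndZ, of "\<phi> y" "\<phi> y'"] Z.mult_closed[of "\<phi> y" "\<phi> y'"]
          by (auto simp: \<phi>_def Zc Yc)
        then obtain v where "\<phi> y \<otimes>\<^bsub>Z\<^esub> \<phi> y' = (v, y \<otimes>\<^bsub>Y\<^esub> y')" "v \<in> carrier V"
          by (cases "\<phi> y \<otimes>\<^bsub>Z\<^esub> \<phi> y'") (auto simp: Zc)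
        then show "eqmod Z J (\<phi> (y \<otimes>\<^bsub>Y\<^esub> y')) (\<phi> y \<otimes>\<^bsub>Z\<^esub> \<phi> y')"
          using CJ[of "\<zero>\<^bsub>V\<^esub>" v "y \<otimes>\<^bsub>Y\<^esub> y'"] Y.mult_closed[OF y] by (simp add: \<phi>_def)
      next
        fix y assume y: "y \<in> carrier Y"
        then show "\<phi> y \<in> carrier Z" by (simp add: \<phi>_def Z_def)
      next
        fix y y' assume y: "y \<in> carrier Y" "y' \<in> carrier Y"
        have "\<phi> (y \<oplus>\<^bsub>Y\<^esub> y') = \<phi> y \<oplus>\<^bsub>Z\<^esub> \<phi> y'" "\<phi> (y \<oplus>\<^bsub>Y\<^esub> y') \<in> carrier Z" using y by (simp_all add: \<phi>_def Z_def)
        then show "eqmod Z J (\<phi> (y \<oplus>\<^bsub>Y\<^esub> y')) (\<phi> y \<oplus>\<^bsub>Z\<^esub> \<phi> y')"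
          using Z.eqmod_refl[OF Z.ideal_subspace[OF J(1)]] by simp
      next
        fix c y assume y: "c \<in> carrier F" "y \<in> carrier Y"
        have "\<phi> (c \<odot>\<^bsub>Y\<^esub> y) = c \<odot>\<^bsub>Z\<^esub> \<phi> y" "\<phi> (c \<odot>\<^bsub>Y\<^esub> y) \<in> carrier Z" using y by (simp_all add: \<phi>_def Z_def)
        then show "eqmod Z J (\<phi> (c \<odot>\<^bsub>Y\<^esub> y)) (c \<odot>\<^bsub>Z\<^esub> \<phi> y)"
          using Z.eqmod_refl[OF Z.ideal_subspace[OF J(1)]] by simp
      qed
      show "inq Z J"
      proof (rule inq_transfer[OF Yl Zl iKY J(1) hom _ _ qKY])
        show "\<phi> y \<in> J" if "y \<in> KY" for y
          using that J(2) w(2) by (auto simp: \<phi>_def KZ_def)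
        show "\<exists>x\<in>carrier Y. eqmod Z J z (\<phi> x)" if z: "z \<in> carrier Z" for z
        proof -
          obtain u y where "z = (u, y)" "u \<in> carrier V" "y \<in> carrier Y" using z by (auto simp: Z_def)
          then show ?thesis using CJ[of u "\<zero>\<^bsub>V\<^esub>" y] by (auto simp: \<phi>_def)
        qed
      qed
    qed
    define R where "R = fibre_alg Z C"
    have Rl: "leibniz_algebra F R" unfolding R_def by (rule solubleD(1)[OF fibre_soluble[OF Zs iC]])
    define KR where "KR = {(z, z') \<in> carrier R. z \<in> KZ \<and> z' \<in> KZ}"
    have KR: "alg_ideal F R KR" "inq R KR"
      unfolding R_def KR_def by (rule inq_fibre[OF Zs iC iKZ inqZ])+
    have Rcases: "\<exists>u v a x i. p = ((u, ((a, x), i)), (v, ((a, x), i))) \<and> u \<in> carrier V \<and> v \<in> carrier V \<and>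
        a \<in> carrier V \<and> x \<in> carrier H \<and> i \<in> carrier H" if pR: "p \<in> carrier R" for p
    proof -
      obtain z z' where p: "p = (z, z')" "z \<in> carrier Z" "z' \<in> carrier Z" "z \<ominus>\<^bsub>Z\<^esub> z' \<in> C"
        using pR by (auto simp: R_def eqmod_def)
      obtain u y where z: "z = (u, y)" "u \<in> carrier V" "y \<in> carrier Y" using p(2) by (auto simp: Z_def)
      obtain v y' where z': "z' = (v, y')" "v \<in> carrier V" "y' \<in> carrier Y" using p(3) by (auto simp: Z_def)
      have "z \<ominus>\<^bsub>Z\<^esub> z' = (u \<ominus>\<^bsub>V\<^esub> v, y \<ominus>\<^bsub>Y\<^esub> y')"
        unfolding Z_def using z z' by (simp add: vs_pair.pair_minus[OF vp])
      then have "y = y'" using p(4) z z' Y.minus_eq_zero_iff by (simp add: C_def)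
      then show ?thesis using p z z' by (auto simp: Yc)
    qed
    \<comment> \<open>Two elements of the fibre product differ only in their C-coordinates. In the
      difference the contributions of \<omega> cancel and only the left action remains, so the image
      is the split extension with zero right action.\<close>
    define \<phi> where "\<phi> = (\<lambda>(z :: 'v \<times> ('v \<times> 'h) \<times> 'h, z' :: 'v \<times> ('v \<times> 'h) \<times> 'h).
      (fst z \<ominus>\<^bsub>V\<^esub> fst z', snd (fst (snd z'))))"
    have \<phi>: "\<phi> ((u, y), (v, ((a, x), i))) = (u \<ominus>\<^bsub>V\<^esub> v, x)" for u y v a x i by (simp add: \<phi>_def)
    show ?thesis
    proof (rule inq_transfer[OF Rl SDl KR(1) iW _ _ _ KR(2)])
      show "hom_mod F R SD (W \<times> {\<zero>\<^bsub>H\<^esub>}) \<phi>"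
        unfolding hom_mod_def
      proof (intro conjI ballI)
        fix p assume "p \<in> carrier R"
        then show "\<phi> p \<in> carrier SD" using Rcases[of p] by (auto simp: \<phi>)
      next
        fix p q assume "p \<in> carrier R" "q \<in> carrier R"
        then obtain u v a x i u' v' a' x' i' where
          p: "p = ((u, ((a, x), i)), (v, ((a, x), i)))" "u \<in> carrier V" "v \<in> carrier V" "a \<in> carrier V" "x \<in> carrier H" "i \<in> carrier H"
          and q: "q = ((u', ((a', x'), i')), (v', ((a', x'), i')))" "u' \<in> carrier V" "v' \<in> carrier V" "a' \<in> carrier V" "x' \<in> carrier H" "i' \<in> carrier H"
          using Rcases by metis
        have "(u \<oplus>\<^bsub>V\<^esub> u') \<ominus>\<^bsub>V\<^esub> (v \<oplus>\<^bsub>V\<^esub> v') = (u \<ominus>\<^bsub>V\<^esub> v) \<oplus>\<^bsub>V\<^esub> (u' \<ominus>\<^bsub>V\<^esub> v')"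
          using p(2,3) q(2,3) by algebra
        then show "eqmod SD (W \<times> {\<zero>\<^bsub>H\<^esub>}) (\<phi> (p \<oplus>\<^bsub>R\<^esub> q)) (\<phi> p \<oplus>\<^bsub>SD\<^esub> \<phi> q)"
          using p q by (simp add: R_def Zadd \<phi> em V.eqmod_refl[OF subW])
        have "(l x u' \<oplus>\<^bsub>V\<^esub> \<omega> i' \<odot>\<^bsub>V\<^esub> a) \<ominus>\<^bsub>V\<^esub> (l x v' \<oplus>\<^bsub>V\<^esub> \<omega> i' \<odot>\<^bsub>V\<^esub> a) = l x (u' \<ominus>\<^bsub>V\<^esub> v')"
        proof -
          have c: "l x u' \<in> carrier V" "l x v' \<in> carrier V" "\<omega> i' \<odot>\<^bsub>V\<^esub> a \<in> carrier V" using p q l_closed lc by auto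
          show ?thesis unfolding l_minus[OF p(5) q(2,3)] by (rule V.M.minus_add_cancel_right[OF c])
        qed
        moreover have "eqmod V W (l x (u' \<ominus>\<^bsub>V\<^esub> v')) (r (u \<ominus>\<^bsub>V\<^esub> v) x' \<oplus>\<^bsub>V\<^esub> l x (u' \<ominus>\<^bsub>V\<^esub> v'))"
          by (rule V.eqmod_sym[OF subW V.eqmod_absorb(1)[OF subW]])
            (use p q anti l_closed r_closed in simp_all)
        ultimately show "eqmod SD (W \<times> {\<zero>\<^bsub>H\<^esub>}) (\<phi> (p \<otimes>\<^bsub>R\<^esub> q)) (\<phi> p \<otimes>\<^bsub>SD\<^esub> \<phi> q)"
          using p q l_closed r_closed H.mult_closed by (simp add: R_def Zmult \<phi> em)
      next
        fix c p assume c: "c \<in> carrier F" and "p \<in> carrier R"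
        then obtain u v a x i where
          p: "p = ((u, ((a, x), i)), (v, ((a, x), i)))" "u \<in> carrier V" "v \<in> carrier V" "a \<in> carrier V" "x \<in> carrier H" "i \<in> carrier H"
          using Rcases by metis
        have "(c \<odot>\<^bsub>V\<^esub> u) \<ominus>\<^bsub>V\<^esub> (c \<odot>\<^bsub>V\<^esub> v) = c \<odot>\<^bsub>V\<^esub> (u \<ominus>\<^bsub>V\<^esub> v)"
          using c p by (simp add: V.M.minus_eq V.smult_r_distr V.smult_r_minus)
        then show "eqmod SD (W \<times> {\<zero>\<^bsub>H\<^esub>}) (\<phi> (c \<odot>\<^bsub>R\<^esub> p)) (c \<odot>\<^bsub>SD\<^esub> \<phi> p)"
          using c p by (simp add: R_def Zsmult \<phi> em V.eqmod_refl[OF subW])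
      qed
      show "\<phi> p \<in> W \<times> {\<zero>\<^bsub>H\<^esub>}" if "p \<in> KR" for p
        using that w(7) by (auto simp: KR_def KZ_def KY_def \<phi>)
      show "\<exists>p\<in>carrier R. eqmod SD (W \<times> {\<zero>\<^bsub>H\<^esub>}) y (\<phi> p)" if y: "y \<in> carrier SD" for y
      proof -
        obtain v x where y: "y = (v, x)" "v \<in> carrier V" "x \<in> carrier H" using y by auto
        define p where "p = ((v, ((\<zero>\<^bsub>V\<^esub>, x), \<zero>\<^bsub>H\<^esub>)), (\<zero>\<^bsub>V\<^esub>, ((\<zero>\<^bsub>V\<^esub>, x), \<zero>\<^bsub>H\<^esub>)))"
        have "(v, ((\<zero>\<^bsub>V\<^esub>, x), \<zero>\<^bsub>H\<^esub>)) \<ominus>\<^bsub>Z\<^esub> (\<zero>\<^bsub>V\<^esub>, ((\<zero>\<^bsub>V\<^esub>, x), \<zero>\<^bsub>H\<^esub>)) = (v \<ominus>\<^bsub>V\<^esub> \<zero>\<^bsub>V\<^esub>, \<zero>\<^bsub>Y\<^esub>)"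
          unfolding Z_def using y Y.minus_eq_zero_iff[of "((\<zero>\<^bsub>V\<^esub>, x), \<zero>\<^bsub>H\<^esub>)"] by (simp add: vs_pair.pair_minus[OF vp] Yc)
        then have "p \<in> carrier R" using y by (simp add: p_def R_def Zc eqmod_def C_def)
        moreover have "v \<ominus>\<^bsub>V\<^esub> \<zero>\<^bsub>V\<^esub> = v" using y by simp
        then have "\<phi> p = y" using y by (simp add: p_def \<phi>)
        moreover have "eqmod SD (W \<times> {\<zero>\<^bsub>H\<^esub>}) y y"
          using SD.eqmod_refl[OF SD.ideal_subspace[OF iW], of y] y by simp
        ultimately show ?thesis by (metis (no_types, lifting))
      qed
    qed
  qed
qed

end

lemma (in vectorspace) set_add_zero: "S \<subseteq> carrier V \<Longrightarrow> S <+>\<^bsub>V\<^esub> {\<zero>\<^bsub>V\<^esub>} = S"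
  by (auto simp: set_add_def' subset_iff)

text \<open>The law \<open>l_mult\<close> of the left action alone implies all three laws once vx is
  defined as - xv.\<close>

lemma (in bimod) symmetric_bimod: "bimod F H V l (\<lambda>v x. \<ominus>\<^bsub>V\<^esub> l x v)"
proof (intro bimod.intro bimod_axioms.intro, goal_cases)
  case 1 show ?case by (rule H.leibniz_algebra_axioms)
next
  case 2 show ?case by (rule V.vectorspace_axioms)
next
  case (13 x y v)
  then show ?case by (rule l_mult)
next
  case (14 x y v)
  then show ?case
    using l_closed H.mult_closed V.M.minus_add[of "l y (l x v)" "l (x \<otimes>\<^bsub>H\<^esub> y) v"] l_mult[OF 14]
    by (simp add: l_uminus V.M.minus_add V.M.a_comm)
next
  case (15 x y v)
  define p q where "p = l x (l y v)" and "q = l y (l x v)"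
  have c: "p \<in> carrier V" "q \<in> carrier V" using 15 l_closed by (auto simp: p_def q_def)
  have "\<ominus>\<^bsub>V\<^esub> (p \<ominus>\<^bsub>V\<^esub> q) = q \<oplus>\<^bsub>V\<^esub> (\<ominus>\<^bsub>V\<^esub> p)" using c by algebra
  then show ?case using l_mult_left[OF 15] 15 c l_closed by (simp add: l_uminus p_def q_def)
qed (auto simp: l_closed l_add1 l_add2 l_smult1 l_smult2 V.M.minus_add V.smult_r_minus V.M.a_comm)

context class_bimod
begin

lemma restrict_class_bimod:
  assumes "submod U"
  shows "class_bimod F H (V\<lparr>carrier := U\<rparr>) l r \<HH>"
  by (intro class_bimod.intro class_bimod_axioms.intro restrict_bimod[OF assms] schunck_formation_class_axioms
      solH inH V.subspace_fin_dim[OF fd submod_subspace[OF assms]])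

text \<open>The identity g(xy) = x g(y) - y g(x) of an antiderivation is the cocycle identity for
  the right action vx = - xv. The values of g lie in N, the part with zero right action modulo W; N
  is a left submodule, so it can be given the symmetric action s, and \<open>cocycle_inner\<close>
  applies there. The element found lies in N, which is why it has zero right action modulo W
  too.\<close>

lemma anticocycle_inner:
  assumes free: "central_free W"
    and gc: "\<And>x. x \<in> carrier H \<Longrightarrow> g x \<in> carrier V"
    and gr: "\<And>x y. x \<in> carrier H \<Longrightarrow> y \<in> carrier H \<Longrightarrow> r (g x) y \<in> W"
    and ga: "\<And>x y. x \<in> carrier H \<Longrightarrow> y \<in> carrier H \<Longrightarrow> eqmod V W (g (x \<oplus>\<^bsub>H\<^esub> y)) (g x \<oplus>\<^bsub>V\<^esub> g y)"
    and gs: "\<And>c x. c \<in> carrier F \<Longrightarrow> x \<in> carrier H \<Longrightarrow> eqmod V W (g (c \<odot>\<^bsub>H\<^esub> x)) (c \<odot>\<^bsub>V\<^esub> g x)"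
    and gm: "\<And>x y. x \<in> carrier H \<Longrightarrow> y \<in> carrier H \<Longrightarrow>
      eqmod V W (g (x \<otimes>\<^bsub>H\<^esub> y)) (l x (g y) \<ominus>\<^bsub>V\<^esub> l y (g x))"
  shows "\<exists>w\<in>carrier V. (\<forall>x\<in>carrier H. r w x \<in> W) \<and> (\<forall>x\<in>carrier H. eqmod V W (g x) (\<ominus>\<^bsub>V\<^esub> l x w))"
proof -
  have W: "submod W" using free by (simp add: central_free_def)
  note w = V.subspaceD[OF submod_subspace[OF W]]
  define s where "s = (\<lambda>v x. \<ominus>\<^bsub>V\<^esub> l x v)"
  interpret S0: bimod F H V l s unfolding s_def by (rule symmetric_bimod)
  define N where "N = {v \<in> carrier V. \<forall>x\<in>carrier H. r v x \<in> W}"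
  have sN: "subspace F N V"
    by (rule V.subspaceI) (auto simp: N_def r_zero r_add1 r_smult1 w)
  note n = V.subspaceD[OF sN]
  have lN: "l x v \<in> N" if x: "x \<in> carrier H" and v: "v \<in> N" for x v
  proof -
    have vc: "v \<in> carrier V" and vr: "\<And>y. y \<in> carrier H \<Longrightarrow> r v y \<in> W" using v by (auto simp: N_def)
    have "r (l x v) y \<in> W" if y: "y \<in> carrier H" for y
      using r_l_swap[OF x y vc] vr[OF H.mult_closed[OF x y]] submodD(1)[OF W x vr[OF y]] w(7) by simp
    then show ?thesis using l_closed[OF x vc] by (simp add: N_def)
  qed
  have S0N: "S0.submod N" unfolding S0.submod_def using sN lN n(6) by (simp add: s_def)
  have WN: "W \<subseteq> N" using w(3) submodD(2)[OF W] by (auto simp: N_def)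
  interpret S0c: class_bimod F H V l s \<HH>
    by (intro class_bimod.intro class_bimod_axioms.intro S0.bimod_axioms schunck_formation_class_axioms solH inH fd)
  interpret S: class_bimod F H "V\<lparr>carrier := N\<rparr>" l s \<HH> by (rule S0c.restrict_class_bimod[OF S0N])
  have S_submod: "S.submod U \<longleftrightarrow> S0.submod U \<and> U \<subseteq> N" for U by (rule S0.restrict_submod_iff[OF S0N])
  have W0: "S0.submod W" unfolding S0.submod_def using W w(6) by (simp add: submod_def s_def)
  have "S.central_free W"
    unfolding S.central_free_def
  proof (intro conjI allI impI)
    show "S.submod W" using S_submod W0 WN by blast
    fix U assume U: "S.submod U \<and> W \<subset> U"
    then have U0: "S0.submod U" "U \<subseteq> N" "W \<subset> U" using S_submod by auto
    have sU: "subspace F U V" by (rule S0.submod_subspace[OF U0(1)])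
    have rU: "r u x \<in> W" if "x \<in> carrier H" "u \<in> U" for x u using that U0(2) by (auto simp: N_def)
    have smU: "submod U"
      using sU S0.submodD(1)[OF U0(1)] rU U0(3) by (auto simp: submod_def)
    interpret U: class_bimod F H "V\<lparr>carrier := U\<rparr>" l r \<HH> by (rule restrict_class_bimod[OF smU])
    show "\<not> S.central U W"
    proof
      \<comment> \<open>U lies in N, so its original right action is zero modulo W;
        \<open>central_antisym_of_sym\<close> would make U/W central for that action.\<close>
      assume "S.central U W"
      then have q: "inq (semidirect H (V\<lparr>carrier := U\<rparr>) l s) (W \<times> {\<zero>\<^bsub>H\<^esub>})"
        by (simp add: S.central_def)
      have "inq U.SD (W \<times> {\<zero>\<^bsub>H\<^esub>})"
      proof (rule U.central_antisym_of_sym[OF S0.restrict_bimod[OF U0(1)] _ _ _ q])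
        show "s v x = \<ominus>\<^bsub>V\<lparr>carrier := U\<rparr>\<^esub> l x v" if "x \<in> carrier H" "v \<in> carrier (V\<lparr>carrier := U\<rparr>)" for x v
          using V.restrict_uminus[OF sU] submodD(1)[OF smU that(1)] that(2) by (simp add: s_def)
        show "U.submod W" using restrict_submod_iff[OF smU] W U0(3) by blast
        show "r v x \<in> W" if "x \<in> carrier H" "v \<in> carrier (V\<lparr>carrier := U\<rparr>)" for x v
          using rU that by simp
      qed
      then have "central U W" by (simp add: central_def)
      then show False using free smU U0(3) by (simp add: central_free_def)
    qed
  qed
  moreover
  have gN: "g x \<in> N" if "x \<in> carrier H" for x using gc gr that by (simp add: N_def)
  have "S.cocycle W g"
    unfolding S.cocycle_def
  proof (intro conjI ballI)
    show "g x \<in> carrier (V\<lparr>carrier := N\<rparr>)" if "x \<in> carrier H" for x using gN that by simp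
    show "eqmod (V\<lparr>carrier := N\<rparr>) W (g (x \<oplus>\<^bsub>H\<^esub> y)) (g x \<oplus>\<^bsub>V\<lparr>carrier := N\<rparr>\<^esub> g y)"
      if "x \<in> carrier H" "y \<in> carrier H" for x y
      using ga[OF that] gN that n(4) by (simp add: V.restrict_eqmod[OF sN])
    show "eqmod (V\<lparr>carrier := N\<rparr>) W (g (c \<odot>\<^bsub>H\<^esub> x)) (c \<odot>\<^bsub>V\<lparr>carrier := N\<rparr>\<^esub> g x)"
      if "c \<in> carrier F" "x \<in> carrier H" for c x
      using gs[OF that] gN that n(5) by (simp add: V.restrict_eqmod[OF sN])
    show "eqmod (V\<lparr>carrier := N\<rparr>) W (g (x \<otimes>\<^bsub>H\<^esub> y)) (s (g x) y \<oplus>\<^bsub>V\<lparr>carrier := N\<rparr>\<^esub> l x (g y))"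
      if xy: "x \<in> carrier H" "y \<in> carrier H" for x y
    proof -
      have c: "l x (g y) \<in> N" "s (g x) y \<in> N" using lN gN n(6) xy by (auto simp: s_def)
      have "s (g x) y \<oplus>\<^bsub>V\<^esub> l x (g y) = l x (g y) \<ominus>\<^bsub>V\<^esub> l y (g x)"
        using l_closed gc xy by (simp add: s_def V.M.minus_eq V.M.a_comm)
      then have "eqmod V W (g (x \<otimes>\<^bsub>H\<^esub> y)) (s (g x) y \<oplus>\<^bsub>V\<^esub> l x (g y))" using gm[OF xy] by simp
      then show ?thesis
        using V.restrict_eqmod[OF sN gN[OF H.mult_closed[OF xy]] n(4)[OF c(2,1)]] by simp
    qed
  qed
  ultimately have "\<exists>v\<in>carrier (V\<lparr>carrier := N\<rparr>). \<forall>x\<in>carrier H. eqmod (V\<lparr>carrier := N\<rparr>) W (g x) (s v x)"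
    by (rule S.cocycle_inner)
  then obtain v where v: "v \<in> N" "\<And>x. x \<in> carrier H \<Longrightarrow> eqmod (V\<lparr>carrier := N\<rparr>) W (g x) (s v x)"
    by auto
  have "eqmod V W (g x) (\<ominus>\<^bsub>V\<^esub> l x v)" if x: "x \<in> carrier H" for x
    using v(2)[OF x] V.restrict_eqmod[OF sN gN[OF x]] lN[OF x v(1)] n(6) by (simp add: s_def)
  then show ?thesis using v(1) by (auto simp: N_def)
qed

end

subsection \<open>Projectors and the layers of the derived series\<close>

text \<open>An equality of records rather than an isomorphism: among the fields of
  \<open>quotient_alg\<close> only \<open>carrier\<close> refers to the carrier of L. Subalgebras of
  L/K in the definition of a projector thus become quotients of subalgebras of L.\<close>

lemma quotient_restrict:
  "(quotient_alg L K)\<lparr>carrier := (\<lambda>x. K +>\<^bsub>L\<^esub> x) ` U\<rparr> = quotient_alg (L\<lparr>carrier := U\<rparr>) K"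
  by (auto simp: quotient_alg_def A_RCOSETS_def' a_r_coset_def' rcoset_mult_def set_add_def' fun_eq_iff)

context leibniz_algebra
begin

section \<open>Biderivations\<close>

lemma biderivationD:
  assumes "biderivation F L (d, D')"
  shows "\<And>x. x \<in> carrier L \<Longrightarrow> d x \<in> carrier L" "\<And>x. x \<in> carrier L \<Longrightarrow> D' x \<in> carrier L"
    "\<And>x y. x \<in> carrier L \<Longrightarrow> y \<in> carrier L \<Longrightarrow> d (x \<oplus> y) = d x \<oplus> d y"
    "\<And>x y. x \<in> carrier L \<Longrightarrow> y \<in> carrier L \<Longrightarrow> D' (x \<oplus> y) = D' x \<oplus> D' y"
    "\<And>c x. c \<in> carrier F \<Longrightarrow> x \<in> carrier L \<Longrightarrow> d (c \<odot> x) = c \<odot> d x"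
    "\<And>c x. c \<in> carrier F \<Longrightarrow> x \<in> carrier L \<Longrightarrow> D' (c \<odot> x) = c \<odot> D' x"
    "\<And>x y. x \<in> carrier L \<Longrightarrow> y \<in> carrier L \<Longrightarrow> d (x \<otimes> y) = d x \<otimes> y \<oplus> x \<otimes> d y"
    "\<And>x y. x \<in> carrier L \<Longrightarrow> y \<in> carrier L \<Longrightarrow> D' (x \<otimes> y) = x \<otimes> D' y \<ominus> y \<otimes> D' x"
    "\<And>x y. x \<in> carrier L \<Longrightarrow> y \<in> carrier L \<Longrightarrow> d x \<otimes> y = D' x \<otimes> y"
  using assms by (auto simp: biderivation_def derivation_def antiderivation_def module_hom_def)

text \<open>The second component of the inner biderivation of a is x \<mapsto> - xa, whence the plus
  sign. The compatibility of the two components comes from (ax)y = - (xa)y, a consequence of the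
  Leibniz identity.\<close>

lemma biderivation_minus_inner:
  assumes b: "biderivation F L (d, D')" and a: "a \<in> carrier L"
  shows "biderivation F L (\<lambda>x. d x \<ominus> a \<otimes> x, \<lambda>x. D' x \<oplus> x \<otimes> a)"
proof -
  note b = biderivationD[OF b]
  note [simp] = b(1,2) a mult_closed
  have 1: "d (x \<oplus> y) \<ominus> a \<otimes> (x \<oplus> y) = (d x \<ominus> a \<otimes> x) \<oplus> (d y \<ominus> a \<otimes> y)"
    if xy: "x \<in> carrier L" "y \<in> carrier L" for x y
  proof -
    have c: "d x \<in> carrier L" "d y \<in> carrier L" "a \<otimes> x \<in> carrier L" "a \<otimes> y \<in> carrier L" using xy by auto
    show ?thesis unfolding b(3)[OF xy] mult_add_right[OF a xy] using c by algebra
  qed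
  have 2: "d (c \<odot> x) \<ominus> a \<otimes> (c \<odot> x) = c \<odot> (d x \<ominus> a \<otimes> x)"
    if "c \<in> carrier F" "x \<in> carrier L" for c x
    using that by (simp add: b(5) mult_smult_right M.minus_eq smult_r_distr smult_r_minus)
  have 3: "d (x \<otimes> y) \<ominus> a \<otimes> (x \<otimes> y) = (d x \<ominus> a \<otimes> x) \<otimes> y \<oplus> x \<otimes> (d y \<ominus> a \<otimes> y)"
    if xy: "x \<in> carrier L" "y \<in> carrier L" for x y
  proof -
    define p q s t where "p = d x \<otimes> y" and "q = x \<otimes> d y" and "s = (a \<otimes> x) \<otimes> y" and "t = x \<otimes> (a \<otimes> y)"
    have c: "p \<in> carrier L" "q \<in> carrier L" "s \<in> carrier L" "t \<in> carrier L"
      using xy by (auto simp: p_def q_def s_def t_def)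
    have "(p \<oplus> q) \<ominus> (s \<oplus> t) = (p \<ominus> s) \<oplus> (q \<ominus> t)" using c by algebra
    then show ?thesis
      using xy leibniz[OF a xy] by (simp add: b(7) mult_minus p_def q_def s_def t_def)
  qed
  have 4: "D' (x \<oplus> y) \<oplus> (x \<oplus> y) \<otimes> a = (D' x \<oplus> x \<otimes> a) \<oplus> (D' y \<oplus> y \<otimes> a)"
    if "x \<in> carrier L" "y \<in> carrier L" for x y
    using that by (simp add: b(4) mult_add_left M.a_ac)
  have 5: "D' (c \<odot> x) \<oplus> (c \<odot> x) \<otimes> a = c \<odot> (D' x \<oplus> x \<otimes> a)"
    if "c \<in> carrier F" "x \<in> carrier L" for c x
    using that by (simp add: b(6) mult_smult_left smult_r_distr)
  have 6: "D' (x \<otimes> y) \<oplus> (x \<otimes> y) \<otimes> a = x \<otimes> (D' y \<oplus> y \<otimes> a) \<ominus> y \<otimes> (D' x \<oplus> x \<otimes> a)"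
    if xy: "x \<in> carrier L" "y \<in> carrier L" for x y
  proof -
    define p q s t where "p = x \<otimes> D' y" and "q = y \<otimes> D' x" and "s = x \<otimes> (y \<otimes> a)" and "t = y \<otimes> (x \<otimes> a)"
    have c: "p \<in> carrier L" "q \<in> carrier L" "s \<in> carrier L" "t \<in> carrier L"
      using xy by (auto simp: p_def q_def s_def t_def)
    have "(p \<ominus> q) \<oplus> (s \<ominus> t) = (p \<oplus> s) \<ominus> (q \<oplus> t)" using c by algebra
    then show ?thesis
      using xy leibniz_right[OF xy a] by (simp add: b(8) mult_add_right p_def q_def s_def t_def)
  qed
  have 7: "(d x \<ominus> a \<otimes> x) \<otimes> y = (D' x \<oplus> x \<otimes> a) \<otimes> y" if xy: "x \<in> carrier L" "y \<in> carrier L" for x y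
  proof -
    define p s t where "p = D' x \<otimes> y" and "s = a \<otimes> (x \<otimes> y)" and "t = x \<otimes> (a \<otimes> y)"
    have c: "p \<in> carrier L" "s \<in> carrier L" "t \<in> carrier L" using xy by (auto simp: p_def s_def t_def)
    have "p \<ominus> (s \<ominus> t) = p \<oplus> (t \<ominus> s)" using c by algebra
    then show ?thesis
      using xy leibniz_right[OF a xy] leibniz_right[OF xy(1) a xy(2)]
      by (simp add: b(9) mult_minus mult_add_left p_def s_def t_def)
  qed
  show ?thesis
    unfolding biderivation_def derivation_def antiderivation_def module_hom_def
    using 1 2 3 4 5 6 7 by simp
qed

end

section \<open>The projector and its maximality modulo ideals\<close>

locale projector_setup = leibniz_algebra F L + schunck_formation_class F \<HH>
  for F :: "('f, 'm) ring_scheme" and L :: "('f, 'a) module" (structure) and \<HH> :: "'f alg_class" +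
  fixes H assumes solL: "soluble_leibniz F L" and proj: "projector F \<HH> L H"
begin

lemma subH: "subalgebra F L H"
  using proj by (simp add: projector_def)

lemma sH: "subspace F H L"
  using subH by (simp add: subalgebra_def)

lemmas h = subspaceD[OF sH]

lemma H_mult: "x \<in> H \<Longrightarrow> y \<in> H \<Longrightarrow> x \<otimes> y \<in> H"
  using subH by (simp add: subalgebra_def)

lemma HK_inq:
  assumes K: "alg_ideal F L K"
  shows "inq (L\<lparr>carrier := H <+>\<^bsub>L\<^esub> K\<rparr>) K"
  using proj K unfolding projector_def class_maximal_def quotient_image_def quotient_restrict by blast

text \<open>The image of U competes with (H + K)/K among the subalgebras of L/K in the class;
  equality of the images pulls back to L because H + K contains K.\<close>

lemma H_maximal:
  assumes K: "alg_ideal F L K" and U: "subalgebra F L U" "H <+>\<^bsub>L\<^esub> K \<subseteq> U"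
    and q: "inq (L\<lparr>carrier := U\<rparr>) K"
  shows "U \<subseteq> H <+>\<^bsub>L\<^esub> K"
proof -
  interpret A: alg_with_ideal F L K using leibniz_algebra_axioms K by (rule alg_with_idealI)
  have sU: "subspace F U L" using U(1) by (simp add: subalgebra_def)
  have "subspace F (A.q ` U) A.Q"
    by (rule alg_hom_image_subspace[OF leibniz_algebra_axioms A.quotient_leibniz A.q_hom sU])
  moreover have "X \<otimes>\<^bsub>A.Q\<^esub> Y \<in> A.q ` U" if XY: "X \<in> A.q ` U" "Y \<in> A.q ` U" for X Y
  proof -
    obtain x y where xy: "X = A.q x" "x \<in> U" "Y = A.q y" "y \<in> U" using XY by blast
    then have "x \<otimes> y \<in> U" using U(1) by (simp add: subalgebra_def)
    moreover have "A.q (x \<otimes> y) = X \<otimes>\<^bsub>A.Q\<^esub> Y"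
      unfolding xy using alg_homD(3)[OF A.q_hom] xy subspaceD(3)[OF sU] by blast
    ultimately show ?thesis by (metis imageI)
  qed
  ultimately have sa: "subalgebra F A.Q (A.q ` U)" by (simp add: subalgebra_def)
  have cm: "class_maximal F \<HH> A.Q (A.q ` (H <+>\<^bsub>L\<^esub> K))"
    using proj K unfolding projector_def quotient_image_def by blast
  have qU: "in_class F \<HH> (A.Q\<lparr>carrier := A.q ` U\<rparr>)" using q unfolding quotient_restrict .
  have "\<forall>V. subalgebra F A.Q V \<and> in_class F \<HH> (A.Q\<lparr>carrier := V\<rparr>) \<and> A.q ` (H <+>\<^bsub>L\<^esub> K) \<subseteq> V
      \<longrightarrow> V = A.q ` (H <+>\<^bsub>L\<^esub> K)"
    using cm unfolding class_maximal_def by (elim conjE)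
  then have eq: "A.q ` U = A.q ` (H <+>\<^bsub>L\<^esub> K)"
    by (elim allE[of _ "A.q ` U"] mp) (intro conjI sa qU image_mono[OF U(2)])
  have sHK: "subspace F (H <+>\<^bsub>L\<^esub> K) L" by (rule subspace_set_add[OF sH A.subK])
  show ?thesis
  proof
    fix u assume u: "u \<in> U"
    then obtain x where x: "x \<in> H <+>\<^bsub>L\<^esub> K" "A.q u = A.q x" using eq by blast
    have c: "u \<in> carrier L" "x \<in> carrier L" using u x subspaceD(3)[OF sU] subspaceD(3)[OF sHK] by auto
    then have "eqmod L K u x" using x A.q_eq by simp
    then show "u \<in> H <+>\<^bsub>L\<^esub> K"
      using eqmod_mem[OF A.subK _ sHK set_add_right[OF sH ideal_carrier[OF K]]] c x(1) by blast
  qed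
qed

abbreviation H_alg where "H_alg \<equiv> L\<lparr>carrier := H\<rparr>"

lemma H_alg_soluble: "soluble_leibniz F H_alg"
  by (rule restrict_soluble[OF solL subH])

lemma H_alg_leibniz: "leibniz_algebra F H_alg"
  by (rule solubleD[OF H_alg_soluble])

lemma H_alg_in_class: "in_class F \<HH> H_alg"
  using HK_inq[OF zero_ideal] in_class_iff_inq_zero[OF H_alg_leibniz] by (simp add: set_add_zero[OF h(1)])

lemma H_alg_inq: "inq H_alg {\<zero>}"
  using H_alg_in_class in_class_iff_inq_zero[OF H_alg_leibniz] by simp

text \<open>The bimodule is all of \<open>D i\<close>; the passage to the layer happens later, by
  working modulo a submodule that contains \<open>D (Suc i)\<close>. The split extension sets
  products of two elements of \<open>D i\<close> to zero, which agrees with L exactly modulo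
  \<open>D (Suc i)\<close>.\<close>

lemma derived_class_bimod: "class_bimod F H_alg (L\<lparr>carrier := D i\<rparr>) (\<otimes>) (\<otimes>) \<HH>"
proof -
  note iD = derived_ideal[of i]
  note c = subspaceD(3)[OF ideal_subspace[OF iD]]
  have vs: "vectorspace F (L\<lparr>carrier := D i\<rparr>)" by (rule subspace_is_vs[OF ideal_subspace[OF iD]])
  have "bimod F H_alg (L\<lparr>carrier := D i\<rparr>) (\<otimes>) (\<otimes>)"
  proof (intro bimod.intro bimod_axioms.intro H_alg_leibniz vs, goal_cases)
    case (11 x y v) then show ?case using leibniz[of x y v] h(3) c by simp
  next
    case (12 x y v) then show ?case using leibniz[of x v y] h(3) c by simp
  next
    case (13 x y v) then show ?case using leibniz[of v x y] h(3) c by simp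
  qed (use h(3) c ideal_mult[OF iD] in \<open>simp_all add: mult_add_left mult_add_right mult_smult_left mult_smult_right\<close>)
  then show ?thesis
    by (intro class_bimod.intro class_bimod_axioms.intro schunck_formation_class_axioms H_alg_soluble H_alg_in_class
        subspace_fin_dim[OF solubleD(2)[OF solL] ideal_subspace[OF iD]])
qed

text \<open>It is shown that X = H + U lies in the class modulo \<open>D (Suc i)\<close>; maximality
  of H then forces U into H + \<open>D (Suc i)\<close>. Take a primitive quotient X/J. If U lies in
  J, it is an image of H. If W lies in J, it is an image of the split extension of U/W. If neither
  does, U and W are abelian modulo J with equal image, and as W lies in H +
  \<open>D (Suc i)\<close>, X/J is again an image of H.\<close>

lemma central_layer_contradiction:
  assumes U: "subspace F U L" "U \<subseteq> D i" "\<And>x u. x \<in> H \<Longrightarrow> u \<in> U \<Longrightarrow> x \<otimes> u \<in> U \<and> u \<otimes> x \<in> U"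
    and WU: "D i \<inter> (H <+>\<^bsub>L\<^esub> D (Suc i)) \<subseteq> U"
    and cen: "inq (semidirect H_alg (L\<lparr>carrier := U\<rparr>) (\<otimes>) (\<otimes>)) ((D i \<inter> (H <+>\<^bsub>L\<^esub> D (Suc i))) \<times> {\<zero>})"
  shows "U \<subseteq> D i \<inter> (H <+>\<^bsub>L\<^esub> D (Suc i))"
proof -
  define A2 where "A2 = D (Suc i)"
  define G where "G = H <+>\<^bsub>L\<^esub> A2"
  define W where "W = D i \<inter> G"
  define X where "X = H <+>\<^bsub>L\<^esub> U"
  have i1: "alg_ideal F L (D i)" and i2: "alg_ideal F L A2" unfolding A2_def by (rule derived_ideal)+
  note s1 = subspaceD[OF ideal_subspace[OF i1]]
  note s2 = subspaceD[OF ideal_subspace[OF i2]]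
  note u = subspaceD[OF U(1)]
  have A21: "A2 \<subseteq> D i" unfolding A2_def by (rule derived_antimono_Suc)
  have sG: "subspace F G L" unfolding G_def by (rule subspace_set_add[OF sH ideal_subspace[OF i2]])
  have saG: "subalgebra F L G" unfolding G_def by (rule subalgebra_set_add[OF subH i2])
  have HG: "H \<subseteq> G" unfolding G_def by (rule set_add_left[OF ideal_subspace[OF i2] h(1)])
  have A2G: "A2 \<subseteq> G" unfolding G_def by (rule set_add_right[OF sH s2(1)])
  have A2W: "A2 \<subseteq> W" unfolding W_def using A21 A2G by blast
  have WU': "W \<subseteq> U" unfolding W_def G_def A2_def by (rule WU)
  have sW: "subspace F W L" unfolding W_def by (rule subspace_Int[OF ideal_subspace[OF i1] sG])
  note w = subspaceD[OF sW]
  have UU: "x \<otimes> y \<in> A2" if "x \<in> U" "y \<in> U" for x y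
    unfolding A2_def using that U(2) derived_mult by blast
  have HW: "x \<otimes> y \<in> W \<and> y \<otimes> x \<in> W" if "x \<in> H" "y \<in> W" for x y
  proof -
    have "x \<in> G" "y \<in> G" "x \<in> carrier L" "y \<in> D i" using that HG h(3) by (auto simp: W_def)
    then show ?thesis using saG ideal_mult[OF i1] by (auto simp: W_def subalgebra_def)
  qed
  have sX: "subspace F X L" unfolding X_def by (rule subspace_set_add[OF sH U(1)])
  have HX: "H \<subseteq> X" unfolding X_def by (rule set_add_left[OF U(1) h(1)])
  have UX: "U \<subseteq> X" unfolding X_def by (rule set_add_right[OF sH u(1)])
  have Xc: "\<exists>a\<in>H. \<exists>b\<in>U. x = a \<oplus> b" if "x \<in> X" for x using that by (simp add: X_def set_add_iff)
  have X_mult: "x \<otimes> y \<in> T \<and> y \<otimes> x \<in> T"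
    if T: "subspace F T L" "\<And>a t. a \<in> H \<Longrightarrow> t \<in> T \<Longrightarrow> a \<otimes> t \<in> T \<and> t \<otimes> a \<in> T" "T \<subseteq> U" "A2 \<subseteq> T"
      and x: "x \<in> X" and y: "y \<in> T" for T x y
  proof -
    obtain a b where ab: "a \<in> H" "b \<in> U" "x = a \<oplus> b" using Xc[OF x] by blast
    have c: "a \<in> carrier L" "b \<in> carrier L" "y \<in> carrier L"
      using ab h(3) u(3) subspaceD(3)[OF T(1)] y by auto
    have "b \<otimes> y \<in> T" "y \<otimes> b \<in> T" using UU[OF ab(2)] UU[OF _ ab(2)] y T(3,4) by blast+
    then show ?thesis
      using T(2)[OF ab(1) y] subspaceD(4)[OF T(1)] c ab(3) by (simp add: mult_add_left mult_add_right)
  qed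
  have UX_mult: "x \<otimes> y \<in> U \<and> y \<otimes> x \<in> U" if "x \<in> X" "y \<in> U" for x y
    by (rule X_mult[OF U(1,3)]) (use that A2W WU' in auto)
  have saX: "subalgebra F L X"
  proof -
    have "x \<otimes> y \<in> X" if x: "x \<in> X" and y: "y \<in> X" for x y
    proof -
      obtain a b where ab: "a \<in> H" "b \<in> U" "y = a \<oplus> b" using Xc[OF y] by blast
      obtain a' b' where ab': "a' \<in> H" "b' \<in> U" "x = a' \<oplus> b'" using Xc[OF x] by blast
      note c = h(3)[OF ab(1)] u(3)[OF ab(2)] h(3)[OF ab'(1)] u(3)[OF ab'(2)] subspaceD(3)[OF sX x]
      have "x \<otimes> y = x \<otimes> a \<oplus> x \<otimes> b" using ab(3) c by (simp add: mult_add_right)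
      also have "x \<otimes> a = a' \<otimes> a \<oplus> b' \<otimes> a" using ab'(3) c by (simp add: mult_add_left)
      finally show ?thesis
        using H_mult[OF ab'(1) ab(1)] HX UX U(3)[OF ab(1) ab'(2)] UX_mult[OF x ab(2)] subspaceD(4)[OF sX]
        by (metis subsetD)
    qed
    then show ?thesis using sX by (simp add: subalgebra_def)
  qed
  define LX where "LX = L\<lparr>carrier := X\<rparr>"
  have LXs: "soluble_leibniz F LX" unfolding LX_def by (rule restrict_soluble[OF solL saX])
  have LXl: "leibniz_algebra F LX" by (rule solubleD[OF LXs])
  interpret LX: leibniz_algebra F LX by (rule LXl)
  have LX_ops: "carrier LX = X" "x \<oplus>\<^bsub>LX\<^esub> y = x \<oplus> y" "x \<otimes>\<^bsub>LX\<^esub> y = x \<otimes> y" "c \<odot>\<^bsub>LX\<^esub> x = c \<odot> x" for x y c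
    by (simp_all add: LX_def)
  have idealX: "alg_ideal F LX T"
    if "subspace F T L" "T \<subseteq> X" "\<And>x y. x \<in> X \<Longrightarrow> y \<in> T \<Longrightarrow> x \<otimes> y \<in> T \<and> y \<otimes> x \<in> T" for T
    unfolding LX_def ideal_restrict_iff[OF sX] using that by blast
  have iA2: "alg_ideal F LX A2"
    by (rule idealX) (use ideal_subspace[OF i2] A2W WU' UX ideal_mult[OF i2] subspaceD(3)[OF sX] in auto)
  have iU: "alg_ideal F LX U" by (rule idealX[OF U(1) UX UX_mult])
  have iW: "alg_ideal F LX W"
  proof (rule idealX[OF sW])
    show "W \<subseteq> X" using WU' UX by blast
    show "x \<otimes> y \<in> W \<and> y \<otimes> x \<in> W" if "x \<in> X" "y \<in> W" for x y
      by (rule X_mult[OF sW HW WU' A2W that])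
  qed
  have inqX: "inq LX A2"
  proof (rule inqI_primitive[OF LXs iA2])
    fix J assume J: "alg_ideal F LX J" "A2 \<subseteq> J" "prim_quot F LX J"
    note sJ = LX.ideal_subspace[OF J(1)]
    note j = LX.subspaceD[OF sJ]
    have em: "eqmod LX J x y \<longleftrightarrow> x \<ominus> y \<in> J" if "x \<in> X" "y \<in> X" for x y
      unfolding LX_def restrict_eqmod[OF sX that] by (simp add: eqmod_def)
    \<comment> \<open>Two of the three cases end here: when H alone covers X/J, that quotient is an
      image of a member of the class.\<close>
    have from_H: "inq LX J" if onto: "\<And>x. x \<in> X \<Longrightarrow> \<exists>a\<in>H. eqmod LX J x a"
    proof (rule inq_transfer[OF H_alg_leibniz LXl leibniz_algebra.zero_ideal[OF H_alg_leibniz] J(1)])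
      have "(\<lambda>x. x) \<in> alg_hom F H_alg LX" by (rule alg_homI) (use HX in \<open>auto simp: LX_ops\<close>)
      then show "hom_mod F H_alg LX J (\<lambda>x. x)" by (rule hom_hom_mod[OF LXl J(1)])
      show "\<exists>x\<in>carrier H_alg. eqmod LX J y x" if "y \<in> carrier LX" for y
        using onto[of y] that by (simp add: LX_ops)
      show "inq H_alg {\<zero>\<^bsub>H_alg\<^esub>}" using H_alg_inq by simp
      show "x \<in> J" if "x \<in> {\<zero>\<^bsub>H_alg\<^esub>}" for x using that j(2) by (simp add: LX_def)
    qed
    have prod: "x \<otimes>\<^bsub>LX\<^esub> y \<in> J" if "x \<in> U" "y \<in> U" for x y using UU[OF that] J(2) by (auto simp: LX_ops)
    consider "U \<subseteq> J" | "W \<subseteq> J" | "\<not> U \<subseteq> J" "\<not> W \<subseteq> J" by blast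
    then show "inq LX J"
    proof cases
      case 1
      show ?thesis
      proof (rule from_H)
        fix x assume x: "x \<in> X"
        then obtain a b where ab: "a \<in> H" "b \<in> U" "x = a \<oplus> b" using Xc by blast
        note c = h(3)[OF ab(1)] u(3)[OF ab(2)]
        have "(a \<oplus> b) \<ominus> a = b" using c by algebra
        then have "eqmod LX J x a" using em[OF x, of a] ab 1 HX by auto
        then show "\<exists>a\<in>H. eqmod LX J x a" using ab(1) by blast
      qed
    next
      case 2
      interpret B: class_bimod F H_alg "L\<lparr>carrier := D i\<rparr>" "(\<otimes>)" "(\<otimes>)" \<HH> by (rule derived_class_bimod)
      have smU: "B.submod U" unfolding B.submod_def
        using U by (simp add: subspace_restrict_iff[OF ideal_subspace[OF i1]])
      have smW: "B.submod W" unfolding B.submod_def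
        using sW HW by (simp add: subspace_restrict_iff[OF ideal_subspace[OF i1]]) (simp add: W_def)
      have iWU: "alg_ideal F (semidirect H_alg (L\<lparr>carrier := U\<rparr>) (\<otimes>) (\<otimes>)) (W \<times> {\<zero>})"
        using B.SDU_ideal[OF smU smW WU'] by simp
      have SDl: "leibniz_algebra F (semidirect H_alg (L\<lparr>carrier := U\<rparr>) (\<otimes>) (\<otimes>))"
        using B.SDU_leibniz[OF smU] by simp
      define \<phi> where "\<phi> = (\<lambda>(b, a). a \<oplus> b)"
      have inX: "a \<oplus> b \<in> X" if "a \<in> H" "b \<in> U" for a b using that by (auto simp: X_def set_addI)
      show ?thesis
      proof (rule inq_transfer[OF SDl LXl iWU J(1)])
        show "hom_mod F (semidirect H_alg (L\<lparr>carrier := U\<rparr>) (\<otimes>) (\<otimes>)) LX J \<phi>"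
          unfolding hom_mod_def
        proof (intro conjI ballI)
          fix z assume "z \<in> carrier (semidirect H_alg (L\<lparr>carrier := U\<rparr>) (\<otimes>) (\<otimes>))"
          then show "\<phi> z \<in> carrier LX" using inX by (auto simp: \<phi>_def LX_ops)
        next
          fix z z' assume z: "z \<in> carrier (semidirect H_alg (L\<lparr>carrier := U\<rparr>) (\<otimes>) (\<otimes>))"
            and z': "z' \<in> carrier (semidirect H_alg (L\<lparr>carrier := U\<rparr>) (\<otimes>) (\<otimes>))"
          obtain b a where ab: "z = (b, a)" "b \<in> U" "a \<in> H" using z by auto
          obtain b' a' where ab': "z' = (b', a')" "b' \<in> U" "a' \<in> H" using z' by auto
          note c = u(3)[OF ab(2)] h(3)[OF ab(3)] u(3)[OF ab'(2)] h(3)[OF ab'(3)]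
          have "(a \<oplus> a') \<oplus> (b \<oplus> b') = (a \<oplus> b) \<oplus> (a' \<oplus> b')" using c by (simp add: M.a_ac)
          moreover have "(a \<oplus> a') \<oplus> (b \<oplus> b') \<in> X" using inX ab ab' h(4) u(4) by simp
          ultimately show "eqmod LX J (\<phi> (z \<oplus>\<^bsub>semidirect H_alg (L\<lparr>carrier := U\<rparr>) (\<otimes>) (\<otimes>)\<^esub> z')) (\<phi> z \<oplus>\<^bsub>LX\<^esub> \<phi> z')"
            using ab ab' LX.eqmod_refl[OF sJ] by (simp add: \<phi>_def LX_ops)
          define p q where "p = a \<otimes> a' \<oplus> (b \<otimes> a' \<oplus> a \<otimes> b')" and "q = b \<otimes> b'"
          have q: "q \<in> J" unfolding q_def using UU[OF ab(2) ab'(2)] J(2) by blast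
          have pX: "p \<in> X" unfolding p_def
            using inX H_mult[OF ab(3) ab'(3)] U(3)[OF ab'(3) ab(2)] U(3)[OF ab(3) ab'(2)] u(4) by blast
          have qX: "q \<in> X" unfolding q_def using UU[OF ab(2) ab'(2)] A2W WU' UX by blast
          have pq: "p \<in> carrier L" "q \<in> carrier L" using pX qX subspaceD(3)[OF sX] by auto
          have "(a \<oplus> b) \<otimes> (a' \<oplus> b') = p \<oplus> q"
            using c mult_closed by (simp add: p_def q_def mult_add_left mult_add_right M.a_ac)
          moreover have "p \<ominus> (p \<oplus> q) = \<ominus> q" using pq by algebra
          moreover have "\<ominus> q \<in> J" using j(6)[OF q] restrict_uminus[OF sX qX] by (simp add: LX_def)
          moreover have "p \<oplus> q \<in> X" using pX qX subspaceD(4)[OF sX] by blast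
          ultimately have "eqmod LX J p ((a \<oplus> b) \<otimes> (a' \<oplus> b'))" using em[OF pX] by simp
          then show "eqmod LX J (\<phi> (z \<otimes>\<^bsub>semidirect H_alg (L\<lparr>carrier := U\<rparr>) (\<otimes>) (\<otimes>)\<^esub> z')) (\<phi> z \<otimes>\<^bsub>LX\<^esub> \<phi> z')"
            using ab ab' by (simp add: \<phi>_def LX_ops p_def)
        next
          fix k z assume k: "k \<in> carrier F" and z: "z \<in> carrier (semidirect H_alg (L\<lparr>carrier := U\<rparr>) (\<otimes>) (\<otimes>))"
          obtain b a where ab: "z = (b, a)" "b \<in> U" "a \<in> H" using z by auto
          have "k \<odot> a \<oplus> k \<odot> b = k \<odot> (a \<oplus> b)" using k h(3)[OF ab(3)] u(3)[OF ab(2)] by (simp add: smult_r_distr)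
          moreover have "k \<odot> a \<oplus> k \<odot> b \<in> X" using inX ab k h(5) u(5) by simp
          ultimately show "eqmod LX J (\<phi> (k \<odot>\<^bsub>semidirect H_alg (L\<lparr>carrier := U\<rparr>) (\<otimes>) (\<otimes>)\<^esub> z)) (k \<odot>\<^bsub>LX\<^esub> \<phi> z)"
            using ab LX.eqmod_refl[OF sJ] by (simp add: \<phi>_def LX_ops)
        qed
        show "\<phi> z \<in> J" if "z \<in> W \<times> {\<zero>}" for z
          using that 2 w(3) by (auto simp: \<phi>_def)
        show "\<exists>z\<in>carrier (semidirect H_alg (L\<lparr>carrier := U\<rparr>) (\<otimes>) (\<otimes>)). eqmod LX J x (\<phi> z)" if x: "x \<in> carrier LX" for x
        proof -
          obtain a b where ab: "a \<in> H" "b \<in> U" "x = a \<oplus> b"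
            using Xc[of x] x unfolding LX_ops(1) by blast
          then have "eqmod LX J x (\<phi> (b, a))" using LX.eqmod_refl[OF sJ x] by (simp add: \<phi>_def)
          then show ?thesis using ab by (intro bexI[of _ "(b, a)"]) simp_all
        qed
        show "inq (semidirect H_alg (L\<lparr>carrier := U\<rparr>) (\<otimes>) (\<otimes>)) (W \<times> {\<zero>})"
          using cen by (simp add: W_def G_def A2_def)
      qed
    next
      case 3
      have prodW: "x \<otimes>\<^bsub>LX\<^esub> y \<in> J" if "x \<in> W" "y \<in> W" for x y by (rule prod) (use that WU' in auto)
      show ?thesis
      proof (rule from_H)
        fix x assume x: "x \<in> X"
        then obtain a b where ab: "a \<in> H" "b \<in> U" "x = a \<oplus> b" using Xc by blast
        \<comment> \<open>The socle argument exchanges b for an element of W, and W lies in H + A2,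
          so modulo J the component b can be replaced by an element of H.\<close>
        obtain v where v: "v \<in> W" "eqmod LX J b v"
          using LX.prim_quot_socle[OF J(1,3) iW 3(2) prodW iU 3(1) prod ab(2)] by blast
        have "v \<in> G" using v(1) by (simp add: W_def)
        then obtain a' t where t: "a' \<in> H" "t \<in> A2" "v = a' \<oplus> t" by (auto simp: G_def set_add_iff)
        have vX: "v \<in> X" and bX: "b \<in> X" and tX: "t \<in> X" using v t ab WU' UX A2W by auto
        note c = h(3)[OF ab(1)] u(3)[OF ab(2)] h(3)[OF t(1)] s2(3)[OF t(2)]
        have vc: "v \<in> carrier L" using c t(3) by simp
        have "(a \<oplus> b) \<ominus> (a \<oplus> a') = (b \<ominus> v) \<oplus> t" unfolding t(3) using c by algebra
        moreover have "b \<ominus> v \<in> J" using v(2) em[OF bX vX] by simp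
        then have "(b \<ominus> v) \<oplus> t \<in> J" using j(4)[of "b \<ominus> v" t] t(2) J(2) by (auto simp: LX_ops)
        moreover have "a \<oplus> a' \<in> X" using h(4)[OF ab(1) t(1)] HX by blast
        ultimately have "eqmod LX J x (a \<oplus> a')" using em[OF x] ab(3) by simp
        then show "\<exists>a\<in>H. eqmod LX J x a" using h(4)[OF ab(1) t(1)] by blast
      qed
    qed
  qed
  have "G \<subseteq> X"
  proof
    fix x assume "x \<in> G"
    then obtain a t where "a \<in> H" "t \<in> A2" "x = a \<oplus> t" by (auto simp: G_def set_add_iff)
    then show "x \<in> X" using A2W WU' by (auto simp: X_def intro: set_addI)
  qed
  then have "X \<subseteq> G" using H_maximal[OF i2 saX] inqX by (simp add: G_def LX_def)
  then show ?thesis using UX U(2) unfolding G_def A2_def by blast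
qed

section \<open>Correcting a biderivation on one layer\<close>

context
  fixes i :: nat
begin

abbreviation "A1 \<equiv> D i"
abbreviation "G2 \<equiv> H <+>\<^bsub>L\<^esub> D (Suc i)"
abbreviation "W0 \<equiv> D i \<inter> (H <+>\<^bsub>L\<^esub> D (Suc i))"

interpretation B: class_bimod F H_alg "L\<lparr>carrier := D i\<rparr>" "(\<otimes>)" "(\<otimes>)" \<HH>
  by (rule derived_class_bimod)

lemma A1_ideal: "alg_ideal F L A1"
  by (rule derived_ideal)

lemmas A1_sub = ideal_subspace[OF A1_ideal]
lemmas a1 = subspaceD[OF A1_sub]

lemma G2_sub: "subspace F G2 L"
  by (rule subspace_set_add[OF sH ideal_subspace[OF derived_ideal]])

lemmas g2 = subspaceD[OF G2_sub]

lemma G2_subalgebra: "subalgebra F L G2"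
  by (rule subalgebra_set_add[OF subH derived_ideal])

lemma G2_mult: "x \<in> G2 \<Longrightarrow> y \<in> G2 \<Longrightarrow> x \<otimes> y \<in> G2"
  using G2_subalgebra by (simp add: subalgebra_def)

lemma H_G2: "H \<subseteq> G2"
  by (rule set_add_left[OF ideal_subspace[OF derived_ideal] h(1)])

lemma layer_central_free: "B.central_free W0"
  unfolding B.central_free_def
proof (intro conjI allI impI)
  have "subspace F W0 L" by (rule subspace_Int[OF A1_sub G2_sub])
  then show "B.submod W0"
    unfolding B.submod_def subspace_restrict_iff[OF A1_sub]
    using ideal_mult[OF A1_ideal] G2_mult H_G2 h(3) by auto
  fix U assume U: "B.submod U \<and> W0 \<subset> U"
  then have *: "subspace F U L" "U \<subseteq> A1" "\<And>x u. x \<in> H \<Longrightarrow> u \<in> U \<Longrightarrow> x \<otimes> u \<in> U \<and> u \<otimes> x \<in> U"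
    unfolding B.submod_def subspace_restrict_iff[OF A1_sub] by auto
  show "\<not> B.central U W0"
    using central_layer_contradiction[OF *] U unfolding B.central_def by auto
qed

text \<open>Elements of \<open>D i\<close> that differ by an element of H differ by one of H
  \<inter> \<open>D i\<close>, which lies in W0. Congruences may therefore be computed modulo H in L
  and then read in the bimodule.\<close>

lemma W0_eqmod:
  assumes "x \<in> A1" "y \<in> A1" "eqmod L H x y"
  shows "eqmod (L\<lparr>carrier := A1\<rparr>) W0 x y"
  using assms a1(7) H_G2 unfolding restrict_eqmod[OF A1_sub assms(1,2)] by (auto simp: eqmod_def)

text \<open>g picks a \<open>D i\<close>-component of f. The choice is free up to H \<inter>
  \<open>D i\<close>, so neither linearity nor the cocycle identity holds exactly; they hold modulo
  W0, which is what \<open>cocycle\<close> asks for.\<close>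

lemma layer_part:
  assumes f: "\<And>x. x \<in> H \<Longrightarrow> f x \<in> H <+>\<^bsub>L\<^esub> A1"
  shows "\<exists>g. \<forall>x\<in>H. g x \<in> A1 \<and> eqmod L H (f x) (g x)"
proof -
  have "\<exists>b. b \<in> A1 \<and> eqmod L H (f x) b" if x: "x \<in> H" for x
  proof -
    obtain a b where ab: "a \<in> H" "b \<in> A1" "f x = a \<oplus> b" using f[OF x] by (auto simp: set_add_iff)
    have c: "a \<in> carrier L" "b \<in> carrier L" using h(3) a1(3) ab by auto
    have "(a \<oplus> b) \<ominus> b = a" using c by algebra
    then show ?thesis using ab by (auto simp: eqmod_def)
  qed
  then show ?thesis by metis
qed

text \<open>The \<open>D i\<close>-component of d on H is a cocycle modulo W0 because d is a
  derivation and its H-component contributes only elements of H. The module is central-free, so the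
  cocycle is v acting from the left.\<close>

lemma left_layer:
  assumes b: "biderivation F L (d, D')" and dH: "\<And>x. x \<in> H \<Longrightarrow> d x \<in> H <+>\<^bsub>L\<^esub> A1"
  shows "\<exists>v\<in>A1. \<forall>x\<in>H. d x \<ominus> v \<otimes> x \<in> G2"
proof -
  note b = biderivationD[OF b]
  obtain f where f: "\<And>x. x \<in> H \<Longrightarrow> f x \<in> A1" "\<And>x. x \<in> H \<Longrightarrow> eqmod L H (d x) (f x)"
    using layer_part[of d] dH by blast
  have fc: "f x \<in> carrier L" "d x \<in> carrier L" "x \<in> carrier L" if "x \<in> H" for x
    using f(1)[OF that] a1(3) b(1) h(3)[OF that] by auto
  have f': "eqmod L H (f x) (d x)" if "x \<in> H" for x
    using eqmod_sym[OF sH f(2)[OF that]] fc[OF that] by simp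
  have "B.cocycle W0 f"
    unfolding B.cocycle_def
  proof (intro conjI ballI)
    fix x assume "x \<in> carrier H_alg"
    then show "f x \<in> carrier (L\<lparr>carrier := A1\<rparr>)" using f(1) by simp
  next
    fix x y assume "x \<in> carrier H_alg" "y \<in> carrier H_alg"
    then have xy: "x \<in> H" "y \<in> H" by auto
    note c = fc[OF xy(1)] fc[OF xy(2)]
    have "eqmod L H (f (x \<oplus> y)) (f x \<oplus> f y)"
    proof (rule eqmod_trans[OF sH f'[OF h(4)[OF xy]]])
      show "eqmod L H (d (x \<oplus> y)) (f x \<oplus> f y)"
        unfolding b(3)[OF c(3,6)] by (rule eqmod_add[OF sH f(2)[OF xy(1)] f(2)[OF xy(2)]]) (use c in simp_all)
    qed (use c fc[OF h(4)[OF xy]] in simp_all)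
    then show "eqmod (L\<lparr>carrier := A1\<rparr>) W0 (f (x \<oplus>\<^bsub>H_alg\<^esub> y)) (f x \<oplus>\<^bsub>L\<lparr>carrier := A1\<rparr>\<^esub> f y)"
      using W0_eqmod f(1) h(4) a1(4) xy by simp
    \<comment> \<open>Since d x - f x lies in H, multiplying it by y stays in H, and likewise on the
      other side.\<close>
    have m: "eqmod L H (d x \<otimes> y) (f x \<otimes> y)" "eqmod L H (x \<otimes> d y) (x \<otimes> f y)"
      using f(2)[OF xy(1)] f(2)[OF xy(2)] H_mult xy c by (simp_all add: eqmod_def mult_minus[symmetric])
    have "eqmod L H (f (x \<otimes> y)) (f x \<otimes> y \<oplus> x \<otimes> f y)"
    proof (rule eqmod_trans[OF sH f'[OF H_mult[OF xy]]])
      show "eqmod L H (d (x \<otimes> y)) (f x \<otimes> y \<oplus> x \<otimes> f y)"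
        unfolding b(7)[OF c(3,6)] by (rule eqmod_add[OF sH m]) (use c mult_closed in simp_all)
    qed (use c fc[OF H_mult[OF xy]] mult_closed in simp_all)
    then show "eqmod (L\<lparr>carrier := A1\<rparr>) W0 (f (x \<otimes>\<^bsub>H_alg\<^esub> y)) (f x \<otimes> y \<oplus>\<^bsub>L\<lparr>carrier := A1\<rparr>\<^esub> x \<otimes> f y)"
      using W0_eqmod f(1) H_mult a1(4) ideal_mult[OF A1_ideal] xy c by simp
  next
    fix k x assume k: "k \<in> carrier F" and "x \<in> carrier H_alg"
    then have x: "x \<in> H" by auto
    note c = fc[OF x]
    have "eqmod L H (f (k \<odot> x)) (k \<odot> f x)"
    proof (rule eqmod_trans[OF sH f'[OF h(5)[OF k x]]])
      show "eqmod L H (d (k \<odot> x)) (k \<odot> f x)"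
        unfolding b(5)[OF k c(3)] by (rule eqmod_smult[OF sH f(2)[OF x] k]) (use c in simp_all)
    qed (use c k fc[OF h(5)[OF k x]] in simp_all)
    then show "eqmod (L\<lparr>carrier := A1\<rparr>) W0 (f (k \<odot>\<^bsub>H_alg\<^esub> x)) (k \<odot>\<^bsub>L\<lparr>carrier := A1\<rparr>\<^esub> f x)"
      using W0_eqmod f(1) h(5) a1(5) k x by simp
  qed
  then have "\<exists>v\<in>carrier (L\<lparr>carrier := A1\<rparr>). \<forall>x\<in>carrier H_alg. eqmod (L\<lparr>carrier := A1\<rparr>) W0 (f x) (v \<otimes> x)"
    by (rule B.cocycle_inner[OF layer_central_free])
  then obtain v where v: "v \<in> A1" "\<And>x. x \<in> H \<Longrightarrow> eqmod (L\<lparr>carrier := A1\<rparr>) W0 (f x) (v \<otimes> x)" by auto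
  have "d x \<ominus> v \<otimes> x \<in> G2" if x: "x \<in> H" for x
  proof -
    note c = fc[OF x]
    have vx: "v \<otimes> x \<in> A1" "v \<otimes> x \<in> carrier L" using ideal_mult[OF A1_ideal] v(1) c a1(3) mult_closed by auto
    have "f x \<ominus> v \<otimes> x \<in> G2" using v(2)[OF x] unfolding restrict_eqmod[OF A1_sub f(1)[OF x] vx(1)] by (simp add: eqmod_def)
    moreover have "d x \<ominus> f x \<in> G2" using f(2)[OF x] H_G2 by (auto simp: eqmod_def)
    moreover have "d x \<ominus> v \<otimes> x = (d x \<ominus> f x) \<oplus> (f x \<ominus> v \<otimes> x)"
      using c vx by algebra
    ultimately show ?thesis using g2(4) by simp
  qed
  then show ?thesis using v(1) by blast
qed

text \<open>With d(H) already in \<open>G2\<close>, the identity d(x)y = D'(x)y shows that the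
  \<open>D i\<close>-component of D' has zero right action modulo W0, as
  \<open>anticocycle_inner\<close> requires. That w has zero right action modulo W0 is kept in the
  conclusion: it protects d when w is subtracted.\<close>

lemma right_layer:
  assumes b: "biderivation F L (d, D')" and dH: "\<And>x. x \<in> H \<Longrightarrow> d x \<in> G2"
    and DH: "\<And>x. x \<in> H \<Longrightarrow> D' x \<in> H <+>\<^bsub>L\<^esub> A1"
  shows "\<exists>w\<in>A1. \<forall>x\<in>H. w \<otimes> x \<in> G2 \<and> D' x \<oplus> x \<otimes> w \<in> G2"
proof -
  note b = biderivationD[OF b]
  obtain g where g: "\<And>x. x \<in> H \<Longrightarrow> g x \<in> A1" "\<And>x. x \<in> H \<Longrightarrow> eqmod L H (D' x) (g x)"
    using layer_part[of D'] DH by blast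
  have gc: "g x \<in> carrier L" "D' x \<in> carrier L" "x \<in> carrier L" if "x \<in> H" for x
    using g(1)[OF that] a1(3) b(2) h(3)[OF that] by auto
  have g': "eqmod L H (g x) (D' x)" if "x \<in> H" for x
    using eqmod_sym[OF sH g(2)[OF that]] gc[OF that] by simp
  have "\<exists>w\<in>carrier (L\<lparr>carrier := A1\<rparr>). (\<forall>x\<in>carrier H_alg. w \<otimes> x \<in> W0) \<and>
    (\<forall>x\<in>carrier H_alg. eqmod (L\<lparr>carrier := A1\<rparr>) W0 (g x) (\<ominus>\<^bsub>L\<lparr>carrier := A1\<rparr>\<^esub> (x \<otimes> w)))"
  proof (rule B.anticocycle_inner[OF layer_central_free])
    show "g x \<in> carrier (L\<lparr>carrier := A1\<rparr>)" if "x \<in> carrier H_alg" for x using g(1) that by simp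
  next
    fix x y assume "x \<in> carrier H_alg" "y \<in> carrier H_alg"
    then have xy: "x \<in> H" "y \<in> H" by auto
    note c = gc[OF xy(1)] gc[OF xy(2)]
    \<comment> \<open>The H-component of D' x times y lies in H, and D'(x)y = d(x)y lies in
      \<open>G2\<close>; their difference is g(x)y.\<close>
    have "(D' x \<ominus> g x) \<otimes> y \<in> G2" using g(2)[OF xy(1)] H_mult xy H_G2 by (auto simp: eqmod_def)
    moreover have "y \<in> G2" using H_G2 xy(2) by blast
    then have "d x \<otimes> y \<in> G2" by (rule G2_mult[OF dH[OF xy(1)]])
    then have "D' x \<otimes> y \<in> G2" unfolding b(9)[OF c(3,6)] .
    moreover have "g x \<otimes> y = D' x \<otimes> y \<ominus> (D' x \<ominus> g x) \<otimes> y"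
    proof -
      have c': "D' x \<otimes> y \<in> carrier L" "g x \<otimes> y \<in> carrier L" using c mult_closed by auto
      show ?thesis unfolding mult_minus(2)[OF c(2,1,6)] using c' by algebra
    qed
    ultimately have "g x \<otimes> y \<in> G2" using g2(7) by simp
    then show "g x \<otimes> y \<in> W0" using ideal_mult(2)[OF A1_ideal c(6) g(1)[OF xy(1)]] by simp
    have "eqmod L H (g (x \<oplus> y)) (g x \<oplus> g y)"
    proof (rule eqmod_trans[OF sH g'[OF h(4)[OF xy]]])
      show "eqmod L H (D' (x \<oplus> y)) (g x \<oplus> g y)"
        unfolding b(4)[OF c(3,6)] by (rule eqmod_add[OF sH g(2)[OF xy(1)] g(2)[OF xy(2)]]) (use c in simp_all)
    qed (use c gc[OF h(4)[OF xy]] in simp_all)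
    then show "eqmod (L\<lparr>carrier := A1\<rparr>) W0 (g (x \<oplus>\<^bsub>H_alg\<^esub> y)) (g x \<oplus>\<^bsub>L\<lparr>carrier := A1\<rparr>\<^esub> g y)"
      using W0_eqmod g(1) h(4) a1(4) xy by simp
    have m: "eqmod L H (x \<otimes> D' y) (x \<otimes> g y)" "eqmod L H (y \<otimes> D' x) (y \<otimes> g x)"
      using g(2)[OF xy(1)] g(2)[OF xy(2)] H_mult xy c by (simp_all add: eqmod_def mult_minus[symmetric])
    have xg: "x \<otimes> g y \<in> A1" "y \<otimes> g x \<in> A1" using ideal_mult[OF A1_ideal] g(1) xy c by auto
    have "eqmod L H (g (x \<otimes> y)) (x \<otimes> g y \<ominus> y \<otimes> g x)"
    proof (rule eqmod_trans[OF sH g'[OF H_mult[OF xy]]])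
      show "eqmod L H (D' (x \<otimes> y)) (x \<otimes> g y \<ominus> y \<otimes> g x)"
        unfolding b(8)[OF c(3,6)] by (rule eqmod_minus[OF sH m]) (use c mult_closed in simp_all)
    qed (use c gc[OF H_mult[OF xy]] mult_closed in simp_all)
    then show "eqmod (L\<lparr>carrier := A1\<rparr>) W0 (g (x \<otimes>\<^bsub>H_alg\<^esub> y)) (x \<otimes> g y \<ominus>\<^bsub>L\<lparr>carrier := A1\<rparr>\<^esub> y \<otimes> g x)"
      using W0_eqmod g(1) H_mult a1(7) xg xy by (simp add: restrict_minus[OF A1_sub])
  next
    fix k x assume k: "k \<in> carrier F" and "x \<in> carrier H_alg"
    then have x: "x \<in> H" by auto
    note c = gc[OF x]
    have "eqmod L H (g (k \<odot> x)) (k \<odot> g x)"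
    proof (rule eqmod_trans[OF sH g'[OF h(5)[OF k x]]])
      show "eqmod L H (D' (k \<odot> x)) (k \<odot> g x)"
        unfolding b(6)[OF k c(3)] by (rule eqmod_smult[OF sH g(2)[OF x] k]) (use c in simp_all)
    qed (use c k gc[OF h(5)[OF k x]] in simp_all)
    then show "eqmod (L\<lparr>carrier := A1\<rparr>) W0 (g (k \<odot>\<^bsub>H_alg\<^esub> x)) (k \<odot>\<^bsub>L\<lparr>carrier := A1\<rparr>\<^esub> g x)"
      using W0_eqmod g(1) h(5) a1(5) k x by simp
  qed
  then obtain w where w: "w \<in> A1" "\<And>x. x \<in> H \<Longrightarrow> w \<otimes> x \<in> G2"
    "\<And>x. x \<in> H \<Longrightarrow> eqmod (L\<lparr>carrier := A1\<rparr>) W0 (g x) (\<ominus>\<^bsub>L\<lparr>carrier := A1\<rparr>\<^esub> (x \<otimes> w))"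
    by auto
  have "D' x \<oplus> x \<otimes> w \<in> G2" if x: "x \<in> H" for x
  proof -
    note c = gc[OF x]
    have xw: "x \<otimes> w \<in> A1" "x \<otimes> w \<in> carrier L" using ideal_mult[OF A1_ideal] w(1) c a1(3) mult_closed by auto
    have "g x \<ominus> (\<ominus> (x \<otimes> w)) \<in> G2"
      using w(3)[OF x] unfolding restrict_uminus[OF A1_sub xw(1)] restrict_eqmod[OF A1_sub g(1)[OF x] a1(6)[OF xw(1)]]
      by (simp add: eqmod_def)
    moreover have "D' x \<ominus> g x \<in> G2" using g(2)[OF x] H_G2 by (auto simp: eqmod_def)
    moreover have "D' x \<oplus> x \<otimes> w = (D' x \<ominus> g x) \<oplus> (g x \<ominus> (\<ominus> (x \<otimes> w)))"
      using c xw by algebra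
    ultimately show ?thesis using g2(4) by simp
  qed
  then show ?thesis using w(1,2) by blast
qed

end

text \<open>In each step v repairs d and then w repairs D'. The first repair changes D' only by
  elements of the ideal \<open>D i\<close>, so the hypothesis of \<open>right_layer\<close> survives
  it; the second changes d only inside H + \<open>D (Suc i)\<close>.\<close>

lemma biderivation_reduces:
  assumes b: "biderivation F L (d, D')"
  shows "\<exists>a\<in>carrier L. \<forall>x\<in>H. d x \<ominus> a \<otimes> x \<in> H <+>\<^bsub>L\<^esub> D i \<and> D' x \<oplus> x \<otimes> a \<in> H <+>\<^bsub>L\<^esub> D i"
proof (induction i)
  case 0
  have "carrier L \<subseteq> H <+>\<^bsub>L\<^esub> D 0" using set_add_right[OF sH] by simp
  moreover have "d x \<ominus> \<zero> \<otimes> x \<in> carrier L \<and> D' x \<oplus> x \<otimes> \<zero> \<in> carrier L" if "x \<in> H" for x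
    using biderivationD(1,2)[OF b] h(3)[OF that] by simp
  ultimately show ?case by (intro bexI[of _ \<zero>]) auto
next
  case (Suc i)
  note bb = biderivationD[OF b]
  note gD = subspaceD[OF G2_sub[of i]]
  obtain a where a: "a \<in> carrier L"
    "\<And>x. x \<in> H \<Longrightarrow> d x \<ominus> a \<otimes> x \<in> H <+>\<^bsub>L\<^esub> D i" "\<And>x. x \<in> H \<Longrightarrow> D' x \<oplus> x \<otimes> a \<in> H <+>\<^bsub>L\<^esub> D i"
    using Suc by blast
  have b1: "biderivation F L (\<lambda>x. d x \<ominus> a \<otimes> x, \<lambda>x. D' x \<oplus> x \<otimes> a)" by (rule biderivation_minus_inner[OF b a(1)])
  obtain v where v: "v \<in> D i" "\<And>x. x \<in> H \<Longrightarrow> (d x \<ominus> a \<otimes> x) \<ominus> v \<otimes> x \<in> H <+>\<^bsub>L\<^esub> D (Suc i)"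
    using left_layer[OF b1 a(2)] by blast
  have vc: "v \<in> carrier L" using v(1) ideal_carrier[OF derived_ideal] by blast
  have b2: "biderivation F L (\<lambda>x. (d x \<ominus> a \<otimes> x) \<ominus> v \<otimes> x, \<lambda>x. (D' x \<oplus> x \<otimes> a) \<oplus> x \<otimes> v)"
    by (rule biderivation_minus_inner[OF b1 vc])
  have D2: "(D' x \<oplus> x \<otimes> a) \<oplus> x \<otimes> v \<in> H <+>\<^bsub>L\<^esub> D i" if x: "x \<in> H" for x
  proof -
    have "x \<otimes> v \<in> D i" using ideal_mult(1)[OF derived_ideal h(3)[OF x] v(1)] .
    then have "x \<otimes> v \<in> H <+>\<^bsub>L\<^esub> D i" using set_add_right[OF sH ideal_carrier[OF derived_ideal]] by blast
    then show ?thesis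
      using a(3)[OF x] subspaceD(4)[OF subspace_set_add[OF sH ideal_subspace[OF derived_ideal]]] by blast
  qed
  obtain w where w: "w \<in> D i" "\<And>x. x \<in> H \<Longrightarrow> w \<otimes> x \<in> H <+>\<^bsub>L\<^esub> D (Suc i)"
    "\<And>x. x \<in> H \<Longrightarrow> ((D' x \<oplus> x \<otimes> a) \<oplus> x \<otimes> v) \<oplus> x \<otimes> w \<in> H <+>\<^bsub>L\<^esub> D (Suc i)"
    using right_layer[OF b2 v(2) D2] by blast
  have wc: "w \<in> carrier L" using w(1) ideal_carrier[OF derived_ideal] by blast
  \<comment> \<open>Inner biderivations are additive in the element, so the successive corrections
    collect into one.\<close>
  define e where "e = a \<oplus> (v \<oplus> w)"
  have ec: "e \<in> carrier L" using a(1) vc wc by (simp add: e_def)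
  have "d x \<ominus> e \<otimes> x \<in> H <+>\<^bsub>L\<^esub> D (Suc i) \<and> D' x \<oplus> x \<otimes> e \<in> H <+>\<^bsub>L\<^esub> D (Suc i)" if x: "x \<in> H" for x
  proof
    note xc = h(3)[OF x]
    have c: "d x \<in> carrier L" "D' x \<in> carrier L" "a \<otimes> x \<in> carrier L" "v \<otimes> x \<in> carrier L" "w \<otimes> x \<in> carrier L"
      "x \<otimes> a \<in> carrier L" "x \<otimes> v \<in> carrier L" "x \<otimes> w \<in> carrier L"
      using bb(1,2) xc a(1) vc wc mult_closed by auto
    have ex: "e \<otimes> x = a \<otimes> x \<oplus> (v \<otimes> x \<oplus> w \<otimes> x)" "x \<otimes> e = x \<otimes> a \<oplus> (x \<otimes> v \<oplus> x \<otimes> w)"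
      using a(1) vc wc xc by (simp_all add: e_def mult_add_left mult_add_right)
    have "d x \<ominus> e \<otimes> x = ((d x \<ominus> a \<otimes> x) \<ominus> v \<otimes> x) \<ominus> w \<otimes> x" unfolding ex using c by algebra
    then show "d x \<ominus> e \<otimes> x \<in> H <+>\<^bsub>L\<^esub> D (Suc i)" using gD(7)[OF v(2)[OF x] w(2)[OF x]] by simp
    have "D' x \<oplus> x \<otimes> e = ((D' x \<oplus> x \<otimes> a) \<oplus> x \<otimes> v) \<oplus> x \<otimes> w" unfolding ex using c by (simp add: M.a_assoc)
    then show "D' x \<oplus> x \<otimes> e \<in> H <+>\<^bsub>L\<^esub> D (Suc i)" using w(3)[OF x] by simp
  qed
  then show ?case using ec by blast
qed

lemma projector_intravariant: "intravariant F L H"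
  unfolding intravariant_def
proof (intro conjI allI impI)
  show "subalgebra F L H" by (rule subH)
  fix b assume b: "biderivation F L b \<and> close F L b"
  obtain d D' where bd: "b = (d, D')" by (cases b)
  then have bi: "biderivation F L (d, D')" using b by simp
  \<comment> \<open>At this stage H + \<open>D n\<close> is H itself, so the reduced biderivation
    stabilises H.\<close>
  obtain n where n: "D n = {\<zero>}" using solubleD(3)[OF solL] by blast
  obtain a where a: "a \<in> carrier L" "\<And>x. x \<in> H \<Longrightarrow> d x \<ominus> a \<otimes> x \<in> H" "\<And>x. x \<in> H \<Longrightarrow> D' x \<oplus> x \<otimes> a \<in> H"
    using biderivation_reduces[OF bi, of n] by (auto simp: n set_add_zero[OF h(1)])
  define b' where "b' = (\<lambda>x. d x \<ominus> a \<otimes> x, \<lambda>x. D' x \<oplus> x \<otimes> a)"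
  have "biderivation F L b'" unfolding b'_def by (rule biderivation_minus_inner[OF bi a(1)])
  moreover have "stabilises b' H" using a(2,3) by (auto simp: stabilises_def b'_def)
  moreover have "is_sum_of L b (inner_biderivation L a) b'"
    unfolding is_sum_of_def
  proof
    fix x assume x: "x \<in> carrier L"
    have c: "d x \<in> carrier L" "D' x \<in> carrier L" "a \<otimes> x \<in> carrier L" "x \<otimes> a \<in> carrier L"
      using biderivationD(1,2)[OF bi] x a(1) mult_closed by auto
    have "d x = a \<otimes> x \<oplus> (d x \<ominus> a \<otimes> x)" "D' x = \<ominus> (x \<otimes> a) \<oplus> (D' x \<oplus> x \<otimes> a)" using c by algebra+
    then show "fst b x = fst (inner_biderivation L a) x \<oplus> fst b' x \<and> snd b x = snd (inner_biderivation L a) x \<oplus> snd b' x"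
      by (simp add: bd b'_def inner_biderivation_def)
  qed
  ultimately show "\<exists>a\<in>carrier L. \<exists>b'. biderivation F L b' \<and> stabilises b' H \<and> is_sum_of L b (inner_biderivation L a) b'"
    using a(1) by blast
qed

end

theorem mainTheorem2:
  fixes F :: "('f, 'm) ring_scheme"
    and L :: "('f, 'a) module"
    and \<HH> :: "'f alg_class"
    and H :: "'a set"
  assumes "field F"
    and "schunck_formation F \<HH>"
    and "soluble_leibniz F L"
    and "projector F \<HH> L H"
  shows "intravariant F L H"
proof -
  have "projector_setup F L \<HH> H"
    using assms solubleD(1)[OF assms(3)]
    by (simp add: projector_setup_def projector_setup_axioms_def schunck_formation_class_def)
  then show ?thesis by (rule projector_setup.projector_intravariant)
qed

end
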